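(* Let $(M,F)$ be an $n$-dimensional Finsler manifold. If the Berwald scalar curvature $\mathsf{e}$ is constant and the mean stretch curvature vanishes, $\bar\Sigma=0$, then the $S$-curvature of $F$ satisfies $$S=\frac{1}{n-1}\,\mathsf{e}+\pi^*\xi(\mathbf{G})$$ for some $\xi\in\Omega^1(M)$ with $d\xi=0$, i.e., $S$ is almost constant.
   Context: Indices: $i,j,k,l,p,q$ run over $1,\dots,n$; $\alpha,\beta,\gamma,\mu$ run over $1,\dots,n-1$; $\bar\alpha:=n+\alpha$; repeated indices are summed; $n\ge 2$. Finsler setup. $F:TM\to[0,\infty)$ is continuous, smooth on $TM\setminus 0$, positively $1$-homogeneous in $y$, and $g_{ij}=\frac12[F^2]_{y^iy^j}$ is positive definite on $TM\setminus0$. $SM=\{(x,y)\in TM: F(x,y)=1\}$ with projection $\pi:SM\to M$; objects on $TM\setminus 0$ that are $0$-homogeneous in $y$ are regarded as objects on $SM$. Spray coefficients $G^i=\frac14 g^{il}([F^2]_{x^ky^l}y^k-[F^2]_{x^l})$, $N^i_k=\partial G^i/\partial y^k$, $\frac{\delta}{\delta x^i}=\frac{\partial}{\partial x^i}-N^k_i\frac{\partial}{\partial y^k}$, $\delta y^i=dy^i+N^i_kdx^k$. A local adapted frame of $T(SM)$ is $\mathbf{e}_i=u_i^j\frac{\delta}{\delta x^j}$, $\mathbf{e}_{\bar\alpha}=-u_\alpha^jF\frac{\partial}{\partial y^j}$, where $g_{kl}u^k_iu^l_j=\delta_{ij}$ and $u_n^i=y^i/F$; its dual coframe is $\omega^i,\omega^{\bar\alpha}$.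 Thus $\mathbf{e}_n=\mathbf{G}=\frac{y^i}{F}\frac{\delta}{\delta x^i}$ is the Reeb field and $\omega^n=F_{y^i}dx^i$ is the Hilbert form. $H(SM)$ is the bundle spanned by $\mathbf{e}_1,\dots,\mathbf{e}_n$. Chern connection. $\nabla^{\rm Ch}\mathbf{e}_i=\omega_i^j\otimes\mathbf{e}_j$ on $H(SM)$ is determined by $d\omega^i=\omega^j\wedge\omega^i_j$ and $\omega^i_j+\omega^j_i=-2H_{ij}$, where $H_{ij}=H_{ij\gamma}\omega^{\bar\gamma}$, $H_{ij\gamma}=-A_{pqk}u_i^pu_j^qu_\gamma^k$, $A_{pqk}=\frac14F[F^2]_{y^py^qy^k}$; moreover $\omega^n_\alpha=-\omega^\alpha_n=\omega^{\bar\alpha}$, $\omega^n_n=0$. Its curvature forms are $\Omega^i_j=d\omega^i_j-\omega^k_j\wedge\omega^i_k=\frac12R^{~i}_{j~kl}\omega^k\wedge\omega^l+P^{~i}_{j~k\gamma}\omega^k\wedge\omega^{\bar\gamma}$; $R$ denotes the $hh$-part and $\mathrm{tr}[R]=\frac12R^{~i}_{i~kl}\omega^k\wedge\omega^l$. The Landsberg curvature has components $L^i_{j\gamma}=-P^{~i}_{j~n\gamma}$. Berwald connection. Its connection forms are $\tilde\omega^i_j=\omega^i_j-L^i_{j\alpha}\omega^\alpha$ (in natural coordinates, $\frac{\partial^2G^i}{\partial y^j\partial y^k}dx^k$), with curvature forms $\tilde\Omega^i_j=d\tilde\omega^i_j-\tilde\omega^k_j\wedge\tilde\omega^i_k=\frac12\tilde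 R^{~i}_{j~kl}\omega^k\wedge\omega^l+\tilde P^{~i}_{j~k\gamma}\omega^k\wedge\omega^{\bar\gamma}$; $\mathrm{tr}[\tilde R]=\frac12\tilde R^{~i}_{i~kl}\omega^k\wedge\omega^l$. The mean stretch curvature is the $2$-form $\bar\Sigma:=2\,\mathrm{tr}[\tilde R-R]$. The mean Berwald curvature is $\mathbf{E}=\mathrm{tr}\tilde P=\tilde P^{~i}_{i~\gamma\mu}\omega^\gamma\wedge\omega^{\bar\mu}=:E_{\gamma\mu}\omega^\gamma\wedge\omega^{\bar\mu}$, and the Berwald scalar curvature is the function $\mathsf{e}=\mathrm{tr}\,\mathbf{E}=\sum_\gamma E_{\gamma\gamma}$ on $SM$. $S$-curvature. Fix a volume form $dV_M=\sigma(x)\,dx^1\wedge\cdots\wedge dx^n$, $\sigma>0$, on $M$ (a positive density if $M$ is not orientable). The distortion is $\tau=\ln\frac{\sqrt{\det(g_{ij})}}{\sigma(x)}$, and $S:=\mathbf{G}(\tau)$ is a function on $SM$, called the $S$-curvature. It is almost constant if $S=\frac{1}{n-1}c+\pi^*\xi(\mathbf{G})$ with $c$ constant and $\xi\in\Omega^1(M)$ closed. *)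

theory Defs
  imports "HOL-Analysis.Analysis"
begin

section \<open>Smooth functions and differential forms on open subsets of Euclidean space\<close>

primrec Ck_on :: "nat \<Rightarrow> 'a::euclidean_space set \<Rightarrow> ('a \<Rightarrow> 'b::real_normed_vector) \<Rightarrow> bool" where
  "Ck_on 0 S f \<longleftrightarrow> continuous_on S f"
| "Ck_on (Suc k) S f \<longleftrightarrow> (\<forall>x\<in>S. f differentiable (at x)) \<and>
     (\<forall>v. Ck_on k S (\<lambda>x. frechet_derivative f (at x) v))"

definition smooth_on :: "'a::euclidean_space set \<Rightarrow> ('a \<Rightarrow> 'b::real_normed_vector) \<Rightarrow> bool" where
  "smooth_on S f \<longleftrightarrow> open S \<and> (\<forall>k. Ck_on k S f)"

text \<open>A 1-form is a map taking a point and a tangent vector at that point, a 2-form takes a point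
  and two tangent vectors; \<open>wedge\<close> acts on covectors at one point.\<close>

definition wedge :: "('v \<Rightarrow> real) \<Rightarrow> ('v \<Rightarrow> real) \<Rightarrow> 'v \<Rightarrow> 'v \<Rightarrow> real" where
  "wedge \<alpha> \<beta> a b = \<alpha> a * \<beta> b - \<alpha> b * \<beta> a"

definition ext_d :: "('v::real_normed_vector \<Rightarrow> 'v \<Rightarrow> real) \<Rightarrow> 'v \<Rightarrow> 'v \<Rightarrow> 'v \<Rightarrow> real" where
  "ext_d \<omega> z a b = frechet_derivative (\<lambda>w. \<omega> w b) (at z) a - frechet_derivative (\<lambda>w. \<omega> w a) (at z) b"


section \<open>Smooth manifolds, tangent vectors, 1-forms and densities\<close>

type_synonym ('m, 'n) chart = "'m set \<times> ('m \<Rightarrow> real ^ 'n)"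

definition chart_image :: "('m, 'n::finite) chart \<Rightarrow> (real ^ 'n) set" where
  "chart_image c = snd c ` fst c"

definition chart_inv :: "('m, 'n::finite) chart \<Rightarrow> real ^ 'n \<Rightarrow> 'm" where
  "chart_inv c = inv_into (fst c) (snd c)"

definition transition :: "('m, 'n::finite) chart \<Rightarrow> ('m, 'n) chart \<Rightarrow> real ^ 'n \<Rightarrow> real ^ 'n" where
  "transition c c' x = snd c' (chart_inv c x)"

definition jacobian :: "('m, 'n::finite) chart \<Rightarrow> ('m, 'n) chart \<Rightarrow> 'm \<Rightarrow> real ^ 'n \<Rightarrow> real ^ 'n" where
  "jacobian c c' p = frechet_derivative (transition c c') (at (snd c p))"

definition smooth_manifold :: "'m topology \<Rightarrow> ('m, 'n::finite) chart set \<Rightarrow> bool" where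
  "smooth_manifold X A \<longleftrightarrow>
     Hausdorff_space X \<and> second_countable X \<and>
     \<Union>(fst ` A) = topspace X \<and>
     (\<forall>c\<in>A. openin X (fst c) \<and> open (chart_image c) \<and>
        homeomorphic_map (subtopology X (fst c)) (top_of_set (chart_image c)) (snd c)) \<and>
     (\<forall>c\<in>A. \<forall>c'\<in>A. smooth_on (snd c ` (fst c \<inter> fst c')) (transition c c'))"

text \<open>A tangent vector at \<open>p\<close> is a family of coordinate vectors, one for each chart around \<open>p\<close>,
  related by the Jacobians of the transition maps (and \<open>0\<close> at all other arguments).\<close>

type_synonym ('m, 'n) tvec = "('m, 'n) chart \<Rightarrow> real ^ 'n"

definition tangent_space :: "('m, 'n::finite) chart set \<Rightarrow> 'm \<Rightarrow> ('m, 'n) tvec set" where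
  "tangent_space A p = {v.
     (\<forall>c\<in>A. \<forall>c'\<in>A. p \<in> fst c \<and> p \<in> fst c' \<longrightarrow> v c' = jacobian c c' p (v c)) \<and>
     (\<forall>c. \<not> (c \<in> A \<and> p \<in> fst c) \<longrightarrow> v c = 0)}"

text \<open>The tangent vector \<open>y\<^sup>i \<partial>/\<partial>x\<^sup>i\<close> at \<open>p\<close> in the coordinates of the chart \<open>c\<close>.\<close>

definition coord_vec ::
    "('m, 'n::finite) chart set \<Rightarrow> ('m, 'n) chart \<Rightarrow> 'm \<Rightarrow> real ^ 'n \<Rightarrow> ('m, 'n) tvec" where
  "coord_vec A c p y = (\<lambda>c'. if c' \<in> A \<and> p \<in> fst c' then jacobian c c' p y else 0)"

text \<open>Coordinate expression \<open>(x, y) \<mapsto> F(x, y)\<close> of a function on the tangent bundle.\<close>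

definition rep :: "('m, 'n::finite) chart set \<Rightarrow> ('m \<Rightarrow> ('m, 'n) tvec \<Rightarrow> real) \<Rightarrow> ('m, 'n) chart \<Rightarrow>
    (real ^ 'n) \<times> (real ^ 'n) \<Rightarrow> real" where
  "rep A F c z = F (chart_inv c (fst z)) (coord_vec A c (chart_inv c (fst z)) (snd z))"

text \<open>Coordinate expression of a 1-form on the manifold.\<close>

definition rep_form :: "('m, 'n::finite) chart set \<Rightarrow> ('m \<Rightarrow> ('m, 'n) tvec \<Rightarrow> real) \<Rightarrow> ('m, 'n) chart \<Rightarrow>
    real ^ 'n \<Rightarrow> real ^ 'n \<Rightarrow> real" where
  "rep_form A \<xi> c x a = \<xi> (chart_inv c x) (coord_vec A c (chart_inv c x) a)"

definition smooth_one_form ::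
    "'m topology \<Rightarrow> ('m, 'n::finite) chart set \<Rightarrow> ('m \<Rightarrow> ('m, 'n) tvec \<Rightarrow> real) \<Rightarrow> bool" where
  "smooth_one_form X A \<xi> \<longleftrightarrow>
     (\<forall>p\<in>topspace X. \<forall>v\<in>tangent_space A p. \<forall>w\<in>tangent_space A p. \<forall>s t.
        \<xi> p (\<lambda>c. s *\<^sub>R v c + t *\<^sub>R w c) = s * \<xi> p v + t * \<xi> p w) \<and>
     (\<forall>c\<in>A. \<forall>a. smooth_on (chart_image c) (\<lambda>x. rep_form A \<xi> c x a))"

definition closed_one_form ::
    "('m, 'n::finite) chart set \<Rightarrow> ('m \<Rightarrow> ('m, 'n) tvec \<Rightarrow> real) \<Rightarrow> bool" where
  "closed_one_form A \<xi> \<longleftrightarrow> (\<forall>c\<in>A. \<forall>x\<in>chart_image c. \<forall>a b. ext_d (rep_form A \<xi> c) x a b = 0)"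

text \<open>\<open>\<sigma> c\<close> is the coefficient of the density in the chart \<open>c\<close>. A volume form on an oriented
  manifold gives such a density, so both cases are covered.\<close>

definition positive_density ::
    "('m, 'n::finite) chart set \<Rightarrow> (('m, 'n) chart \<Rightarrow> real ^ 'n \<Rightarrow> real) \<Rightarrow> bool" where
  "positive_density A \<sigma> \<longleftrightarrow>
     (\<forall>c\<in>A. smooth_on (chart_image c) (\<sigma> c) \<and> (\<forall>x\<in>chart_image c. \<sigma> c x > 0)) \<and>
     (\<forall>c\<in>A. \<forall>c'\<in>A. \<forall>p\<in>fst c \<inter> fst c'.
        \<sigma> c (snd c p) = \<bar>det (matrix (jacobian c c' p))\<bar> * \<sigma> c' (snd c' p))"


section \<open>Finsler metrics in natural coordinates\<close>

text \<open>From here on \<open>f\<close> is the coordinate expression of \<open>F\<close>, and \<open>z = (x, y)\<close>.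
  \<open>dX i\<close> and \<open>dY i\<close> are the partial derivatives with respect to \<open>x\<^sup>i\<close> and \<open>y\<^sup>i\<close>.\<close>

type_synonym 'n tb = "(real ^ 'n) \<times> (real ^ 'n)"

definition dX :: "'n::finite \<Rightarrow> ('n tb \<Rightarrow> real) \<Rightarrow> 'n tb \<Rightarrow> real" where
  "dX i h z = frechet_derivative h (at z) (axis i 1, 0)"

definition dY :: "'n::finite \<Rightarrow> ('n tb \<Rightarrow> real) \<Rightarrow> 'n tb \<Rightarrow> real" where
  "dY i h z = frechet_derivative h (at z) (0, axis i 1)"

definition gmat :: "('n::finite tb \<Rightarrow> real) \<Rightarrow> 'n tb \<Rightarrow> real ^ 'n ^ 'n" where
  "gmat f z = (\<chi> i j. 1/2 * dY j (dY i (\<lambda>w. (f w)\<^sup>2)) z)"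

definition slit :: "('m, 'n::finite) chart \<Rightarrow> 'n tb set" where
  "slit c = {z. fst z \<in> chart_image c \<and> snd z \<noteq> 0}"

definition finsler_metric ::
    "'m topology \<Rightarrow> ('m, 'n::finite) chart set \<Rightarrow> ('m \<Rightarrow> ('m, 'n) tvec \<Rightarrow> real) \<Rightarrow> bool" where
  "finsler_metric X A F \<longleftrightarrow>
     (\<forall>p\<in>topspace X. \<forall>v\<in>tangent_space A p.
        F p v \<ge> 0 \<and> (\<forall>t>0. F p (\<lambda>c. t *\<^sub>R v c) = t * F p v)) \<and>
     (\<forall>c\<in>A. continuous_on (chart_image c \<times> UNIV) (rep A F c) \<and>
        smooth_on (slit c) (rep A F c) \<and>
        (\<forall>z\<in>slit c. \<forall>w. w \<noteq> 0 \<longrightarrow>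
           (\<Sum>i\<in>UNIV. \<Sum>j\<in>UNIV. gmat (rep A F c) z $ i $ j * w $ i * w $ j) > 0))"

definition spray :: "('n::finite tb \<Rightarrow> real) \<Rightarrow> 'n \<Rightarrow> 'n tb \<Rightarrow> real" where
  "spray f i z = 1/4 * (\<Sum>l\<in>UNIV. matrix_inv (gmat f z) $ i $ l *
      ((\<Sum>k\<in>UNIV. dY l (dX k (\<lambda>w. (f w)\<^sup>2)) z * snd z $ k) - dX l (\<lambda>w. (f w)\<^sup>2) z))"

text \<open>\<open>nonlin f i k\<close> is \<open>N\<^sup>i\<^sub>k\<close>, \<open>delta_x f i\<close> is \<open>\<delta>/\<delta>x\<^sup>i\<close> and \<open>delta_y f i\<close> is \<open>\<delta>y\<^sup>i\<close>.\<close>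

definition nonlin :: "('n::finite tb \<Rightarrow> real) \<Rightarrow> 'n \<Rightarrow> 'n \<Rightarrow> 'n tb \<Rightarrow> real" where
  "nonlin f i k = dY k (spray f i)"

definition delta_x :: "('n::finite tb \<Rightarrow> real) \<Rightarrow> 'n \<Rightarrow> 'n tb \<Rightarrow> 'n tb" where
  "delta_x f i z = (axis i 1, - (\<chi> k. nonlin f k i z))"

definition delta_y :: "('n::finite tb \<Rightarrow> real) \<Rightarrow> 'n \<Rightarrow> 'n tb \<Rightarrow> 'n tb \<Rightarrow> real" where
  "delta_y f i z a = snd a $ i + (\<Sum>k\<in>UNIV. nonlin f i k z * fst a $ k)"

definition reeb :: "('n::finite tb \<Rightarrow> real) \<Rightarrow> 'n tb \<Rightarrow> 'n tb" where
  "reeb f z = (\<Sum>i\<in>UNIV. (snd z $ i / f z) *\<^sub>R delta_x f i z)"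

text \<open>\<open>A\<^sub>p\<^sub>q\<^sub>k\<close>\<close>

definition cartan :: "('n::finite tb \<Rightarrow> real) \<Rightarrow> 'n \<Rightarrow> 'n \<Rightarrow> 'n \<Rightarrow> 'n tb \<Rightarrow> real" where
  "cartan f p q k z = 1/4 * f z * dY k (dY q (dY p (\<lambda>w. (f w)\<^sup>2))) z"


section \<open>Adapted frames\<close>

text \<open>Functions and forms on the unit sphere bundle are represented by 0-homogeneous objects
  on the slit tangent bundle, i.e. by their pullbacks under \<open>(x, y) \<mapsto> (x, y/F)\<close>; this pullback
  commutes with the exterior derivative. In particular the forms \<open>co_h\<close>, \<open>co_v\<close> below vanish on
  the radial field \<open>y\<^sup>i \<partial>/\<partial>y\<^sup>i\<close>. Open subsets of the sphere bundle correspond to open conic sets.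

  The index type \<open>'n\<close> carries a marked element \<open>m\<close>, which plays the role of the last index \<open>n\<close>;
  Greek indices range over \<open>- {m}\<close>. \<open>u i z $ j\<close> is \<open>u\<^sub>i\<^sup>j\<close>.\<close>

definition adapted_frame ::
    "'n::finite \<Rightarrow> ('n tb \<Rightarrow> real) \<Rightarrow> 'n tb set \<Rightarrow> ('n \<Rightarrow> 'n tb \<Rightarrow> real ^ 'n) \<Rightarrow> bool" where
  "adapted_frame m f W u \<longleftrightarrow>
     open W \<and> (\<forall>(x, y)\<in>W. \<forall>t>0. (x, t *\<^sub>R y) \<in> W) \<and>
     (\<forall>i. smooth_on W (u i) \<and> (\<forall>(x, y)\<in>W. \<forall>t>0. u i (x, t *\<^sub>R y) = u i (x, y))) \<and>
     (\<forall>z\<in>W. \<forall>i j. (\<Sum>k\<in>UNIV. \<Sum>l\<in>UNIV. gmat f z $ k $ l * u i z $ k * u j z $ l) =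
        (if i = j then 1 else 0)) \<and>
     (\<forall>z\<in>W. u m z = (1 / f z) *\<^sub>R snd z)"

definition e_h :: "('n::finite tb \<Rightarrow> real) \<Rightarrow> ('n \<Rightarrow> 'n tb \<Rightarrow> real ^ 'n) \<Rightarrow> 'n \<Rightarrow> 'n tb \<Rightarrow> 'n tb" where
  "e_h f u i z = (\<Sum>j\<in>UNIV. u i z $ j *\<^sub>R delta_x f j z)"

definition e_v :: "('n::finite tb \<Rightarrow> real) \<Rightarrow> ('n \<Rightarrow> 'n tb \<Rightarrow> real ^ 'n) \<Rightarrow> 'n \<Rightarrow> 'n tb \<Rightarrow> 'n tb" where
  "e_v f u \<alpha> z = (0, - (f z *\<^sub>R u \<alpha> z))"

text \<open>The inverse matrix \<open>v\<^sup>i\<^sub>j\<close> of \<open>u\<^sub>i\<^sup>j\<close>, and the dual coframe \<open>\<omega>\<^sup>i = v\<^sup>i\<^sub>j dx\<^sup>j\<close>,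
  \<open>\<omega>\<close> with barred index \<open>\<alpha>\<close> equal to \<open>- v\<^sup>\<alpha>\<^sub>j \<delta>y\<^sup>j / F\<close>.\<close>

definition coframe_mat :: "('n::finite \<Rightarrow> 'n tb \<Rightarrow> real ^ 'n) \<Rightarrow> 'n tb \<Rightarrow> real ^ 'n ^ 'n" where
  "coframe_mat u z = matrix_inv (\<chi> j i. u i z $ j)"

definition co_h :: "('n::finite \<Rightarrow> 'n tb \<Rightarrow> real ^ 'n) \<Rightarrow> 'n \<Rightarrow> 'n tb \<Rightarrow> 'n tb \<Rightarrow> real" where
  "co_h u i z a = (\<Sum>j\<in>UNIV. coframe_mat u z $ i $ j * fst a $ j)"

definition co_v :: "('n::finite tb \<Rightarrow> real) \<Rightarrow> ('n \<Rightarrow> 'n tb \<Rightarrow> real ^ 'n) \<Rightarrow> 'n \<Rightarrow> 'n tb \<Rightarrow> 'n tb \<Rightarrow> real" where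
  "co_v f u \<alpha> z a = - (1 / f z) * (\<Sum>j\<in>UNIV. coframe_mat u z $ \<alpha> $ j * delta_y f j z a)"


section \<open>Chern and Berwald connections\<close>

text \<open>A family \<open>w i j\<close> of 1-forms stands for connection forms \<open>\<omega>\<^sup>i\<^sub>j\<close> (upper index first).\<close>

definition H_coeff :: "('n::finite tb \<Rightarrow> real) \<Rightarrow> ('n \<Rightarrow> 'n tb \<Rightarrow> real ^ 'n) \<Rightarrow> 'n \<Rightarrow> 'n \<Rightarrow> 'n \<Rightarrow> 'n tb \<Rightarrow> real" where
  "H_coeff f u i j \<gamma> z = - (\<Sum>p\<in>UNIV. \<Sum>q\<in>UNIV. \<Sum>k\<in>UNIV.
      cartan f p q k z * u i z $ p * u j z $ q * u \<gamma> z $ k)"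

definition H_form :: "'n::finite \<Rightarrow> ('n tb \<Rightarrow> real) \<Rightarrow> ('n \<Rightarrow> 'n tb \<Rightarrow> real ^ 'n) \<Rightarrow> 'n \<Rightarrow> 'n \<Rightarrow>
    'n tb \<Rightarrow> 'n tb \<Rightarrow> real" where
  "H_form m f u i j z a = (\<Sum>\<gamma>\<in>-{m}. H_coeff f u i j \<gamma> z * co_v f u \<gamma> z a)"

text \<open>The structure equations determine the values \<open>\<theta> i j\<close> of the connection forms at each point
  algebraically.\<close>

definition is_chern_at :: "'n::finite \<Rightarrow> ('n tb \<Rightarrow> real) \<Rightarrow> ('n \<Rightarrow> 'n tb \<Rightarrow> real ^ 'n) \<Rightarrow> 'n tb \<Rightarrow>
    ('n \<Rightarrow> 'n \<Rightarrow> 'n tb \<Rightarrow> real) \<Rightarrow> bool" where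
  "is_chern_at m f u z \<theta> \<longleftrightarrow>
     (\<forall>i j. linear (\<theta> i j)) \<and>
     (\<forall>i a b. ext_d (co_h u i) z a b = (\<Sum>j\<in>UNIV. wedge (co_h u j z) (\<theta> i j) a b)) \<and>
     (\<forall>i j a. \<theta> i j a + \<theta> j i a = - 2 * H_form m f u i j z a)"

definition chern :: "'n::finite \<Rightarrow> ('n tb \<Rightarrow> real) \<Rightarrow> ('n \<Rightarrow> 'n tb \<Rightarrow> real ^ 'n) \<Rightarrow> 'n \<Rightarrow> 'n \<Rightarrow>
    'n tb \<Rightarrow> 'n tb \<Rightarrow> real" where
  "chern m f u i j z = (THE \<theta>. is_chern_at m f u z \<theta>) i j"

definition curv_form :: "('n::finite \<Rightarrow> 'n \<Rightarrow> 'n tb \<Rightarrow> 'n tb \<Rightarrow> real) \<Rightarrow> 'n \<Rightarrow> 'n \<Rightarrow>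
    'n tb \<Rightarrow> 'n tb \<Rightarrow> 'n tb \<Rightarrow> real" where
  "curv_form w i j z a b = ext_d (w i j) z a b - (\<Sum>k\<in>UNIV. wedge (w k j z) (w i k z) a b)"

text \<open>Components \<open>R\<close> with indices \<open>i j k l\<close> and \<open>P\<close> with indices \<open>i j k \<gamma>\<close> of the curvature
  forms, i.e. the coefficients of \<open>1/2 \<omega>\<^sup>k \<and> \<omega>\<^sup>l\<close> (antisymmetric in \<open>k, l\<close>) and of
  \<open>\<omega>\<^sup>k\<close> wedge the vertical coframe.\<close>

definition hh_coeff :: "('n::finite tb \<Rightarrow> real) \<Rightarrow> ('n \<Rightarrow> 'n tb \<Rightarrow> real ^ 'n) \<Rightarrow>
    ('n \<Rightarrow> 'n \<Rightarrow> 'n tb \<Rightarrow> 'n tb \<Rightarrow> real) \<Rightarrow> 'n \<Rightarrow> 'n \<Rightarrow> 'n \<Rightarrow> 'n \<Rightarrow> 'n tb \<Rightarrow> real" where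
  "hh_coeff f u w i j k l z = curv_form w i j z (e_h f u k z) (e_h f u l z)"

definition hv_coeff :: "('n::finite tb \<Rightarrow> real) \<Rightarrow> ('n \<Rightarrow> 'n tb \<Rightarrow> real ^ 'n) \<Rightarrow>
    ('n \<Rightarrow> 'n \<Rightarrow> 'n tb \<Rightarrow> 'n tb \<Rightarrow> real) \<Rightarrow> 'n \<Rightarrow> 'n \<Rightarrow> 'n \<Rightarrow> 'n \<Rightarrow> 'n tb \<Rightarrow> real" where
  "hv_coeff f u w i j k \<gamma> z = curv_form w i j z (e_h f u k z) (e_v f u \<gamma> z)"

definition tr_hh :: "('n::finite tb \<Rightarrow> real) \<Rightarrow> ('n \<Rightarrow> 'n tb \<Rightarrow> real ^ 'n) \<Rightarrow>
    ('n \<Rightarrow> 'n \<Rightarrow> 'n tb \<Rightarrow> 'n tb \<Rightarrow> real) \<Rightarrow> 'n tb \<Rightarrow> 'n tb \<Rightarrow> 'n tb \<Rightarrow> real" where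
  "tr_hh f u w z a b = 1/2 * (\<Sum>i\<in>UNIV. \<Sum>k\<in>UNIV. \<Sum>l\<in>UNIV.
      hh_coeff f u w i i k l z * wedge (co_h u k z) (co_h u l z) a b)"

definition landsberg :: "'n::finite \<Rightarrow> ('n tb \<Rightarrow> real) \<Rightarrow> ('n \<Rightarrow> 'n tb \<Rightarrow> real ^ 'n) \<Rightarrow>
    'n \<Rightarrow> 'n \<Rightarrow> 'n \<Rightarrow> 'n tb \<Rightarrow> real" where
  "landsberg m f u i j \<gamma> z = - hv_coeff f u (chern m f u) i j m \<gamma> z"

definition berwald :: "'n::finite \<Rightarrow> ('n tb \<Rightarrow> real) \<Rightarrow> ('n \<Rightarrow> 'n tb \<Rightarrow> real ^ 'n) \<Rightarrow> 'n \<Rightarrow> 'n \<Rightarrow>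
    'n tb \<Rightarrow> 'n tb \<Rightarrow> real" where
  "berwald m f u i j z a =
     chern m f u i j z a - (\<Sum>\<alpha>\<in>-{m}. landsberg m f u i j \<alpha> z * co_h u \<alpha> z a)"

definition mean_stretch :: "'n::finite \<Rightarrow> ('n tb \<Rightarrow> real) \<Rightarrow> ('n \<Rightarrow> 'n tb \<Rightarrow> real ^ 'n) \<Rightarrow>
    'n tb \<Rightarrow> 'n tb \<Rightarrow> 'n tb \<Rightarrow> real" where
  "mean_stretch m f u z a b =
     2 * (tr_hh f u (berwald m f u) z a b - tr_hh f u (chern m f u) z a b)"

definition mean_berwald :: "'n::finite \<Rightarrow> ('n tb \<Rightarrow> real) \<Rightarrow> ('n \<Rightarrow> 'n tb \<Rightarrow> real ^ 'n) \<Rightarrow>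
    'n \<Rightarrow> 'n \<Rightarrow> 'n tb \<Rightarrow> real" where
  "mean_berwald m f u \<gamma> \<mu> z = (\<Sum>i\<in>UNIV. hv_coeff f u (berwald m f u) i i \<gamma> \<mu> z)"

definition berwald_scalar :: "'n::finite \<Rightarrow> ('n tb \<Rightarrow> real) \<Rightarrow> ('n \<Rightarrow> 'n tb \<Rightarrow> real ^ 'n) \<Rightarrow>
    'n tb \<Rightarrow> real" where
  "berwald_scalar m f u z = (\<Sum>\<gamma>\<in>-{m}. mean_berwald m f u \<gamma> \<gamma> z)"


section \<open>The S-curvature\<close>

definition distortion :: "('n::finite tb \<Rightarrow> real) \<Rightarrow> (real ^ 'n \<Rightarrow> real) \<Rightarrow> 'n tb \<Rightarrow> real" where
  "distortion f s z = ln (sqrt (det (gmat f z)) / s (fst z))"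

definition S_curvature :: "('n::finite tb \<Rightarrow> real) \<Rightarrow> (real ^ 'n \<Rightarrow> real) \<Rightarrow> 'n tb \<Rightarrow> real" where
  "S_curvature f s z = frechet_derivative (distortion f s) (at z) (reeb f z)"


section \<open>Global objects on the unit sphere bundle\<close>

definition sphere_bundle ::
    "('m, 'n::finite) chart set \<Rightarrow> ('m \<Rightarrow> ('m, 'n) tvec \<Rightarrow> real) \<Rightarrow> ('m, 'n) chart \<Rightarrow> 'n tb set" where
  "sphere_bundle A F c = {z \<in> slit c. rep A F c z = 1}"

text \<open>The Berwald scalar curvature and the mean stretch curvature depend neither on the adapted
  frame nor on the chart, so equations for them are imposed in every chart and every local
  adapted frame.\<close>

definition berwald_scalar_constant ::
    "'n::finite \<Rightarrow> ('m, 'n) chart set \<Rightarrow> ('m \<Rightarrow> ('m, 'n) tvec \<Rightarrow> real) \<Rightarrow> real \<Rightarrow> bool" where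
  "berwald_scalar_constant m A F e \<longleftrightarrow>
     (\<forall>c\<in>A. \<forall>W u. W \<subseteq> slit c \<and> adapted_frame m (rep A F c) W u \<longrightarrow>
        (\<forall>z\<in>W \<inter> sphere_bundle A F c. berwald_scalar m (rep A F c) u z = e))"

definition mean_stretch_vanishes ::
    "'n::finite \<Rightarrow> ('m, 'n) chart set \<Rightarrow> ('m \<Rightarrow> ('m, 'n) tvec \<Rightarrow> real) \<Rightarrow> bool" where
  "mean_stretch_vanishes m A F \<longleftrightarrow>
     (\<forall>c\<in>A. \<forall>W u. W \<subseteq> slit c \<and> adapted_frame m (rep A F c) W u \<longrightarrow>
        (\<forall>z\<in>W \<inter> sphere_bundle A F c. \<forall>a b. mean_stretch m (rep A F c) u z a b = 0))"

definition pullback_form :: "(real ^ 'n \<Rightarrow> real ^ 'n \<Rightarrow> real) \<Rightarrow> 'n::finite tb \<Rightarrow> 'n tb \<Rightarrow> real" where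
  "pullback_form \<eta> z a = \<eta> (fst z) (fst a)"

end

theory Submission
  imports Defs
begin

text \<open>On each fibre put \<open>S(x,y) = y\<^sup>k \<delta>\<tau>/\<delta>x\<^sup>k\<close>, the \<open>1\<close>-homogeneous function \<open>F\<close> times the S-curvature.
  The traces of the connection forms in an orthonormal frame are \<open>(\<delta>\<tau>/\<delta>x\<^sup>k) dx\<^sup>k - d\<tau>\<close> (Chern) and
  \<open>S\<^bsub>y\<^sup>k\<^esub> dx\<^sup>k - d\<tau>\<close> (Berwald). Hence \<open>e = F g\<^sup>j\<^sup>k S\<^bsub>y\<^sup>j y\<^sup>k\<^esub>\<close>, and for constant \<open>e\<close> the function
  \<open>h = S - e F/(n-1)\<close> satisfies \<open>g\<^sup>j\<^sup>k h\<^bsub>y\<^sup>j y\<^sup>k\<^esub> = 0\<close>. This is the equation of infinitesimal rigidity in the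
  Minkowski problem: the vector field \<open>V\<^sup>j = det g F g\<^sup>j\<^sup>a g\<^sup>l\<^sup>b h\<^bsub>ab\<^esub> h\<^sub>l\<close> is tangent to the level sets of \<open>F\<close> and has
  divergence \<open>det g F |Hess h|\<^sup>2\<close>, so integration over an annulus gives \<open>Hess h = 0\<close>, that is,
  \<open>h = \<xi>\<^sub>k(x) y\<^sup>k\<close>. The vanishing of the mean stretch curvature equates the horizontal parts of
  \<open>d(S\<^bsub>y\<^sup>k\<^esub> dx\<^sup>k)\<close>, which is \<open>d\<xi>\<close>, and of \<open>d((\<delta>\<tau>/\<delta>x\<^sup>k) dx\<^sup>k)\<close>, which is linear in the vertical
  gradient of \<open>\<tau>\<close>. The latter vanishes somewhere on every fibre, because \<open>\<tau>\<close> is \<open>0\<close>-homogeneous; so \<open>d\<xi> = 0\<close>.\<close>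

section \<open>Calculus of smooth functions\<close>

text \<open>The constant 1/(n-1) comes from g_ij = F_i F_j + F F_ij (subscripts are y-derivatives):
  contraction with the inverse metric gives tr Hess F = (n-1)/F, so c = e/(n-1) is the multiple of F
  that makes Hess(S - c F) trace free. The weight det g in V is there because det g times the
  inverse metric is the cofactor matrix of the Hessian of F^2/2, which is divergence free in y. The
  obstacle is the origin of each fibre, where F and h are not smooth in general: the cut-off is
  therefore supported in an annulus 1 <= F <= 2 and depends on F alone, so that its gradient is
  annihilated by V, and homogeneity carries the result from the annulus to the whole fibre. Passing
  from Hess h = 0 to linearity uses that the punctured fibre is connected, hence n >= 2. The form xi
  is found in each chart separately; it is global because F and S are, and for S this is seen from
  the Euler-Lagrange equations rather than from frames. The Chern connection is given by a definite
  description, so a solution and its uniqueness come before any trace.\<close>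

lemma frechet_derivative_cong_open:
  assumes "open S" "z \<in> S" "\<And>x. x \<in> S \<Longrightarrow> f x = g x"
  shows "frechet_derivative f (at z) = frechet_derivative g (at z)"
proof -
  have "(f has_derivative D) (at z) \<longleftrightarrow> (g has_derivative D) (at z)" for D
    using has_derivative_transform_within_open[of f D z UNIV S g]
      has_derivative_transform_within_open[of g D z UNIV S f] assms by auto
  then show ?thesis
    unfolding frechet_derivative_def by simp
qed

lemma differentiable_cong_open:
  assumes "open S" "z \<in> S" "\<And>x. x \<in> S \<Longrightarrow> f x = g x"
  shows "f differentiable (at z) \<longleftrightarrow> g differentiable (at z)"
  using has_derivative_transform_within_open[of f _ z UNIV S g]
      has_derivative_transform_within_open[of g _ z UNIV S f] assms
  unfolding differentiable_def by (metis (full_types))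

lemma Ck_on_cong:
  assumes "open S" "\<And>x. x \<in> S \<Longrightarrow> f x = g x"
  shows "Ck_on k S f \<longleftrightarrow> Ck_on k S g"
  using assms(2)
proof (induction k arbitrary: f g)
  case 0
  then show ?case by (simp cong: continuous_on_cong)
next
  case (Suc k)
  have "Ck_on k S (\<lambda>x. frechet_derivative f (at x) v) \<longleftrightarrow> Ck_on k S (\<lambda>x. frechet_derivative g (at x) v)" for v
    by (rule Suc.IH) (use frechet_derivative_cong_open[OF assms(1) _ Suc.prems] in auto)
  then show ?case
    using differentiable_cong_open[OF assms(1) _ Suc.prems] by auto
qed

lemma Ck_on_SucD: "Ck_on (Suc k) S f \<Longrightarrow> Ck_on k S f"
proof (induction k arbitrary: f)
  case 0
  then show ?case
    by (auto intro!: continuous_at_imp_continuous_on differentiable_imp_continuous_within)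
next
  case (Suc k)
  then show ?case by simp
qed

text \<open>\<open>Ck_on\<close> speaks of \<open>frechet_derivative\<close>, whose value has to be
  rewritten before an induction hypothesis applies; here an explicit derivative formula
  \<open>D\<close> takes its place. The rule drives the proofs for linear and bilinear maps,
  compositions, powers and the logarithm.\<close>

lemma Ck_on_SucI:
  assumes "open S" "\<And>x. x \<in> S \<Longrightarrow> (f has_derivative D x) (at x)" "\<And>v. Ck_on k S (\<lambda>x. D x v)"
  shows "Ck_on (Suc k) S f"
proof -
  have "frechet_derivative f (at x) v = D x v" if "x \<in> S" for x v
    using frechet_derivative_at[OF assms(2)[OF that]] by simp
  then have "Ck_on k S (\<lambda>x. frechet_derivative f (at x) v)" for v
    using Ck_on_cong[OF assms(1), of "\<lambda>x. frechet_derivative f (at x) v" "\<lambda>x. D x v"] assms(3) by simp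
  moreover have "\<forall>x\<in>S. f differentiable at x"
    using assms(2) unfolding differentiable_def by blast
  ultimately show ?thesis by simp
qed

lemma Ck_on_SucD_has_derivative:
  "Ck_on (Suc k) S f \<Longrightarrow> x \<in> S \<Longrightarrow> (f has_derivative frechet_derivative f (at x)) (at x)"
  by (simp add: frechet_derivative_works[symmetric])

lemma smooth_on_cong:
  assumes "\<And>x. x \<in> S \<Longrightarrow> f x = g x"
  shows "smooth_on S f \<longleftrightarrow> smooth_on S g"
  unfolding smooth_on_def using Ck_on_cong[of S f g] assms by meson

lemma smooth_on_congI:
  "smooth_on S g \<Longrightarrow> (\<And>x. x \<in> S \<Longrightarrow> f x = g x) \<Longrightarrow> smooth_on S f"
  using smooth_on_cong[of S f g] by simp

lemma Ck_on_subset: "Ck_on k S f \<Longrightarrow> T \<subseteq> S \<Longrightarrow> Ck_on k T f"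
  by (induction k arbitrary: f) (auto intro: continuous_on_subset)

lemma smooth_on_subset: "smooth_on S f \<Longrightarrow> open T \<Longrightarrow> T \<subseteq> S \<Longrightarrow> smooth_on T f"
  unfolding smooth_on_def using Ck_on_subset by blast

text \<open>The direction comes first so that iterated derivatives are plain compositions
  \<open>dd v (dd w h)\<close>. Where \<open>h\<close> is not differentiable the value is arbitrary,
  which is why the calculation rules carry differentiability premises.\<close>

definition dd :: "'a::real_normed_vector \<Rightarrow> ('a \<Rightarrow> 'b::real_normed_vector) \<Rightarrow> 'a \<Rightarrow> 'b" where
  "dd v h z = frechet_derivative h (at z) v"

lemma smooth_on_open: "smooth_on S f \<Longrightarrow> open S"
  by (simp add: smooth_on_def)

lemma smooth_on_differentiable: "smooth_on S f \<Longrightarrow> z \<in> S \<Longrightarrow> f differentiable (at z)"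
  using Ck_on.simps(2)[of 0 S f] unfolding smooth_on_def by blast

lemma smooth_on_dd: "smooth_on S f \<Longrightarrow> smooth_on S (dd v f)"
proof -
  assume f: "smooth_on S f"
  have "dd v f = (\<lambda>x. frechet_derivative f (at x) v)" by (simp add: dd_def fun_eq_iff)
  moreover have "Ck_on k S (\<lambda>x. frechet_derivative f (at x) v)" for k
    using f Ck_on.simps(2)[of k S f] unfolding smooth_on_def by blast
  ultimately show "smooth_on S (dd v f)" using f by (simp add: smooth_on_def)
qed

lemma smooth_on_continuous: "smooth_on S f \<Longrightarrow> continuous_on S f"
  using Ck_on.simps(1)[of S f] unfolding smooth_on_def by blast

lemma dd_cong:
  assumes "open S" "z \<in> S" "\<And>x. x \<in> S \<Longrightarrow> f x = g x"
  shows "dd v f z = dd v g z"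
  unfolding dd_def using frechet_derivative_cong_open[OF assms] by simp

lemma has_derivative_dd: "f differentiable (at z) \<Longrightarrow> (f has_derivative (\<lambda>v. dd v f z)) (at z)"
  unfolding dd_def by (simp add: frechet_derivative_works)

lemma dd_eqI: "(f has_derivative D) (at z) \<Longrightarrow> dd v f z = D v"
  unfolding dd_def using frechet_derivative_at by metis

lemma linear_dd: "f differentiable (at z) \<Longrightarrow> linear (\<lambda>v. dd v f z)"
  unfolding dd_def using linear_frechet_derivative by auto

lemma dd_const [simp]: "dd v (\<lambda>x. c) z = 0"
  by (simp add: dd_def)

lemma dd_bounded_linear: "bounded_linear f \<Longrightarrow> dd v f z = f v"
  by (simp add: bounded_linear_imp_has_derivative dd_eqI)

lemma dd_add:
  "f differentiable (at z) \<Longrightarrow> g differentiable (at z) \<Longrightarrow> dd v (\<lambda>x. f x + g x) z = dd v f z + dd v g z"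
  by (rule dd_eqI) (auto intro!: derivative_eq_intros dest: has_derivative_dd)

lemma dd_diff:
  "f differentiable (at z) \<Longrightarrow> g differentiable (at z) \<Longrightarrow> dd v (\<lambda>x. f x - g x) z = dd v f z - dd v g z"
  by (rule dd_eqI) (auto intro!: derivative_eq_intros dest: has_derivative_dd)

lemma dd_minus: "f differentiable (at z) \<Longrightarrow> dd v (\<lambda>x. - f x) z = - dd v f z"
  by (rule dd_eqI) (auto intro!: derivative_eq_intros dest: has_derivative_dd)

lemma dd_mult:
  fixes f g :: "'a::real_normed_vector \<Rightarrow> real"
  shows "f differentiable (at z) \<Longrightarrow> g differentiable (at z) \<Longrightarrow>
    dd v (\<lambda>x. f x * g x) z = f z * dd v g z + dd v f z * g z"
  by (rule dd_eqI) (auto intro!: derivative_eq_intros dest: has_derivative_dd)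

lemma dd_cmult:
  fixes f :: "'a::real_normed_vector \<Rightarrow> real"
  shows "f differentiable (at z) \<Longrightarrow> dd v (\<lambda>x. c * f x) z = c * dd v f z"
  by (simp add: dd_mult)

lemma dd_sum:
  assumes "\<And>i. i \<in> I \<Longrightarrow> f i differentiable (at z)"
  shows "dd v (\<lambda>x. \<Sum>i\<in>I. f i x) z = (\<Sum>i\<in>I. dd v (f i) z)"
  by (rule dd_eqI) (auto intro!: has_derivative_sum dest: has_derivative_dd assms)

lemma dd_power2:
  fixes f :: "'a::real_normed_vector \<Rightarrow> real"
  shows "f differentiable (at z) \<Longrightarrow> dd v (\<lambda>x. (f x)\<^sup>2) z = 2 * f z * dd v f z"
  by (simp add: power2_eq_square dd_mult)

lemma dd_compose:
  assumes "f differentiable (at z)" "g differentiable (at (f z))"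
  shows "dd v (\<lambda>x. g (f x)) z = dd (dd v f z) g (f z)"
  by (rule dd_eqI, rule has_derivative_compose[OF has_derivative_dd[OF assms(1)] has_derivative_dd[OF assms(2)]])

lemma dd_dir_add: "f differentiable (at z) \<Longrightarrow> dd (v + w) f z = dd v f z + dd w f z"
  using linear_dd linear_add by fastforce

lemma dd_dir_scaleR: "f differentiable (at z) \<Longrightarrow> dd (c *\<^sub>R v) f z = c *\<^sub>R dd v f z"
  using linear_dd linear_scale by fastforce

lemma dd_dir_sum: "f differentiable (at z) \<Longrightarrow> dd (\<Sum>i\<in>I. v i) f z = (\<Sum>i\<in>I. dd (v i) f z)"
  using linear_sum[OF linear_dd] by fastforce

lemma dd_dir_zero: "f differentiable (at z) \<Longrightarrow> dd 0 f z = 0"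
  using linear_dd linear_0 by fastforce

section \<open>Closure properties of smooth functions\<close>

lemma Ck_on_const: "Ck_on k S (\<lambda>x. c)"
  by (induction k arbitrary: c) auto

lemma Ck_on_linear:
  assumes "bounded_linear L" "open S" "Ck_on k S f"
  shows "Ck_on k S (\<lambda>x. L (f x))"
  using assms(3)
proof (induction k arbitrary: f)
  case 0
  then show ?case
    using bounded_linear.continuous_on[OF assms(1)] by simp
next
  case (Suc k)
  show ?case
  proof (rule Ck_on_SucI[OF assms(2)])
    show "((\<lambda>x. L (f x)) has_derivative (\<lambda>v. L (frechet_derivative f (at x) v))) (at x)" if "x \<in> S" for x
      by (rule bounded_linear.has_derivative[OF assms(1) Ck_on_SucD_has_derivative[OF Suc.prems that]])
    show "Ck_on k S (\<lambda>x. L (frechet_derivative f (at x) v))" for v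
      using Suc by simp
  qed
qed

lemma Ck_on_add:
  assumes "open S" "Ck_on k S f" "Ck_on k S g"
  shows "Ck_on k S (\<lambda>x. f x + g x)"
  using assms(2,3)
proof (induction k arbitrary: f g)
  case 0
  then show ?case by (simp add: continuous_on_add)
next
  case (Suc k)
  show ?case
  proof (rule Ck_on_SucI[OF assms(1)])
    show "((\<lambda>x. f x + g x) has_derivative
        (\<lambda>v. frechet_derivative f (at x) v + frechet_derivative g (at x) v)) (at x)" if "x \<in> S" for x
      by (rule has_derivative_add[OF Ck_on_SucD_has_derivative[OF Suc.prems(1) that]
          Ck_on_SucD_has_derivative[OF Suc.prems(2) that]])
    show "Ck_on k S (\<lambda>x. frechet_derivative f (at x) v + frechet_derivative g (at x) v)" for v
      using Suc by simp
  qed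
qed

lemma Ck_on_bilinear:
  assumes "bounded_bilinear B" "open S" "Ck_on k S f" "Ck_on k S g"
  shows "Ck_on k S (\<lambda>x. B (f x) (g x))"
  using assms(3,4)
proof (induction k arbitrary: f g)
  case 0
  then show ?case
    using bounded_bilinear.continuous_on[OF assms(1)] by simp
next
  case (Suc k)
  show ?case
  proof (rule Ck_on_SucI[OF assms(2)])
    show "((\<lambda>x. B (f x) (g x)) has_derivative
      (\<lambda>v. B (f x) (frechet_derivative g (at x) v) + B (frechet_derivative f (at x) v) (g x))) (at x)"
      if "x \<in> S" for x
      by (rule bounded_bilinear.FDERIV[OF assms(1) Ck_on_SucD_has_derivative[OF Suc.prems(1) that]
          Ck_on_SucD_has_derivative[OF Suc.prems(2) that]])
    have "Ck_on k S (\<lambda>x. frechet_derivative f (at x) v)" "Ck_on k S (\<lambda>x. frechet_derivative g (at x) v)" for v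
      using Suc.prems by simp_all
    then show "Ck_on k S (\<lambda>x. B (f x) (frechet_derivative g (at x) v) + B (frechet_derivative f (at x) v) (g x))" for v
      by (intro Ck_on_add[OF assms(2)] Suc.IH Ck_on_SucD[OF Suc.prems(1)] Ck_on_SucD[OF Suc.prems(2)])
  qed
qed

lemma Ck_on_sum:
  assumes "open S" "\<And>i. i \<in> I \<Longrightarrow> Ck_on k S (f i)"
  shows "Ck_on k S (\<lambda>x. \<Sum>i\<in>I. f i x)"
  using assms(2)
  by (induction I rule: infinite_finite_induct) (auto intro: Ck_on_add[OF assms(1)] Ck_on_const)

text \<open>In the chain rule the derivative of \<open>g\<close> is applied to a direction that
  varies with \<open>x\<close>, so the induction hypothesis does not fit directly. Expanding that
  direction in \<open>Basis\<close> leaves derivatives of \<open>g\<close> along fixed vectors, to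
  which it applies.\<close>

lemma Ck_on_compose:
  fixes f :: "'a::euclidean_space \<Rightarrow> 'b::euclidean_space" and g :: "'b \<Rightarrow> 'c::real_normed_vector"
  assumes "open S" "Ck_on k S f" "Ck_on k T g" "f ` S \<subseteq> T"
  shows "Ck_on k S (\<lambda>x. g (f x))"
  using assms(2,3)
proof (induction k arbitrary: g)
  case 0
  then show ?case
    using assms(4) by (simp add: continuous_on_compose2)
next
  case (Suc k)
  show ?case
  proof (rule Ck_on_SucI[OF assms(1)])
    fix x assume x: "x \<in> S"
    have g: "(g has_derivative frechet_derivative g (at (f x))) (at (f x))"
      by (rule Ck_on_SucD_has_derivative[OF Suc.prems(2)]) (use x assms(4) in auto)
    have "frechet_derivative g (at (f x)) w = (\<Sum>b\<in>Basis. (w \<bullet> b) *\<^sub>R frechet_derivative g (at (f x)) b)" for w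
    proof -
      have lin: "linear (frechet_derivative g (at (f x)))"
        using g has_derivative_linear by blast
      have "frechet_derivative g (at (f x)) w = frechet_derivative g (at (f x)) (\<Sum>b\<in>Basis. (w \<bullet> b) *\<^sub>R b)"
        by (simp add: euclidean_representation)
      then show ?thesis
        by (simp add: linear_sum[OF lin] linear_scale[OF lin])
    qed
    then have eq: "frechet_derivative g (at (f x)) = (\<lambda>w. \<Sum>b\<in>Basis. (w \<bullet> b) *\<^sub>R frechet_derivative g (at (f x)) b)"
      by blast
    have "((\<lambda>x. g (f x)) has_derivative (\<lambda>v. frechet_derivative g (at (f x)) (frechet_derivative f (at x) v))) (at x)"
      by (rule has_derivative_compose[OF Ck_on_SucD_has_derivative[OF Suc.prems(1) x] g])
    then show "((\<lambda>x. g (f x)) has_derivative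
        (\<lambda>v. \<Sum>b\<in>Basis. (frechet_derivative f (at x) v \<bullet> b) *\<^sub>R frechet_derivative g (at (f x)) b)) (at x)"
      by (subst (asm) eq)
  next
    fix v
    have "Ck_on k S (\<lambda>x. frechet_derivative f (at x) v)" "Ck_on k T (\<lambda>x. frechet_derivative g (at x) b)" for b
      using Suc.prems by simp_all
    then show "Ck_on k S (\<lambda>x. \<Sum>b\<in>Basis. (frechet_derivative f (at x) v \<bullet> b) *\<^sub>R frechet_derivative g (at (f x)) b)"
      by (intro Ck_on_sum[OF assms(1)] Ck_on_bilinear[OF bounded_bilinear_scaleR assms(1)]
        Ck_on_linear[OF bounded_linear_inner_left assms(1)] Suc.IH Ck_on_SucD[OF Suc.prems(1)])
  qed
qed

lemma smooth_on_const: "open S \<Longrightarrow> smooth_on S (\<lambda>x. c)"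
  by (simp add: smooth_on_def Ck_on_const)

lemma smooth_on_linear: "bounded_linear L \<Longrightarrow> smooth_on S f \<Longrightarrow> smooth_on S (\<lambda>x. L (f x))"
  by (simp add: smooth_on_def Ck_on_linear)

lemma smooth_on_add: "smooth_on S f \<Longrightarrow> smooth_on S g \<Longrightarrow> smooth_on S (\<lambda>x. f x + g x)"
  by (simp add: smooth_on_def Ck_on_add)

lemma smooth_on_minus: "smooth_on S f \<Longrightarrow> smooth_on S (\<lambda>x. - f x)"
  by (rule smooth_on_linear) (simp_all add: bounded_linear_minus bounded_linear_ident)

lemma smooth_on_diff: "smooth_on S f \<Longrightarrow> smooth_on S g \<Longrightarrow> smooth_on S (\<lambda>x. f x - g x)"
  using smooth_on_add[of S f "\<lambda>x. - g x"] smooth_on_minus by auto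

lemma smooth_on_mult:
  fixes f g :: "'a::euclidean_space \<Rightarrow> real"
  shows "smooth_on S f \<Longrightarrow> smooth_on S g \<Longrightarrow> smooth_on S (\<lambda>x. f x * g x)"
  by (simp add: smooth_on_def Ck_on_bilinear[OF bounded_bilinear_mult])

lemma smooth_on_scaleR: "smooth_on S f \<Longrightarrow> smooth_on S g \<Longrightarrow> smooth_on S (\<lambda>x. f x *\<^sub>R g x)"
  by (simp add: smooth_on_def Ck_on_bilinear[OF bounded_bilinear_scaleR])

lemma smooth_on_sum: "open S \<Longrightarrow> (\<And>i. i \<in> I \<Longrightarrow> smooth_on S (f i)) \<Longrightarrow> smooth_on S (\<lambda>x. \<Sum>i\<in>I. f i x)"
  by (simp add: smooth_on_def Ck_on_sum)

lemma smooth_on_prod: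
  fixes f :: "'i \<Rightarrow> 'a::euclidean_space \<Rightarrow> real"
  assumes "open S" "\<And>i. i \<in> I \<Longrightarrow> smooth_on S (f i)"
  shows "smooth_on S (\<lambda>x. \<Prod>i\<in>I. f i x)"
  using assms(2)
  by (induction I rule: infinite_finite_induct) (auto intro: smooth_on_mult smooth_on_const[OF assms(1)])

lemma smooth_on_compose:
  fixes f :: "'a::euclidean_space \<Rightarrow> 'b::euclidean_space"
  assumes "smooth_on T g" "smooth_on S f" "f ` S \<subseteq> T"
  shows "smooth_on S (\<lambda>x. g (f x))"
  using assms Ck_on_compose[of S _ f T g] by (simp add: smooth_on_def)

lemma smooth_on_id: "open S \<Longrightarrow> smooth_on S (\<lambda>x. x)"
proof -
  assume "open S"
  have "Ck_on k S (\<lambda>x. x)" for k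
    by (cases k) (simp_all add: Ck_on_const)
  then show "smooth_on S (\<lambda>x. x)" using \<open>open S\<close> by (simp add: smooth_on_def)
qed

lemma smooth_on_power2:
  fixes f :: "'a::euclidean_space \<Rightarrow> real"
  shows "smooth_on S f \<Longrightarrow> smooth_on S (\<lambda>x. (f x)\<^sup>2)"
  by (simp add: power2_eq_square smooth_on_mult)

text \<open>Real powers are closed under differentiation up to a factor, so the induction runs with
  \<open>a\<close> arbitrary. Inverses, logarithms and the normalization in Gram-Schmidt are reduced
  to this family.\<close>

lemma Ck_on_powr: "Ck_on k {0<..} (\<lambda>t::real. t powr a)"
proof (induction k arbitrary: a)
  case 0
  then show ?case by (auto intro!: continuous_intros)
next
  case (Suc k)
  show ?case
  proof (rule Ck_on_SucI[OF open_greaterThan])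
    show "((\<lambda>t. t powr a) has_derivative (\<lambda>v. v * (a * t powr (a - 1)))) (at t)" if "t \<in> {0<..}" for t :: real
      using that by (auto intro!: derivative_eq_intros simp: powr_diff field_simps)
    have "Ck_on k {0<..} (\<lambda>t::real. (v * a) * t powr (a - 1))" for v
      by (rule Ck_on_linear[OF bounded_linear_mult_right]) (auto intro: Suc)
    then show "Ck_on k {0<..} (\<lambda>t::real. v * (a * t powr (a - 1)))" for v
      by (simp add: mult.assoc)
  qed
qed

lemma smooth_on_powr:
  fixes f :: "'a::euclidean_space \<Rightarrow> real"
  assumes "smooth_on S f" "\<And>x. x \<in> S \<Longrightarrow> f x > 0"
  shows "smooth_on S (\<lambda>x. f x powr a)"
  by (rule smooth_on_compose[OF _ assms(1), of "{0<..}" "\<lambda>t. t powr a"])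
    (use assms(2) in \<open>auto simp: smooth_on_def Ck_on_powr\<close>)

lemma smooth_on_ln:
  fixes f :: "'a::euclidean_space \<Rightarrow> real"
  assumes "smooth_on S f" "\<And>x. x \<in> S \<Longrightarrow> f x > 0"
  shows "smooth_on S (\<lambda>x. ln (f x))"
proof -
  have "Ck_on (Suc k) {0<..} (ln :: real \<Rightarrow> real)" for k
  proof (rule Ck_on_SucI[OF open_greaterThan])
    show "(ln has_derivative (\<lambda>v. v * (t powr (- 1)))) (at t)" if "t \<in> {0<..}" for t :: real
      using that by (auto intro!: derivative_eq_intros simp: powr_minus field_simps)
    show "Ck_on k {0<..} (\<lambda>t::real. v * t powr (- 1))" for v
      by (intro Ck_on_linear[OF bounded_linear_mult_right] Ck_on_powr open_greaterThan)
  qed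
  then have "Ck_on k {0<..} (ln :: real \<Rightarrow> real)" for k
    by (rule Ck_on_SucD)
  then have "smooth_on {0<..} (ln :: real \<Rightarrow> real)"
    unfolding smooth_on_def by simp
  then show ?thesis
    by (rule smooth_on_compose[OF _ assms(1)]) (use assms(2) in auto)
qed

lemma smooth_on_inverse:
  fixes f :: "'a::euclidean_space \<Rightarrow> real"
  assumes "smooth_on S f" "\<And>x. x \<in> S \<Longrightarrow> f x \<noteq> 0"
  shows "smooth_on S (\<lambda>x. inverse (f x))"
proof -
  \<comment> \<open>The power needs a positive base, but \<open>f\<close> may be negative; hence 1/f
    is written as f times the inverse of its square.\<close>
  have "smooth_on S (\<lambda>x. f x * (f x * f x) powr (- 1))"
    by (intro smooth_on_mult smooth_on_powr assms) (use assms(2) not_real_square_gt_zero in blast)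
  moreover have "f x * (f x * f x) powr (- 1) = inverse (f x)" if "x \<in> S" for x
    using assms(2)[OF that] by (simp add: powr_minus field_simps)
  ultimately show ?thesis
    by (subst smooth_on_cong[of S _ "\<lambda>x. f x * (f x * f x) powr (- 1)"]) auto
qed

lemma smooth_on_divide:
  fixes f :: "'a::euclidean_space \<Rightarrow> real"
  assumes "smooth_on S f" "smooth_on S g" "\<And>x. x \<in> S \<Longrightarrow> g x \<noteq> 0"
  shows "smooth_on S (\<lambda>x. f x / g x)"
  unfolding divide_inverse by (intro smooth_on_mult smooth_on_inverse assms)

lemma smooth_on_vec_nth: "smooth_on S f \<Longrightarrow> smooth_on S (\<lambda>x. f x $ i)"
  by (rule smooth_on_linear[OF bounded_linear_vec_nth])

lemma smooth_on_vec:
  fixes f :: "'a::euclidean_space \<Rightarrow> real ^ 'n"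
  assumes "open S" "\<And>i. smooth_on S (\<lambda>x. f x $ i)"
  shows "smooth_on S f"
proof -
  have bl: "bounded_linear (axis i :: real \<Rightarrow> real ^ 'n)" for i
    unfolding linear_conv_bounded_linear[symmetric] by (rule linearI) (auto simp: vec_eq_iff axis_def)
  have "f x = (\<Sum>i\<in>UNIV. axis i (f x $ i))" for x
    by (auto simp: vec_eq_iff axis_def)
  then have "f = (\<lambda>x. \<Sum>i\<in>UNIV. axis i (f x $ i))" by auto
  moreover have "smooth_on S (\<lambda>x. \<Sum>i\<in>UNIV. axis i (f x $ i))"
    by (intro smooth_on_sum smooth_on_linear[OF bl] assms)
  ultimately show ?thesis by metis
qed

subsection \<open>Symmetry of second derivatives\<close>

lemma has_real_derivative_dd_line:
  fixes h :: "'a::real_normed_vector \<Rightarrow> real"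
  assumes "h differentiable (at (p + t *\<^sub>R v))"
  shows "((\<lambda>s. h (p + s *\<^sub>R v)) has_real_derivative dd v h (p + t *\<^sub>R v)) (at t)"
proof -
  have "((\<lambda>s. h (p + s *\<^sub>R v)) has_derivative (\<lambda>s. dd (s *\<^sub>R v) h (p + t *\<^sub>R v))) (at t)"
    by (rule has_derivative_compose[of "\<lambda>s. p + s *\<^sub>R v" _ _ _ h, OF _ has_derivative_dd[OF assms]])
      (auto intro!: derivative_eq_intros)
  then show ?thesis
    using dd_dir_scaleR[OF assms] by (simp add: has_field_derivative_def mult_commute_abs)
qed

text \<open>The mean value theorem is applied first in direction \<open>v\<close> to the difference
  of \<open>h\<close> along two lines shifted by s w, then in direction \<open>w\<close> to
  \<open>dd v h\<close>.\<close>

lemma second_difference_mean_value: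
  fixes h :: "'a::euclidean_space \<Rightarrow> real"
  assumes "smooth_on S h" "s > 0"
    and S: "\<And>a b. \<lbrakk>0 \<le> a; a \<le> s; 0 \<le> b; b \<le> s\<rbrakk> \<Longrightarrow> z + a *\<^sub>R v + b *\<^sub>R w \<in> S"
  obtains a b where "0 < a" "a < s" "0 < b" "b < s"
    "h (z + s *\<^sub>R v + s *\<^sub>R w) - h (z + s *\<^sub>R v) - h (z + s *\<^sub>R w) + h z
      = s\<^sup>2 * dd w (dd v h) (z + a *\<^sub>R v + b *\<^sub>R w)"
proof -
  have dh: "h differentiable (at x)" "dd v h differentiable (at x)" if "x \<in> S" for x
    using smooth_on_differentiable[OF assms(1) that] smooth_on_differentiable[OF smooth_on_dd[OF assms(1)] that]
    by auto
  define \<phi> where "\<phi> a = h ((z + s *\<^sub>R w) + a *\<^sub>R v) - h (z + a *\<^sub>R v)" for a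
  have "(\<phi> has_real_derivative (dd v h ((z + s *\<^sub>R w) + a *\<^sub>R v) - dd v h (z + a *\<^sub>R v))) (at a)"
    if "0 \<le> a" "a \<le> s" for a
    unfolding \<phi>_def using S[of a s] S[of a 0] that assms(2)
    by (intro DERIV_diff has_real_derivative_dd_line dh) (auto simp: algebra_simps)
  from MVT2[OF assms(2) this] obtain a where a: "0 < a" "a < s"
    "\<phi> s - \<phi> 0 = s * (dd v h ((z + s *\<^sub>R w) + a *\<^sub>R v) - dd v h (z + a *\<^sub>R v))" by auto
  have "((\<lambda>b. dd v h ((z + a *\<^sub>R v) + b *\<^sub>R w)) has_real_derivative
      dd w (dd v h) ((z + a *\<^sub>R v) + b *\<^sub>R w)) (at b)" if "0 \<le> b" "b \<le> s" for b
    using S[of a b] a that by (intro has_real_derivative_dd_line dh) auto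
  from MVT2[OF assms(2) this] obtain b where b: "0 < b" "b < s"
    "dd v h ((z + a *\<^sub>R v) + s *\<^sub>R w) - dd v h (z + a *\<^sub>R v) = s * dd w (dd v h) (z + a *\<^sub>R v + b *\<^sub>R w)"
    by auto
  show ?thesis
    by (rule that[OF a(1,2) b(1,2)]) (use a(3) b(3) in \<open>simp add: \<phi>_def algebra_simps power2_eq_square\<close>)
qed

text \<open>The second difference is symmetric in \<open>v\<close> and \<open>w\<close>, and after
  division by \<open>s\<^sup>2\<close> it converges to either mixed derivative, since the
  intermediate point of the mean value theorem tends to \<open>z\<close> and second derivatives are
  continuous.\<close>

lemma dd_commute:
  fixes h :: "'a::euclidean_space \<Rightarrow> real"
  assumes "smooth_on S h" "z \<in> S"
  shows "dd v (dd w h) z = dd w (dd v h) z"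
proof -
  have near: "\<exists>d>0. \<forall>s. 0 < s \<and> s < d \<longrightarrow>
      \<bar>(h (z + s *\<^sub>R v + s *\<^sub>R w) - h (z + s *\<^sub>R v) - h (z + s *\<^sub>R w) + h z) / s\<^sup>2 - dd w (dd v h) z\<bar> < e"
    if "e > 0" for e v w
  proof -
    have c: "continuous (at z) (dd w (dd v h))"
      using smooth_on_differentiable[OF smooth_on_dd[OF smooth_on_dd[OF assms(1)]] assms(2)]
      by (simp add: differentiable_imp_continuous_within)
    obtain d1 where d1: "d1 > 0" "\<And>x. dist x z < d1 \<Longrightarrow> \<bar>dd w (dd v h) x - dd w (dd v h) z\<bar> < e"
      using c \<open>e > 0\<close> unfolding continuous_at_eps_delta dist_real_def by meson
    obtain d2 where d2: "d2 > 0" "ball z d2 \<subseteq> S"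
      using smooth_on_open[OF assms(1)] assms(2) openE by metis
    \<comment> \<open>With this bound the parallelogram spanned by s v and s w for 0 < s < d stays
      within distance \<open>min d1 d2\<close> of \<open>z\<close>.\<close>
    define d where "d = min d1 d2 / (1 + norm v + norm w)"
    have pos: "1 + norm v + norm w > 0" by (smt (verit) norm_ge_zero)
    have "d > 0" using pos d1 d2 by (simp add: d_def)
    have close: "dist (z + a *\<^sub>R v + b *\<^sub>R w) z < min d1 d2" if "0 \<le> a" "a < d" "0 \<le> b" "b < d" for a b
    proof -
      have "dist (z + a *\<^sub>R v + b *\<^sub>R w) z = norm (a *\<^sub>R v + b *\<^sub>R w)"
        by (simp add: dist_norm algebra_simps)
      also have "\<dots> \<le> a * norm v + b * norm w"
        using norm_triangle_ineq[of "a *\<^sub>R v" "b *\<^sub>R w"] that by simp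
      also have "\<dots> \<le> d * norm v + d * norm w"
        using that by (intro add_mono mult_right_mono) auto
      also have "\<dots> < d * (1 + norm v + norm w)" using \<open>d > 0\<close> by (simp add: algebra_simps)
      also have "\<dots> = min d1 d2" using pos by (simp add: d_def)
      finally show ?thesis .
    qed
    show ?thesis
    proof (intro exI[of _ d] conjI allI impI \<open>d > 0\<close>)
      fix s :: real assume s: "0 < s \<and> s < d"
      have mem: "z + a *\<^sub>R v + b *\<^sub>R w \<in> S" if "0 \<le> a" "a \<le> s" "0 \<le> b" "b \<le> s" for a b
        using close[of a b] that s d2 by (auto simp: dist_commute subset_iff)
      obtain a b where ab: "0 < a" "a < s" "0 < b" "b < s"
        "h (z + s *\<^sub>R v + s *\<^sub>R w) - h (z + s *\<^sub>R v) - h (z + s *\<^sub>R w) + h z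
          = s\<^sup>2 * dd w (dd v h) (z + a *\<^sub>R v + b *\<^sub>R w)"
        by (rule second_difference_mean_value[OF assms(1), of s z v w]) (use s mem in auto)
      show "\<bar>(h (z + s *\<^sub>R v + s *\<^sub>R w) - h (z + s *\<^sub>R v) - h (z + s *\<^sub>R w) + h z) / s\<^sup>2 - dd w (dd v h) z\<bar> < e"
        using ab s close[of a b] d1(2) by simp
    qed
  qed
  have "\<bar>dd v (dd w h) z - dd w (dd v h) z\<bar> < e" if "e > 0" for e
  proof -
    from near[of "e/2" v w] near[of "e/2" w v] that obtain d d' where d: "d > 0" "d' > 0"
      "\<And>s. 0 < s \<and> s < d \<Longrightarrow>
      \<bar>(h (z + s *\<^sub>R v + s *\<^sub>R w) - h (z + s *\<^sub>R v) - h (z + s *\<^sub>R w) + h z) / s\<^sup>2 - dd w (dd v h) z\<bar> < e/2"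
      "\<And>s. 0 < s \<and> s < d' \<Longrightarrow>
      \<bar>(h (z + s *\<^sub>R w + s *\<^sub>R v) - h (z + s *\<^sub>R w) - h (z + s *\<^sub>R v) + h z) / s\<^sup>2 - dd v (dd w h) z\<bar> < e/2"
      by (metis half_gt_zero)
    define s where "s = min d d' / 2"
    define Q where "Q = (h (z + s *\<^sub>R v + s *\<^sub>R w) - h (z + s *\<^sub>R v) - h (z + s *\<^sub>R w) + h z) / s\<^sup>2"
    have s: "0 < s \<and> s < d" "0 < s \<and> s < d'"
      using d(1,2) by (auto simp: s_def)
    have "z + s *\<^sub>R w + s *\<^sub>R v = z + s *\<^sub>R v + s *\<^sub>R w" by (simp add: algebra_simps)
    then have "(h (z + s *\<^sub>R w + s *\<^sub>R v) - h (z + s *\<^sub>R w) - h (z + s *\<^sub>R v) + h z) / s\<^sup>2 = Q"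
      unfolding Q_def by (simp add: algebra_simps)
    then have "\<bar>Q - dd w (dd v h) z\<bar> < e/2" "\<bar>Q - dd v (dd w h) z\<bar> < e/2"
      using d(3)[OF s(1)] d(4)[OF s(2)] unfolding Q_def by metis+
    then show ?thesis by linarith
  qed
  then have "\<not> 0 < \<bar>dd v (dd w h) z - dd w (dd v h) z\<bar>" by blast
  then show ?thesis by simp
qed

section \<open>Matrices depending smoothly on a parameter\<close>

lemma matrix_inv_mult:
  fixes A :: "real ^ 'n ^ 'n"
  assumes "det A \<noteq> 0"
  shows "A ** matrix_inv A = mat 1" "matrix_inv A ** A = mat 1"
proof -
  have "\<exists>B. A ** B = mat 1 \<and> B ** A = mat 1"
    using assms unfolding invertible_det_nz[symmetric] invertible_def .
  from someI_ex[OF this] show "A ** matrix_inv A = mat 1" "matrix_inv A ** A = mat 1"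
    unfolding matrix_inv_def by auto
qed

lemma sum_matrix_inv_mult:
  fixes A :: "real ^ 'n ^ 'n"
  assumes "det A \<noteq> 0"
  shows "(\<Sum>k\<in>UNIV. A $ i $ k * matrix_inv A $ k $ j) = (if i = j then 1 else 0)"
    "(\<Sum>k\<in>UNIV. matrix_inv A $ i $ k * A $ k $ j) = (if i = j then 1 else 0)"
  using matrix_inv_mult[OF assms]
  by (simp_all add: matrix_matrix_mult_def mat_def vec_eq_iff)

text \<open>A quotient of polynomials in the entries, which is what makes the inverse matrix depend
  smoothly on a parameter.\<close>

lemma matrix_inv_cramer:
  fixes A :: "real ^ 'n ^ 'n"
  assumes "det A \<noteq> 0"
  shows "matrix_inv A $ k $ l = det (\<chi> i j. if j = k then axis l 1 $ i else A $ i $ j) / det A"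
proof -
  have "A *v (\<chi> k. matrix_inv A $ k $ l) = axis l 1"
    using sum_matrix_inv_mult(1)[OF assms] by (auto simp: matrix_vector_mult_def vec_eq_iff axis_def)
  then show ?thesis
    using cramer[OF assms] by (auto simp: vec_eq_iff)
qed

lemma smooth_on_det:
  fixes M :: "'a::euclidean_space \<Rightarrow> real ^ 'n ^ 'n"
  assumes "open S" "\<And>i j. smooth_on S (\<lambda>x. M x $ i $ j)"
  shows "smooth_on S (\<lambda>x. det (M x))"
  unfolding det_def
  by (intro smooth_on_sum smooth_on_mult smooth_on_const smooth_on_prod assms)

lemma smooth_on_matrix_inv:
  fixes M :: "'a::euclidean_space \<Rightarrow> real ^ 'n ^ 'n"
  assumes "open S" "\<And>i j. smooth_on S (\<lambda>x. M x $ i $ j)" "\<And>x. x \<in> S \<Longrightarrow> det (M x) \<noteq> 0"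
  shows "smooth_on S (\<lambda>x. matrix_inv (M x) $ k $ l)"
proof (subst smooth_on_cong)
  show "matrix_inv (M x) $ k $ l
      = det (\<chi> i j. if j = k then axis l 1 $ i else M x $ i $ j) / det (M x)" if "x \<in> S" for x
    by (rule matrix_inv_cramer[OF assms(3)[OF that]])
  have "smooth_on S (\<lambda>x. (\<chi> i j. if j = k then axis l 1 $ i else M x $ i $ j) $ i' $ j')" for i' j'
    by (cases "j' = k") (simp_all add: assms smooth_on_const)
  then show "smooth_on S (\<lambda>x. det (\<chi> i j. if j = k then axis l 1 $ i else M x $ i $ j) / det (M x))"
    by (intro smooth_on_divide smooth_on_det assms)
qed

text \<open>Jacobi's formula. The Leibniz rule replaces one row at a time by the row of derivatives;
  when that row is written as a combination of the rows of \<open>M z\<close> with coefficients from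
  \<open>C = D ** matrix_inv (M z)\<close>, only the diagonal coefficient survives in the
  determinant.\<close>

lemma dd_det:
  fixes M :: "'a::real_normed_vector \<Rightarrow> real ^ 'n ^ 'n"
  assumes "\<And>i j. (\<lambda>x. M x $ i $ j) differentiable (at z)" "det (M z) \<noteq> 0"
  shows "dd v (\<lambda>x. det (M x)) z =
    det (M z) * (\<Sum>i\<in>UNIV. \<Sum>j\<in>UNIV. matrix_inv (M z) $ i $ j * dd v (\<lambda>x. M x $ j $ i) z)"
proof -
  define D where "D = (\<chi> i j. dd v (\<lambda>x. M x $ i $ j) z)"
  define C where "C = D ** matrix_inv (M z)"
  let ?P = "{p. p permutes (UNIV :: 'n set)}"
  have "((\<lambda>x. det (M x)) has_derivative (\<lambda>v. \<Sum>p\<in>?P. of_int (sign p) *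
      (\<Sum>i\<in>UNIV. dd v (\<lambda>x. M x $ i $ p i) z * (\<Prod>j\<in>UNIV - {i}. M z $ j $ p j)))) (at z)"
    unfolding det_def
    by (intro has_derivative_sum has_derivative_mult_right has_derivative_prod has_derivative_dd assms)
  then have "dd v (\<lambda>x. det (M x)) z = (\<Sum>p\<in>?P. of_int (sign p) *
      (\<Sum>i\<in>UNIV. D $ i $ p i * (\<Prod>j\<in>UNIV - {i}. M z $ j $ p j)))"
    by (subst dd_eqI) (simp_all add: D_def)
  also have "\<dots> = (\<Sum>i\<in>UNIV. \<Sum>p\<in>?P. of_int (sign p) * (D $ i $ p i * (\<Prod>j\<in>UNIV - {i}. M z $ j $ p j)))"
    by (simp add: sum_distrib_left) (rule sum.swap)
  also have "\<dots> = (\<Sum>i\<in>UNIV. det (\<chi> r. if r = i then D $ i else M z $ r))"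
  proof (rule sum.cong[OF refl])
    fix i :: 'n
    have "(\<Prod>j\<in>UNIV. (\<chi> r. if r = i then D $ i else M z $ r) $ j $ p j)
        = D $ i $ p i * (\<Prod>j\<in>UNIV - {i}. M z $ j $ p j)" for p
      by (subst prod.remove[of _ i]) auto
    then show "(\<Sum>p\<in>?P. of_int (sign p) * (D $ i $ p i * (\<Prod>j\<in>UNIV - {i}. M z $ j $ p j)))
        = det (\<chi> r. if r = i then D $ i else M z $ r)"
      by (simp add: det_def)
  qed
  also have "\<dots> = (\<Sum>i\<in>UNIV. C $ i $ i * det (M z))"
  proof (rule sum.cong[OF refl])
    fix i :: 'n
    have "C ** M z = D"
      unfolding C_def by (simp add: matrix_mul_assoc[symmetric] matrix_inv_mult[OF assms(2)])
    then have "D $ i = (\<Sum>k\<in>UNIV. C $ i $ k *s row k (M z))"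
      by (auto simp: vec_eq_iff matrix_matrix_mult_def row_def)
    then have "(\<chi> r. if r = i then D $ i else M z $ r)
        = (\<chi> r. if r = i then \<Sum>k\<in>UNIV. C $ i $ k *s row k (M z) else row r (M z))"
      by (auto simp: vec_eq_iff row_def)
    then show "det (\<chi> r. if r = i then D $ i else M z $ r) = C $ i $ i * det (M z)"
      using cramer_lemma_transpose[of i "C $ i" "M z"] by simp
  qed
  also have "\<dots> = det (M z) * (\<Sum>i\<in>UNIV. \<Sum>k\<in>UNIV. D $ i $ k * matrix_inv (M z) $ k $ i)"
    by (simp add: C_def matrix_matrix_mult_def sum_distrib_left mult.commute)
  also have "(\<Sum>i\<in>UNIV. \<Sum>k\<in>UNIV. D $ i $ k * matrix_inv (M z) $ k $ i)
      = (\<Sum>i\<in>UNIV. \<Sum>j\<in>UNIV. matrix_inv (M z) $ i $ j * dd v (\<lambda>x. M x $ j $ i) z)"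
    by (subst sum.swap) (simp add: D_def mult.commute)
  finally show ?thesis .
qed

text \<open>Obtained by differentiating B M = 1 for the inverse B and multiplying by B from the
  right.\<close>

lemma dd_matrix_inv:
  fixes M :: "'a::euclidean_space \<Rightarrow> real ^ 'n ^ 'n"
  assumes "open S" "\<And>i j. smooth_on S (\<lambda>x. M x $ i $ j)" "\<And>x. x \<in> S \<Longrightarrow> det (M x) \<noteq> 0" "z \<in> S"
  shows "dd v (\<lambda>x. matrix_inv (M x) $ i $ j) z =
    - (\<Sum>p\<in>UNIV. \<Sum>q\<in>UNIV. matrix_inv (M z) $ i $ p * dd v (\<lambda>x. M x $ p $ q) z * matrix_inv (M z) $ q $ j)"
proof -
  let ?B = "\<lambda>x. matrix_inv (M x)"
  have d: "(\<lambda>x. M x $ i $ j) differentiable (at z)" "(\<lambda>x. ?B x $ i $ j) differentiable (at z)" for i j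
    using smooth_on_differentiable[OF assms(2) assms(4)]
      smooth_on_differentiable[OF smooth_on_matrix_inv[OF assms(1-3)] assms(4)] by auto
  have 0: "(\<Sum>k\<in>UNIV. ?B z $ i $ k * dd v (\<lambda>x. M x $ k $ q) z)
      = - (\<Sum>k\<in>UNIV. dd v (\<lambda>x. ?B x $ i $ k) z * M z $ k $ q)" for q
  proof -
    have "dd v (\<lambda>x. \<Sum>k\<in>UNIV. ?B x $ i $ k * M x $ k $ q) z = dd v (\<lambda>x. if i = q then 1 else 0) z"
      by (rule dd_cong[OF assms(1,4)]) (simp add: sum_matrix_inv_mult assms(3))
    then show ?thesis
      by (simp add: dd_sum dd_mult d sum.distrib split: if_splits)
  qed
  have "(\<Sum>p\<in>UNIV. \<Sum>q\<in>UNIV. ?B z $ i $ p * dd v (\<lambda>x. M x $ p $ q) z * ?B z $ q $ j)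
      = (\<Sum>q\<in>UNIV. (\<Sum>p\<in>UNIV. ?B z $ i $ p * dd v (\<lambda>x. M x $ p $ q) z) * ?B z $ q $ j)"
    by (subst sum.swap) (simp add: sum_distrib_right)
  also have "\<dots> = - (\<Sum>q\<in>UNIV. \<Sum>k\<in>UNIV. dd v (\<lambda>x. ?B x $ i $ k) z * (M z $ k $ q * ?B z $ q $ j))"
    by (simp add: 0 sum_distrib_right mult.assoc sum_negf)
  also have "\<dots> = - (\<Sum>k\<in>UNIV. dd v (\<lambda>x. ?B x $ i $ k) z * (\<Sum>q\<in>UNIV. M z $ k $ q * ?B z $ q $ j))"
    by (subst sum.swap) (simp add: sum_distrib_left)
  also have "\<dots> = - (\<Sum>k\<in>UNIV. dd v (\<lambda>x. ?B x $ i $ k) z * (if k = j then 1 else 0))"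
    by (simp add: sum_matrix_inv_mult assms(3,4))
  finally show ?thesis by (simp add: if_distrib cong: if_cong)
qed

section \<open>Integrals of derivatives of compactly supported functions\<close>

text \<open>By translation invariance each difference quotient of \<open>w\<close> has integral 0;
  dominated convergence passes this on to the derivative. It serves as the divergence theorem
  without boundary, one direction at a time.\<close>

lemma integral_directional_derivative_eq_0:
  fixes w w' :: "'a::euclidean_space \<Rightarrow> real"
  assumes deriv: "\<And>y. ((\<lambda>t. w (y + t *\<^sub>R e)) has_real_derivative w' y) (at 0)"
    and cont: "continuous_on UNIV w'" "continuous_on UNIV w"
    and supp: "\<And>y. r \<le> norm y \<Longrightarrow> w y = 0"
  shows "integrable lborel w'" "integral\<^sup>L lborel w' = 0"
proof -
  \<comment> \<open>The shifts used below have length at most \<open>norm e\<close>, so all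
    difference quotients vanish outside the ball of radius \<open>R\<close>.\<close>
  define R where "R = r + norm e"
  have der: "((\<lambda>t. w (y + t *\<^sub>R e)) has_real_derivative w' (y + s *\<^sub>R e)) (at s)" for y s
    using deriv[of "y + s *\<^sub>R e"] DERIV_shift[of "\<lambda>t. w (y + t *\<^sub>R e)" _ 0 s]
    by (simp add: algebra_simps)
  have w'0: "w' y = 0" if "r < norm y" for y
  proof -
    have "((\<lambda>t. 0) has_real_derivative w' y) (at 0)"
    proof (rule has_field_derivative_transform_within_open[OF deriv[of y], of "{t. r < norm (y + t *\<^sub>R e)}"])
      show "open {t. r < norm (y + t *\<^sub>R e)}" by (intro open_Collect_less continuous_intros)
    qed (use that supp in auto)
    then show ?thesis using DERIV_unique DERIV_const by blast
  qed
  obtain B where B: "B > 0" "\<And>y. norm y \<le> R \<Longrightarrow> \<bar>w' y\<bar> \<le> B"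
  proof -
    have "bounded (w' ` cball 0 R)"
      by (intro compact_imp_bounded compact_continuous_image continuous_on_subset[OF cont(1)]) auto
    then show ?thesis
      using that by (auto simp: bounded_pos)
  qed
  have B': "\<bar>w' y\<bar> \<le> B" for y
    using B(1) B(2)[of y] w'0[of y] norm_ge_zero[of e] unfolding R_def by (cases "norm y \<le> r + norm e") auto
  show "integrable lborel w'"
  proof -
    have "integrable lborel (\<lambda>x. indicator (cball 0 r) x *\<^sub>R w' x)"
      by (rule borel_integrable_compact) (auto intro: continuous_on_subset[OF cont(1)])
    moreover have "(\<lambda>x. indicator (cball 0 r) x *\<^sub>R w' x) = w'"
      using w'0 by (auto simp: indicator_def fun_eq_iff)
    ultimately show ?thesis by metis
  qed
  have meas: "w' \<in> borel_measurable lborel" "w \<in> borel_measurable lborel"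
    using cont by (auto intro: borel_measurable_continuous_onI)
  define q where "q n y = (w (y + inverse (real (Suc n)) *\<^sub>R e) - w y) * real (Suc n)" for n y
  have q0: "q n y = 0" if "R < norm y" for n y
  proof -
    have "norm y \<le> norm (y + inverse (real (Suc n)) *\<^sub>R e) + norm (inverse (real (Suc n)) *\<^sub>R e)"
      by (metis add_diff_cancel_right' norm_triangle_ineq4)
    moreover have "norm (inverse (real (Suc n)) *\<^sub>R e) \<le> norm e"
      by (simp add: divide_simps mult_left_le mult_le_cancel_left1 inverse_eq_divide mult_mono' algebra_simps)
    ultimately have "r \<le> norm (y + inverse (real (Suc n)) *\<^sub>R e)" "r \<le> norm y"
      using that norm_ge_zero[of e] unfolding R_def by linarith+
    then show ?thesis by (simp add: q_def supp)
  qed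
  have qB: "\<bar>q n y\<bar> \<le> B" for n y
  proof -
    have "0 < inverse (real (Suc n))" by simp
    from MVT2[OF this, of "\<lambda>t. w (y + t *\<^sub>R e)" "\<lambda>s. w' (y + s *\<^sub>R e)"] der
    obtain s where "w (y + inverse (real (Suc n)) *\<^sub>R e) - w (y + 0 *\<^sub>R e)
        = (inverse (real (Suc n)) - 0) * w' (y + s *\<^sub>R e)" by blast
    then have "q n y = w' (y + s *\<^sub>R e)"
      by (simp add: q_def)
    then show ?thesis using B' by simp
  qed
  have intw: "integrable lborel w"
  proof -
    have "integrable lborel (\<lambda>x. indicator (cball 0 r) x *\<^sub>R w x)"
      by (rule borel_integrable_compact) (auto intro: continuous_on_subset[OF cont(2)])
    moreover have "(\<lambda>x. indicator (cball 0 r) x *\<^sub>R w x) = w"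
      using supp by (auto simp: indicator_def fun_eq_iff)
    ultimately show ?thesis by metis
  qed
  have intq: "integral\<^sup>L lborel (q n) = 0" for n
  proof -
    define c where "c = inverse (real (Suc n)) *\<^sub>R e"
    have "integrable (distr lborel borel ((+) c)) w"
      "integral\<^sup>L (distr lborel borel ((+) c)) w = integral\<^sup>L lborel w"
      using intw by (simp_all add: lborel_distr_plus)
    then have "integrable lborel (\<lambda>y. w (y + c))" "integral\<^sup>L lborel (\<lambda>y. w (y + c)) = integral\<^sup>L lborel w"
      using meas(2) by (simp_all add: integrable_distr_eq integral_distr add.commute)
    then show ?thesis
      unfolding q_def c_def[symmetric] using intw by (simp add: Bochner_Integration.integral_diff)
  qed
  have "(\<lambda>n. integral\<^sup>L lborel (q n)) \<longlonglongrightarrow> integral\<^sup>L lborel w'"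
  proof (rule integral_dominated_convergence[where w = "\<lambda>y. indicator (cball 0 R) y *\<^sub>R B"])
    show "w' \<in> borel_measurable lborel" by (rule meas)
    show "q n \<in> borel_measurable lborel" for n
    proof -
      have "continuous_on UNIV (\<lambda>y. w (y + inverse (real (Suc n)) *\<^sub>R e))"
        by (rule continuous_on_compose2[OF cont(2)]) (auto intro: continuous_intros)
      then have "continuous_on UNIV (q n)"
        unfolding q_def by (intro continuous_intros cont(2))
      then show ?thesis by (auto intro: borel_measurable_continuous_onI)
    qed
    show "integrable lborel (\<lambda>y::'a. indicator (cball 0 R) y *\<^sub>R B)"
      by (rule borel_integrable_compact) auto
    show "AE y in lborel. (\<lambda>n. q n y) \<longlonglongrightarrow> w' y"
    proof (rule AE_I2)
      fix y
      have "(\<lambda>n. (w (y + inverse (real (Suc n)) *\<^sub>R e) - w (y + 0 *\<^sub>R e)) / inverse (real (Suc n))) \<longlonglongrightarrow> w' y"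
      proof (rule filterlim_compose[of "\<lambda>h. (w (y + h *\<^sub>R e) - w (y + 0 *\<^sub>R e)) / h"])
        show "((\<lambda>h. (w (y + h *\<^sub>R e) - w (y + 0 *\<^sub>R e)) / h) \<longlongrightarrow> w' y) (at 0)"
          using deriv[of y] by (simp add: DERIV_def)
        show "filterlim (\<lambda>n. inverse (real (Suc n))) (at 0) sequentially"
          unfolding filterlim_at using LIMSEQ_inverse_real_of_nat by simp
      qed
      then show "(\<lambda>n. q n y) \<longlonglongrightarrow> w' y"
        by (simp add: q_def divide_inverse)
    qed
    show "AE y in lborel. norm (q n y) \<le> indicator (cball 0 R) y *\<^sub>R B" for n
      using qB q0 by (intro AE_I2) (auto simp: indicator_def not_le)
  qed
  with intq show "integral\<^sup>L lborel w' = 0"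
    by (simp add: LIMSEQ_const_iff)
qed

text \<open>The set where \<open>f\<close> is nonzero is open and of measure zero, hence
  empty.\<close>

lemma continuous_nonneg_integral_eq_0:
  fixes f :: "'a::euclidean_space \<Rightarrow> real"
  assumes "continuous_on UNIV f" "\<And>y. f y \<ge> 0" "integrable lborel f" "integral\<^sup>L lborel f = 0"
  shows "f y = 0"
proof (rule ccontr)
  assume "f y \<noteq> 0"
  then have "f y > 0" using assms(2)[of y] by simp
  have meas: "f \<in> borel_measurable borel"
    using assms(1) by (rule borel_measurable_continuous_onI)
  have "AE x in lborel. f x = 0"
    using integral_nonneg_eq_0_iff_AE[OF assms(3)] assms(2,4) by simp
  then have "{x. f x \<noteq> 0} \<in> null_sets lborel"
    using meas by (subst AE_iff_null_sets) auto
  then have "negligible {x. f x \<noteq> 0}"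
    by (simp add: negligible_iff_null_sets null_sets_completionI)
  moreover have "open {x. f x \<noteq> 0}" using assms(1) by (intro open_Collect_neq) auto
  ultimately show False
    using \<open>f y \<noteq> 0\<close> open_not_negligible by blast
qed

section \<open>Homogeneous functions on the slit tangent bundle\<close>

lemma dX_eq_dd: "dX i = dd (axis i 1, 0)"
  by (simp add: fun_eq_iff dX_def dd_def)

lemma dY_eq_dd: "dY i = dd (0, axis i 1)"
  by (simp add: fun_eq_iff dY_def dd_def)

lemma vec_eq_sum_axis: "(a :: real ^ 'n) = (\<Sum>i\<in>UNIV. a $ i *\<^sub>R axis i 1)"
  by (simp add: vec_eq_iff axis_def if_distrib cong: if_cong)

lemma dd_tb:
  fixes h :: "'n::finite tb \<Rightarrow> real"
  assumes "h differentiable (at z)"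
  shows "dd (a, b) h z = (\<Sum>i\<in>UNIV. a $ i * dX i h z) + (\<Sum>i\<in>UNIV. b $ i * dY i h z)"
proof -
  have "(a, b) = (\<Sum>i\<in>UNIV. a $ i *\<^sub>R (axis i 1, 0)) + (\<Sum>i\<in>UNIV. b $ i *\<^sub>R (0, axis i 1))"
    using vec_eq_sum_axis[of a] vec_eq_sum_axis[of b]
    by (simp add: prod_eq_iff fst_sum snd_sum)
  then show ?thesis
    by (simp only: dd_dir_add[OF assms] dd_dir_sum[OF assms] dd_dir_scaleR[OF assms] dX_eq_dd dY_eq_dd real_scaleR_def)
qed

lemma dd_vertical:
  fixes h :: "'n::finite tb \<Rightarrow> real"
  assumes "h differentiable (at z)"
  shows "dd (0, b) h z = (\<Sum>i\<in>UNIV. b $ i * dY i h z)"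
  using dd_tb[OF assms, of 0 b] by simp

text \<open>Formed over any base set \<open>U\<close>, since besides chart images
  (\<open>slit_eq\<close>) it is needed over overlaps of charts.\<close>

definition slit_over :: "(real ^ 'n) set \<Rightarrow> 'n::finite tb set" where
  "slit_over U = {z. fst z \<in> U \<and> snd z \<noteq> 0}"

lemma open_slit_over: "open U \<Longrightarrow> open (slit_over U)"
proof -
  have "slit_over U = U \<times> (- {0})" by (auto simp: slit_over_def)
  then show "open U \<Longrightarrow> open (slit_over U)" by (simp add: open_Times open_Compl)
qed

lemma slit_over_scale: "(x, y) \<in> slit_over U \<Longrightarrow> t > 0 \<Longrightarrow> (x, t *\<^sub>R y) \<in> slit_over U"
  by (simp add: slit_over_def)

text \<open>The degree is real because differentiation in y lowers it and negative degrees occur;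
  only positive dilations are considered, as F need not be reversible.\<close>

definition homog :: "(real ^ 'n) set \<Rightarrow> real \<Rightarrow> ('n::finite tb \<Rightarrow> real) \<Rightarrow> bool" where
  "homog U r h \<longleftrightarrow> (\<forall>(x, y)\<in>slit_over U. \<forall>t>0. h (x, t *\<^sub>R y) = t powr r * h (x, y))"

lemma homogD: "homog U r h \<Longrightarrow> (x, y) \<in> slit_over U \<Longrightarrow> t > 0 \<Longrightarrow> h (x, t *\<^sub>R y) = t powr r * h (x, y)"
  by (auto simp: homog_def)

lemma homogI:
  "(\<And>x y t. (x, y) \<in> slit_over U \<Longrightarrow> t > 0 \<Longrightarrow> h (x, t *\<^sub>R y) = t powr r * h (x, y)) \<Longrightarrow> homog U r h"
  by (auto simp: homog_def)

lemma homog_mult: "homog U r h \<Longrightarrow> homog U s k \<Longrightarrow> homog U (r + s) (\<lambda>z. h z * k z)"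
  by (rule homogI) (simp add: homogD powr_add)

lemma homog_cmult: "homog U r h \<Longrightarrow> homog U r (\<lambda>z. c * h z)"
  by (rule homogI) (simp add: homogD)

lemma homog_diff: "homog U r h \<Longrightarrow> homog U r k \<Longrightarrow> homog U r (\<lambda>z. h z - k z)"
  by (rule homogI) (simp add: homogD algebra_simps)

lemma homog_sum: "(\<And>i. i \<in> I \<Longrightarrow> homog U r (h i)) \<Longrightarrow> homog U r (\<lambda>z. \<Sum>i\<in>I. h i z)"
  by (rule homogI) (auto simp: sum_distrib_left intro!: sum.cong dest: homogD)

lemma homog_coord: "homog U 1 (\<lambda>z. snd z $ i)"
  by (rule homogI) simp

text \<open>The chain rule for the dilation of the fibre by \<open>t\<close>, which scales only the
  vertical part of a direction. Both \<open>homog_dX\<close> and \<open>homog_dY\<close> are special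
  cases.\<close>

lemma homog_dd:
  assumes "smooth_on (slit_over U) h" "homog U r h" "(x, y) \<in> slit_over U" "t > 0"
  shows "dd (a, t *\<^sub>R b) h (x, t *\<^sub>R y) = t powr r * dd (a, b) h (x, y)"
proof -
  let ?s = "\<lambda>z :: 'a tb. (fst z, t *\<^sub>R snd z)"
  have bl: "bounded_linear ?s"
    by (intro bounded_linear_Pair bounded_linear_fst bounded_linear_scaleR_const bounded_linear_compose[OF bounded_linear_scaleR_right] bounded_linear_snd)
  have d: "h differentiable (at z)" if "z \<in> slit_over U" for z
    using smooth_on_differentiable[OF assms(1) that] .
  have "dd (a, t *\<^sub>R b) h (x, t *\<^sub>R y) = dd (dd (a, b) ?s (x, y)) h (?s (x, y))"
    by (simp add: dd_bounded_linear[OF bl])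
  also have "\<dots> = dd (a, b) (\<lambda>z. h (?s z)) (x, y)"
    using d slit_over_scale[OF assms(3,4)] bounded_linear_imp_differentiable[OF bl]
    by (subst dd_compose) auto
  also have "\<dots> = dd (a, b) (\<lambda>z. t powr r * h z) (x, y)"
    using homogD[OF assms(2) _ assms(4)]
    by (intro dd_cong[OF smooth_on_open[OF assms(1)] assms(3)]) (metis prod.collapse)
  also have "\<dots> = t powr r * dd (a, b) h (x, y)"
    by (rule dd_cmult[OF d[OF assms(3)]])
  finally show ?thesis .
qed

lemma homog_dX:
  assumes "smooth_on (slit_over U) h" "homog U r h"
  shows "homog U r (dX i h)"
  using homog_dd[OF assms, of _ _ _ "axis i 1" 0] by (intro homogI) (simp add: dX_eq_dd)

lemma homog_dY:
  assumes "smooth_on (slit_over U) h" "homog U r h"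
  shows "homog U (r - 1) (dY i h)"
proof (rule homogI)
  fix x y t assume z: "(x, y) \<in> slit_over U" and t: "t > (0::real)"
  have "h differentiable at (x, t *\<^sub>R y)"
    by (rule smooth_on_differentiable[OF assms(1) slit_over_scale[OF z t]])
  then have "dd (t *\<^sub>R (0, axis i 1)) h (x, t *\<^sub>R y) = t * dd (0, axis i 1) h (x, t *\<^sub>R y)"
    by (simp only: dd_dir_scaleR real_scaleR_def)
  then have "t * dY i h (x, t *\<^sub>R y) = t powr r * dY i h (x, y)"
    using homog_dd[OF assms z t, of 0 "axis i 1"] by (simp add: dY_eq_dd)
  then show "dY i h (x, t *\<^sub>R y) = t powr (r - 1) * dY i h (x, y)"
    using t by (simp add: powr_diff field_simps)
qed

text \<open>In the radial direction the function is \<open>(1 + s) powr r * h z\<close>, and the two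
  expressions for its derivative at s = 0 are compared.\<close>

lemma euler_homog:
  assumes "smooth_on (slit_over U) h" "homog U r h" "z \<in> slit_over U"
  shows "dd (0, snd z) h z = r * h z"
    "(\<Sum>k\<in>UNIV. snd z $ k * dY k h z) = r * h z"
proof -
  have d: "h differentiable (at z)" by (rule smooth_on_differentiable[OF assms(1,3)])
  have "((\<lambda>s. h (z + s *\<^sub>R (0, snd z))) has_real_derivative dd (0, snd z) h z) (at 0)"
    using has_real_derivative_dd_line[of h z 0 "(0, snd z)"] d by (simp add: zero_prod_def[symmetric])
  moreover have "((\<lambda>s. h (z + s *\<^sub>R (0, snd z))) has_real_derivative r * h z) (at 0)"
  proof (rule has_field_derivative_transform_within_open[of "\<lambda>s. (1 + s) powr r * h z" _ _ "{-1<..}"])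
    show "((\<lambda>s. (1 + s) powr r * h z) has_real_derivative r * h z) (at 0)"
      by (auto intro!: derivative_eq_intros)
    show "(1 + s) powr r * h z = h (z + s *\<^sub>R (0, snd z))" if "s \<in> {-1<..}" for s
    proof -
      have "z + s *\<^sub>R (0, snd z) = (fst z, (1 + s) *\<^sub>R snd z)"
        by (simp add: prod_eq_iff algebra_simps)
      then show ?thesis
        using homogD[OF assms(2), of "fst z" "snd z" "1 + s"] that assms(3) by simp
    qed
  qed auto
  ultimately show 1: "dd (0, snd z) h z = r * h z" by (rule DERIV_unique)
  show "(\<Sum>k\<in>UNIV. snd z $ k * dY k h z) = r * h z"
    using 1 dd_vertical[OF d] by simp
qed

lemma dd_coord [simp]: "dd (a, b) (\<lambda>z. snd z $ k) z = b $ k"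
  by (subst dd_bounded_linear) (auto intro: bounded_linear_compose[OF bounded_linear_vec_nth] bounded_linear_snd)

lemma smooth_on_coord: "open S \<Longrightarrow> smooth_on S (\<lambda>z :: 'n::finite tb. snd z $ k)"
  by (intro smooth_on_vec_nth smooth_on_linear[OF bounded_linear_snd] smooth_on_id)

lemma smooth_on_dX: "smooth_on S h \<Longrightarrow> smooth_on S (dX i h)"
  by (simp add: dX_eq_dd smooth_on_dd)

lemma smooth_on_dY: "smooth_on S h \<Longrightarrow> smooth_on S (dY i h)"
  by (simp add: dY_eq_dd smooth_on_dd)

section \<open>Smooth Gram--Schmidt orthonormalization\<close>

definition bil :: "real ^ 'n ^ 'n \<Rightarrow> real ^ 'n \<Rightarrow> real ^ 'n::finite \<Rightarrow> real" where
  "bil G a b = (\<Sum>k\<in>UNIV. \<Sum>l\<in>UNIV. G $ k $ l * a $ k * b $ l)"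

lemma bil_add_left: "bil G (a + a') b = bil G a b + bil G a' b"
  by (simp add: bil_def algebra_simps sum.distrib)

lemma bil_scale_left: "bil G (c *\<^sub>R a) b = c * bil G a b"
  by (simp add: bil_def sum_distrib_left algebra_simps)

lemma bil_scale_right: "bil G b (c *\<^sub>R a) = c * bil G b a"
  by (simp add: bil_def sum_distrib_left algebra_simps)

lemma bil_zero_left: "bil G 0 b = 0"
  by (simp add: bil_def)

lemma bil_diff_left: "bil G (a - a') b = bil G a b - bil G a' b"
  using bil_add_left[of G "a - a'" a' b] by simp

lemma bil_sum_left: "bil G (\<Sum>i\<in>I. a i) b = (\<Sum>i\<in>I. bil G (a i) b)"
  by (induction I rule: infinite_finite_induct) (simp_all add: bil_zero_left bil_add_left)

lemma bil_commute:
  assumes "\<And>k l. G $ k $ l = G $ l $ k"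
  shows "bil G a b = bil G b a"
  unfolding bil_def by (subst sum.swap) (simp add: assms mult.commute mult.left_commute)

lemma smooth_on_bil:
  assumes "open W" "\<And>k l. smooth_on W (\<lambda>z. G z $ k $ l)" "smooth_on W a" "smooth_on W b"
  shows "smooth_on W (\<lambda>z. bil (G z) (a z) (b z))"
  unfolding bil_def by (intro smooth_on_sum smooth_on_mult smooth_on_vec_nth assms)

text \<open>The relation \<open>R\<close> will be dilation of the fibre; carrying it through the
  induction makes the resulting frame 0-homogeneous. The vector \<open>b m\<close> has unit length
  and is left unchanged, and membership in the span is kept so that independence makes the next
  residual \<open>w\<close> nonzero.\<close>

lemma gram_schmidt:
  fixes W :: "'a::euclidean_space set" and G :: "'a \<Rightarrow> real ^ 'n ^ 'n::finite" and b :: "'n \<Rightarrow> 'a \<Rightarrow> real ^ 'n"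
  assumes W: "open W" and G: "\<And>k l. smooth_on W (\<lambda>z. G z $ k $ l)"
    and sym: "\<And>z k l. z \<in> W \<Longrightarrow> G z $ k $ l = G z $ l $ k"
    and pos: "\<And>z v. z \<in> W \<Longrightarrow> v \<noteq> 0 \<Longrightarrow> bil (G z) v v > 0"
    and b: "\<And>i. smooth_on W (b i)"
    and indep: "\<And>z k. z \<in> W \<Longrightarrow> b k z \<notin> span ((\<lambda>j. b j z) ` (- {k}))"
    and inv: "\<And>z z'. R z z' \<Longrightarrow> z \<in> W \<Longrightarrow> z' \<in> W \<and> G z' = G z \<and> (\<forall>i. b i z' = b i z)"
    and m: "\<And>z. z \<in> W \<Longrightarrow> bil (G z) (b m z) (b m z) = 1"
    and B: "finite B"
  shows "\<exists>u. (\<forall>i\<in>insert m B. smooth_on W (u i) \<and> (\<forall>z\<in>W. \<forall>z'. R z z' \<longrightarrow> u i z' = u i z)) \<and>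
    (\<forall>z\<in>W. u m z = b m z \<and> (\<forall>i\<in>insert m B. u i z \<in> span ((\<lambda>j. b j z) ` insert m B) \<and>
      (\<forall>j\<in>insert m B. bil (G z) (u i z) (u j z) = (if i = j then 1 else 0))))"
  using B
proof (induction B rule: finite_induct)
  case empty
  show ?case
    by (rule exI[of _ "\<lambda>i. b m"]) (auto simp: b m inv intro: span_base)
next
  case (insert k B)
  show ?case
  proof (cases "k = m")
    case True
    then show ?thesis using insert.IH by simp
  next
    case False
    let ?B = "insert m B"
    have k: "k \<notin> ?B" "finite ?B" using False insert.hyps by auto
    obtain u where u: "\<And>i. i \<in> ?B \<Longrightarrow> smooth_on W (u i)"
        "\<And>i z z'. i \<in> ?B \<Longrightarrow> z \<in> W \<Longrightarrow> R z z' \<Longrightarrow> u i z' = u i z"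
        "\<And>z. z \<in> W \<Longrightarrow> u m z = b m z"
        "\<And>i z. i \<in> ?B \<Longrightarrow> z \<in> W \<Longrightarrow> u i z \<in> span ((\<lambda>j. b j z) ` ?B)"
        "\<And>i j z. i \<in> ?B \<Longrightarrow> j \<in> ?B \<Longrightarrow> z \<in> W \<Longrightarrow> bil (G z) (u i z) (u j z) = (if i = j then 1 else 0)"
      using insert.IH by blast
    define w where "w z = b k z - (\<Sum>j\<in>?B. bil (G z) (b k z) (u j z) *\<^sub>R u j z)" for z
    define n where "n z = bil (G z) (w z) (w z) powr (- 1/2)" for z
    have wB: "(\<Sum>j\<in>?B. bil (G z) (b k z) (u j z) *\<^sub>R u j z) \<in> span ((\<lambda>j. b j z) ` ?B)" if "z \<in> W" for z
      using u(4) that by (intro span_sum span_scale) auto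
    have w0: "w z \<noteq> 0" if "z \<in> W" for z
    proof
      assume "w z = 0"
      then have "b k z \<in> span ((\<lambda>j. b j z) ` ?B)"
        using wB[OF that] by (simp add: w_def)
      moreover have "span ((\<lambda>j. b j z) ` ?B) \<subseteq> span ((\<lambda>j. b j z) ` (- {k}))"
        using k by (intro span_mono image_mono) auto
      ultimately show False using indep[OF that, of k] by blast
    qed
    have sw: "smooth_on W w"
      unfolding w_def
      by (intro smooth_on_diff smooth_on_sum smooth_on_scaleR smooth_on_bil W G b u(1)) auto
    have sn: "smooth_on W n"
      unfolding n_def by (intro smooth_on_powr smooth_on_bil W G sw pos w0)
    have orth: "bil (G z) (w z) (u j z) = 0" if "z \<in> W" "j \<in> ?B" for z j
    proof -
      have "(\<Sum>i\<in>?B. bil (G z) (b k z) (u i z) * bil (G z) (u i z) (u j z))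
          = (\<Sum>i\<in>?B. if i = j then bil (G z) (b k z) (u j z) else 0)"
        using that by (intro sum.cong) (auto simp: u(5))
      also have "\<dots> = bil (G z) (b k z) (u j z)"
        using that(2) k(2) by (simp add: sum.delta')
      finally show ?thesis
        by (simp only: w_def bil_diff_left bil_sum_left bil_scale_left diff_self)
    qed
    have nn: "n z * (n z * bil (G z) (w z) (w z)) = 1" if "z \<in> W" for z
    proof -
      define q where "q = bil (G z) (w z) (w z)"
      have "q > 0" using pos[OF that w0[OF that]] by (simp add: q_def)
      have "q powr (- 1/2) * (q powr (- 1/2) * q) = q powr (- 1/2) * (q powr (- 1/2) * q powr 1)"
        using \<open>q > 0\<close> by simp
      also have "\<dots> = 1"
        using \<open>q > 0\<close> by (simp only: powr_add[symmetric]) simp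
      finally show ?thesis by (simp add: n_def q_def)
    qed
    define u' where "u' = u(k := \<lambda>z. n z *\<^sub>R w z)"
    have u'k: "u' k = (\<lambda>z. n z *\<^sub>R w z)" by (simp add: u'_def)
    have u'i: "u' i = u i" if "i \<in> ?B" for i using that k by (auto simp: u'_def)
    have w_inv: "w z' = w z" if "R z z'" "z \<in> W" for z z'
      using inv[OF that] u(2)[OF _ that(2,1)] by (simp add: w_def)
    have n_inv: "n z' = n z" if "R z z'" "z \<in> W" for z z'
      using inv[OF that] w_inv[OF that] by (simp add: n_def)
    show ?thesis
    proof (intro exI[of _ u'] conjI ballI allI impI)
      fix i assume i: "i \<in> insert m (insert k B)"
      show "smooth_on W (u' i)"
        using i u(1) smooth_on_scaleR[OF sn sw] u'i u'k by (cases "i = k") auto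
      fix z z' assume z: "z \<in> W" "R z z'"
      show "u' i z' = u' i z"
        using i u(2)[OF _ z] w_inv[OF z(2,1)] n_inv[OF z(2,1)] u'i u'k by (cases "i = k") auto
    next
      fix z assume z: "z \<in> W"
      show "u' m z = b m z" using u(3)[OF z] u'i by auto
    next
      fix z i assume z: "z \<in> W" and i: "i \<in> insert m (insert k B)"
      have sub: "span ((\<lambda>j. b j z) ` ?B) \<subseteq> span ((\<lambda>j. b j z) ` insert m (insert k B))"
        by (intro span_mono) auto
      have "w z \<in> span ((\<lambda>j. b j z) ` insert m (insert k B))"
        unfolding w_def by (rule span_diff[OF span_base subsetD[OF sub wB[OF z]]]) simp
      then show "u' i z \<in> span ((\<lambda>j. b j z) ` insert m (insert k B))"
        using i u(4)[OF _ z] sub u'i u'k by (cases "i = k") (auto intro: span_scale)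
    next
      fix z i j assume z: "z \<in> W" and i: "i \<in> insert m (insert k B)" and j: "j \<in> insert m (insert k B)"
      have kk: "bil (G z) (u' k z) (u' k z) = 1"
        using nn[OF z] by (simp add: u'k bil_scale_left bil_scale_right)
      have ko: "bil (G z) (u' k z) (u j z) = 0" "bil (G z) (u j z) (u' k z) = 0" if "j \<in> ?B" for j
        using orth[OF z that] bil_commute[of "G z" "u j z" "w z", OF sym[OF z]]
        by (simp_all add: u'k bil_scale_left bil_scale_right)
      show "bil (G z) (u' i z) (u' j z) = (if i = j then 1 else 0)"
      proof (cases "i = k"; cases "j = k")
        assume "i \<noteq> k" "j \<noteq> k"
        then show ?thesis using i j u(5)[OF _ _ z] u'i by auto
      next
        assume "i = k" "j \<noteq> k"
        then have "j \<in> ?B" using j by auto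
        then show ?thesis using ko[of j] u'i \<open>i = k\<close> \<open>j \<noteq> k\<close> by auto
      next
        assume "i \<noteq> k" "j = k"
        then have "i \<in> ?B" using i by auto
        then show ?thesis using ko[of i] u'i \<open>i \<noteq> k\<close> \<open>j = k\<close> by auto
      qed (use kk in auto)
    qed
  qed
qed

lemma matrix_inv_unique:
  fixes A B :: "real ^ 'n ^ 'n"
  assumes "B ** A = mat 1"
  shows "det A \<noteq> 0" "matrix_inv A = B"
proof -
  have "A ** B = mat 1" using assms matrix_left_right_inverse by blast
  then show 0: "det A \<noteq> 0"
    using assms unfolding invertible_det_nz[symmetric] invertible_def by blast
  have "matrix_inv A = (B ** A) ** matrix_inv A" by (simp add: assms)
  also have "\<dots> = B" by (simp add: matrix_mul_assoc[symmetric] matrix_inv_mult[OF 0])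
  finally show "matrix_inv A = B" .
qed

section \<open>Local Finsler geometry\<close>

text \<open>What a Finsler metric looks like to a single chart. Continuity includes the zero
  vectors, where \<open>f\<close> is not assumed smooth; this lets cut-offs in \<open>f\<close> be
  extended across the origin of a fibre.\<close>

locale finsler_chart =
  fixes U :: "(real ^ 'n::finite) set" and f :: "'n tb \<Rightarrow> real"
  assumes open_U: "open U"
    and smooth_f: "smooth_on (slit_over U) f"
    and cont_f: "continuous_on (U \<times> UNIV) f"
    and f_scale: "\<And>x y t. x \<in> U \<Longrightarrow> t > 0 \<Longrightarrow> f (x, t *\<^sub>R y) = t * f (x, y)"
    and f_nonneg: "\<And>z. z \<in> slit_over U \<Longrightarrow> f z \<ge> 0"
    and gmat_pos: "\<And>z w. z \<in> slit_over U \<Longrightarrow> w \<noteq> 0 \<Longrightarrow> bil (gmat f z) w w > 0"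
begin

abbreviation "Om \<equiv> slit_over U"
abbreviation "f2 \<equiv> \<lambda>w. (f w)\<^sup>2"

lemmas open_Om = open_slit_over[OF open_U]

lemma diff_Om: "smooth_on Om h \<Longrightarrow> z \<in> Om \<Longrightarrow> h differentiable (at z)"
  by (rule smooth_on_differentiable)

lemma smooth_f2: "smooth_on Om f2"
  by (intro smooth_on_power2 smooth_f)

lemma homog_f: "homog U 1 f"
  by (rule homogI) (simp add: f_scale slit_over_def)

lemma homog_f2: "homog U 2 f2"
  using homog_mult[OF homog_f homog_f] by (simp add: power2_eq_square)

lemma gmat_eq: "gmat f z $ i $ j = 1/2 * dY j (dY i f2) z"
  by (simp add: gmat_def)

lemma smooth_g: "smooth_on Om (\<lambda>z. gmat f z $ i $ j)"
  unfolding gmat_eq by (intro smooth_on_mult smooth_on_const open_Om smooth_on_dY smooth_f2)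

lemma homog_g: "homog U 0 (\<lambda>z. gmat f z $ i $ j)"
proof -
  have "homog U (2 - 1 - 1) (dY j (dY i f2))"
    by (intro homog_dY smooth_on_dY smooth_f2 homog_f2)
  then show ?thesis unfolding gmat_eq by (intro homog_cmult) simp
qed

lemma gmat_scale: "(x, y) \<in> Om \<Longrightarrow> t > 0 \<Longrightarrow> gmat f (x, t *\<^sub>R y) = gmat f (x, y)"
  using homogD[OF homog_g] by (simp add: vec_eq_iff)

lemma gmat_sym: "z \<in> Om \<Longrightarrow> gmat f z $ i $ j = gmat f z $ j $ i"
  unfolding gmat_eq dY_eq_dd by (simp add: dd_commute[OF smooth_f2])

lemma gmat_snd:
  assumes "z \<in> Om"
  shows "(\<Sum>j\<in>UNIV. gmat f z $ i $ j * snd z $ j) = 1/2 * dY i f2 z"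
proof -
  have "(\<Sum>j\<in>UNIV. snd z $ j * dY j (dY i f2) z) = (2 - 1) * dY i f2 z"
    by (rule euler_homog(2)[OF smooth_on_dY[OF smooth_f2] homog_dY[OF smooth_f2 homog_f2] assms])
  moreover have "(\<Sum>j\<in>UNIV. gmat f z $ i $ j * snd z $ j) = 1/2 * (\<Sum>j\<in>UNIV. snd z $ j * dY j (dY i f2) z)"
    unfolding sum_distrib_left by (rule sum.cong) (simp_all add: gmat_eq)
  ultimately show ?thesis by simp
qed

lemma gmat_snd_snd:
  assumes "z \<in> Om"
  shows "bil (gmat f z) (snd z) (snd z) = f2 z"
proof -
  have "bil (gmat f z) (snd z) (snd z) = (\<Sum>i\<in>UNIV. snd z $ i * (\<Sum>j\<in>UNIV. gmat f z $ i $ j * snd z $ j))"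
    by (simp add: bil_def sum_distrib_left algebra_simps)
  also have "\<dots> = 1/2 * (\<Sum>i\<in>UNIV. snd z $ i * dY i f2 z)"
    unfolding gmat_snd[OF assms] by (simp add: sum_distrib_left algebra_simps)
  also have "(\<Sum>i\<in>UNIV. snd z $ i * dY i f2 z) = 2 * f2 z"
    by (rule euler_homog(2)[OF smooth_f2 homog_f2 assms])
  finally show ?thesis by simp
qed

text \<open>Only nonnegativity is part of the definition; strictness follows from g(y, y) = F^2 and
  positive definiteness.\<close>

lemma f_pos: "z \<in> Om \<Longrightarrow> f z > 0"
  using f_nonneg[of z] gmat_pos[of z "snd z"] gmat_snd_snd[of z]
  by (cases "f z = 0") (auto simp: slit_over_def)

lemma dY_f2: "z \<in> Om \<Longrightarrow> dY i f2 z = 2 * f z * dY i f z"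
  unfolding dY_eq_dd by (rule dd_power2[OF diff_Om[OF smooth_f]])

lemma dX_f2: "z \<in> Om \<Longrightarrow> dX i f2 z = 2 * f z * dX i f z"
  unfolding dX_eq_dd by (rule dd_power2[OF diff_Om[OF smooth_f]])

text \<open>The hypotheses of the theorem quantify over adapted frames, so they are empty unless
  frames exist around each point. Orthonormalizing y/F together with n - 1 coordinate vectors works
  wherever the component of y in the omitted direction stays nonzero, which is an open conic
  set.\<close>

lemma adapted_frame_exists:
  assumes z0: "z0 \<in> Om"
  shows "\<exists>W u. adapted_frame m f W u \<and> W \<subseteq> Om \<and> z0 \<in> W"
proof -
  obtain i0 where i0: "snd z0 $ i0 \<noteq> 0"
    using z0 by (auto simp: slit_over_def vec_eq_iff)
  define W where "W = Om \<inter> {z. snd z $ i0 \<noteq> 0}"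
  have W: "open W" "W \<subseteq> Om"
    unfolding W_def by (auto intro!: open_Int open_Om open_Collect_neq continuous_intros)
  have WOm: "smooth_on W h" if "smooth_on Om h" for h :: "'n tb \<Rightarrow> 'b::real_normed_vector"
    using smooth_on_subset[OF that W] .
  \<comment> \<open>The transposition sends the marked index \<open>m\<close> to the coordinate
    \<open>i0\<close> that y replaces, and the other indices bijectively to the remaining
    coordinates.\<close>
  define \<pi> where "\<pi> = Transposition.transpose m i0"
  have \<pi>: "inj \<pi>" "\<pi> m = i0" by (auto simp: \<pi>_def)
  define b where "b i z = (if i = m then (1 / f z) *\<^sub>R snd z else axis (\<pi> i) 1)" for i and z :: "'n tb"
  have sb: "smooth_on W (b i)" for i
  proof (cases "i = m")
    case True
    have "smooth_on W (\<lambda>z. (1 / f z) *\<^sub>R snd z)"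
      using f_pos by (intro WOm smooth_on_scaleR smooth_on_divide smooth_on_const smooth_f open_Om
          smooth_on_linear[OF bounded_linear_snd] smooth_on_id) force
    moreover have "b i = (\<lambda>z. (1 / f z) *\<^sub>R snd z)" using True by (simp add: b_def fun_eq_iff)
    ultimately show ?thesis by simp
  next
    case False
    then have "b i = (\<lambda>z. axis (\<pi> i) 1)" by (simp add: b_def fun_eq_iff)
    then show ?thesis using smooth_on_const[OF W(1)] by simp
  qed
  have indep: "b k z \<notin> span ((\<lambda>j. b j z) ` (- {k}))" if "z \<in> W" for z k
  proof -
    \<comment> \<open>A linear functional that vanishes on every \<open>b j z\<close> with j
      different from \<open>k\<close> but not on \<open>b k z\<close>, which proves
      independence.\<close>
    define L where "L v = (if k = m then v $ i0 else v $ \<pi> k - snd z $ \<pi> k / snd z $ i0 * v $ i0)" for v :: "real ^ 'n"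
    have z: "snd z $ i0 \<noteq> 0" "f z > 0" using that f_pos W by (auto simp: W_def)
    have lin: "linear L"
      by (rule linearI) (auto simp: L_def algebra_simps add_divide_distrib)
    have ne: "\<pi> i \<noteq> i0" if "i \<noteq> m" for i
      using \<pi> that by (metis injD)
    have 0: "L (b j z) = 0" if "j \<noteq> k" for j
    proof (cases "j = m")
      case True
      then show ?thesis using z that by (simp add: L_def b_def field_simps)
    next
      case False
      have "\<pi> j \<noteq> \<pi> k" using that \<pi>(1) by (metis injD)
      then show ?thesis using False ne by (auto simp: L_def b_def axis_def)
    qed
    have 1: "L (b k z) \<noteq> 0"
      using z ne by (auto simp: L_def b_def axis_def)
    have "L v = 0" if "v \<in> span ((\<lambda>j. b j z) ` (- {k}))" for v
      by (rule linear_eq_0_on_span[OF lin _ that]) (use 0 in auto)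
    with 1 show ?thesis by blast
  qed
  define R where "R z z' \<longleftrightarrow> (\<exists>t>0. z' = (fst z, t *\<^sub>R snd z))" for z z' :: "'n tb"
  have inv: "z' \<in> W \<and> gmat f z' = gmat f z \<and> (\<forall>i. b i z' = b i z)" if R: "R z z'" and zW: "z \<in> W" for z z'
  proof -
    obtain t where t: "t > 0" "z' = (fst z, t *\<^sub>R snd z)" using R unfolding R_def by blast
    have z: "z \<in> Om" "fst z \<in> U" "z' \<in> W" using zW t by (auto simp: W_def slit_over_def)
    have "f z' = t * f z" using f_scale[OF z(2) t(1), of "snd z"] t(2) by simp
    moreover have "gmat f z' = gmat f z" using gmat_scale[of "fst z" "snd z" t] t z(1) by simp
    ultimately show ?thesis using z t f_pos[OF z(1)] by (simp add: b_def)
  qed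
  have bm: "bil (gmat f z) (b m z) (b m z) = 1" if "z \<in> W" for z
  proof -
    have z: "z \<in> Om" using that W by auto
    show ?thesis
      using f_pos[OF z] gmat_snd_snd[OF z]
      by (simp add: b_def bil_scale_left bil_scale_right power2_eq_square)
  qed
  have "\<exists>u. (\<forall>i\<in>insert m UNIV. smooth_on W (u i) \<and> (\<forall>z\<in>W. \<forall>z'. R z z' \<longrightarrow> u i z' = u i z)) \<and>
    (\<forall>z\<in>W. u m z = b m z \<and> (\<forall>i\<in>insert m UNIV. u i z \<in> span ((\<lambda>j. b j z) ` insert m UNIV) \<and>
      (\<forall>j\<in>insert m UNIV. bil (gmat f z) (u i z) (u j z) = (if i = j then 1 else 0))))"
    by (rule gram_schmidt[OF W(1)])
      (use W gmat_pos gmat_sym sb indep inv bm in \<open>auto intro: WOm[OF smooth_g]\<close>)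
  then obtain u where u0: "(\<forall>i\<in>insert m UNIV. smooth_on W (u i) \<and> (\<forall>z\<in>W. \<forall>z'. R z z' \<longrightarrow> u i z' = u i z)) \<and>
    (\<forall>z\<in>W. u m z = b m z \<and> (\<forall>i\<in>insert m UNIV. u i z \<in> span ((\<lambda>j. b j z) ` insert m UNIV) \<and>
      (\<forall>j\<in>insert m UNIV. bil (gmat f z) (u i z) (u j z) = (if i = j then 1 else 0))))"
    by blast
  have u: "smooth_on W (u i)" "z \<in> W \<Longrightarrow> R z z' \<Longrightarrow> u i z' = u i z"
     "z \<in> W \<Longrightarrow> u m z = b m z"
     "z \<in> W \<Longrightarrow> bil (gmat f z) (u i z) (u j z) = (if i = j then 1 else 0)" for i j z z'
    using u0 by blast+
  have "adapted_frame m f W u"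
    unfolding adapted_frame_def
  proof (intro conjI ballI allI impI)
    show "open W" by (rule W(1))
    show "case z of (x, y) \<Rightarrow> \<forall>t>0. (x, t *\<^sub>R y) \<in> W" if "z \<in> W" for z
      using that by (auto simp: W_def slit_over_def)
    show "smooth_on W (u i)" for i by (rule u(1))
    show "case z of (x, y) \<Rightarrow> \<forall>t>0. u i (x, t *\<^sub>R y) = u i (x, y)" if "z \<in> W" for z i
      using u(2)[OF that, of _ i] by (cases z) (auto simp: R_def)
    show "(\<Sum>k\<in>UNIV. \<Sum>l\<in>UNIV. gmat f z $ k $ l * u i z $ k * u j z $ l) = (if i = j then 1 else 0)"
      if "z \<in> W" for z i j
      using u(4)[OF that] by (simp add: bil_def)
    show "u m z = (1 / f z) *\<^sub>R snd z" if "z \<in> W" for z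
      using u(3)[OF that] by (simp add: b_def)
  qed
  moreover have "z0 \<in> W" using z0 i0 by (simp add: W_def)
  ultimately show ?thesis using W by blast
qed

end

locale finsler_frame = finsler_chart +
  fixes m :: 'a and W :: "'a tb set" and u :: "'a \<Rightarrow> 'a tb \<Rightarrow> real ^ 'a"
  assumes frame: "adapted_frame m f W u" and W_sub: "W \<subseteq> Om"
begin

lemma open_W: "open W" and smooth_u: "smooth_on W (u i)"
  using frame by (auto simp: adapted_frame_def)

lemma smooth_W: "smooth_on Om h \<Longrightarrow> smooth_on W h"
  using smooth_on_subset[OF _ open_W W_sub] .

lemma u_orth: "z \<in> W \<Longrightarrow> bil (gmat f z) (u i z) (u j z) = (if i = j then 1 else 0)"
  using frame by (simp add: adapted_frame_def bil_def)

lemma u_m: "z \<in> W \<Longrightarrow> u m z = (1 / f z) *\<^sub>R snd z"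
  using frame by (simp add: adapted_frame_def)

context fixes z assumes z: "z \<in> W"
begin

text \<open>Orthonormality read as a matrix identity: the inverse of the frame matrix arises by
  lowering the frame index with g.\<close>

lemma frame_matrix:
  "(\<chi> i j. \<Sum>k\<in>UNIV. gmat f z $ k $ j * u i z $ k) ** (\<chi> j i. u i z $ j) = mat 1"
proof -
  have "(\<Sum>l\<in>UNIV. (\<Sum>k\<in>UNIV. gmat f z $ k $ l * u i z $ k) * u j z $ l) = bil (gmat f z) (u i z) (u j z)" for i j
    unfolding bil_def sum_distrib_right by (subst sum.swap) (rule refl)
  then show ?thesis
    by (simp add: vec_eq_iff matrix_matrix_mult_def mat_def u_orth[OF z])
qed

lemma coframe_eq: "coframe_mat u z $ i $ j = (\<Sum>k\<in>UNIV. gmat f z $ k $ j * u i z $ k)"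
  unfolding coframe_mat_def matrix_inv_unique(2)[OF frame_matrix] by simp

lemma coframe_u: "(\<Sum>j\<in>UNIV. coframe_mat u z $ i $ j * u k z $ j) = (if i = k then 1 else 0)"
  using sum_matrix_inv_mult(2)[OF matrix_inv_unique(1)[OF frame_matrix], of i k]
  by (simp add: coframe_mat_def)

lemma u_coframe: "(\<Sum>i\<in>UNIV. u i z $ k * coframe_mat u z $ i $ j) = (if k = j then 1 else 0)"
  using sum_matrix_inv_mult(1)[OF matrix_inv_unique(1)[OF frame_matrix], of k j]
  by (simp add: coframe_mat_def)

lemma ginv_matrix: "(\<chi> k l. \<Sum>i\<in>UNIV. u i z $ k * u i z $ l) ** gmat f z = mat 1"
proof -
  have zOm: "z \<in> Om" using z W_sub by auto
  have "(\<Sum>l\<in>UNIV. (\<Sum>i\<in>UNIV. u i z $ k * u i z $ l) * gmat f z $ l $ j) = (if k = j then 1 else 0)" for k j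
  proof -
    have "(\<Sum>l\<in>UNIV. (\<Sum>i\<in>UNIV. u i z $ k * u i z $ l) * gmat f z $ l $ j)
        = (\<Sum>i\<in>UNIV. u i z $ k * (\<Sum>l\<in>UNIV. gmat f z $ l $ j * u i z $ l))"
      unfolding sum_distrib_right sum_distrib_left by (subst sum.swap) (simp add: algebra_simps)
    also have "\<dots> = (\<Sum>i\<in>UNIV. u i z $ k * coframe_mat u z $ i $ j)"
      by (simp add: coframe_eq)
    finally show ?thesis by (simp add: u_coframe)
  qed
  then show ?thesis
    by (simp add: vec_eq_iff matrix_matrix_mult_def mat_def)
qed

lemma ginv_eq: "matrix_inv (gmat f z) $ k $ l = (\<Sum>i\<in>UNIV. u i z $ k * u i z $ l)"
  unfolding matrix_inv_unique(2)[OF ginv_matrix] by simp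

text \<open>With P the frame matrix, the inverse metric is P times its transpose, so (det P)^2 det g
  = 1.\<close>

lemma det_gmat_pos_frame: "det (gmat f z) > 0"
proof -
  define P where "P = (\<chi> k i. u i z $ k)"
  have "(\<chi> k l. \<Sum>i\<in>UNIV. u i z $ k * u i z $ l) = P ** transpose P"
    by (simp add: P_def vec_eq_iff matrix_matrix_mult_def transpose_def)
  then have "det (P ** transpose P ** gmat f z) = 1"
    using ginv_matrix by simp
  then have "(det P)\<^sup>2 * det (gmat f z) = 1"
    by (simp add: det_mul det_transpose power2_eq_square)
  then show ?thesis
    by (metis mult_le_0_iff not_less zero_le_power2 zero_less_one linorder_not_le)
qed

end

end

context finsler_chart
begin

section \<open>Determinant and inverse of the fundamental tensor\<close>

lemma det_gmat_pos:
  assumes "z \<in> Om"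
  shows "det (gmat f z) > 0"
proof -
  obtain W u where "adapted_frame undefined f W u" "W \<subseteq> Om" "z \<in> W"
    using adapted_frame_exists[OF assms] by blast
  then interpret finsler_frame U f undefined W u by unfold_locales
  show ?thesis by (rule det_gmat_pos_frame) fact
qed

lemma smooth_det_gmat: "smooth_on Om (\<lambda>z. det (gmat f z))"
  by (intro smooth_on_det open_Om smooth_g)

abbreviation "ginv z \<equiv> matrix_inv (gmat f z)"

lemma smooth_ginv: "smooth_on Om (\<lambda>z. ginv z $ i $ j)"
  using det_gmat_pos by (intro smooth_on_matrix_inv open_Om smooth_g) force

lemma dY_det_gmat:
  assumes z: "z \<in> Om"
  shows "dY k (\<lambda>z. det (gmat f z)) z = det (gmat f z) *
      (\<Sum>i\<in>UNIV. \<Sum>j\<in>UNIV. ginv z $ i $ j * dY k (\<lambda>z. gmat f z $ j $ i) z)"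
  unfolding dY_eq_dd using det_gmat_pos[OF z] by (intro dd_det diff_Om[OF smooth_g z]) simp

lemma ginv_mult:
  assumes "z \<in> Om"
  shows "(\<Sum>k\<in>UNIV. gmat f z $ i $ k * ginv z $ k $ j) = (if i = j then 1 else 0)"
    "(\<Sum>k\<in>UNIV. ginv z $ i $ k * gmat f z $ k $ j) = (if i = j then 1 else 0)"
  using sum_matrix_inv_mult[of "gmat f z" i j] det_gmat_pos[OF assms] by simp_all

lemma homog_ginv: "homog U 0 (\<lambda>z. ginv z $ i $ j)"
  by (rule homogI) (simp add: gmat_scale)

lemma ginv_sym:
  assumes "z \<in> Om"
  shows "ginv z $ i $ j = ginv z $ j $ i"
proof -
  obtain W u where "adapted_frame undefined f W u" "W \<subseteq> Om" "z \<in> W"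
    using adapted_frame_exists[OF assms] by blast
  then interpret finsler_frame U f undefined W u by unfold_locales
  show ?thesis by (simp add: ginv_eq[OF \<open>z \<in> W\<close>] mult.commute)
qed

subsection \<open>The spray\<close>

lemma smooth_spray: "smooth_on Om (spray f i)"
proof -
  have "smooth_on Om (\<lambda>z. 1/4 * (\<Sum>l\<in>UNIV. ginv z $ i $ l *
      ((\<Sum>k\<in>UNIV. dY l (dX k f2) z * snd z $ k) - dX l f2 z)))"
    by (intro smooth_on_mult smooth_on_const open_Om smooth_on_sum smooth_ginv smooth_on_diff
        smooth_on_dY smooth_on_dX smooth_f2 smooth_on_coord)
  then show ?thesis by (simp add: spray_def[abs_def])
qed

lemma homog_spray: "homog U 2 (spray f i)"
proof -
  have 1: "homog U ((2 - 1) + 1) (\<lambda>z. dY l (dX k f2) z * snd z $ k)" for l k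
    by (intro homog_mult homog_coord homog_dY homog_dX smooth_on_dX smooth_f2 homog_f2)
  have "homog U (0 + 2) (\<lambda>z. ginv z $ i $ l * ((\<Sum>k\<in>UNIV. dY l (dX k f2) z * snd z $ k) - dX l f2 z))" for l
    using 1 by (intro homog_mult homog_ginv homog_diff homog_sum homog_dX smooth_f2 homog_f2) simp
  then have "homog U 2 (\<lambda>z. 1/4 * (\<Sum>l\<in>UNIV. ginv z $ i $ l *
      ((\<Sum>k\<in>UNIV. dY l (dX k f2) z * snd z $ k) - dX l f2 z)))"
    by (intro homog_cmult homog_sum) simp
  then show ?thesis by (simp add: spray_def[abs_def])
qed

lemma smooth_nonlin: "smooth_on Om (nonlin f i k)"
  unfolding nonlin_def by (intro smooth_on_dY smooth_spray)

lemma homog_nonlin: "homog U 1 (nonlin f i k)"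
  using homog_dY[OF smooth_spray homog_spray] by (simp add: nonlin_def)

lemma nonlin_snd:
  assumes "z \<in> Om"
  shows "(\<Sum>k\<in>UNIV. snd z $ k * nonlin f i k z) = 2 * spray f i z"
  unfolding nonlin_def by (rule euler_homog(2)[OF smooth_spray homog_spray assms])

lemma gmat_spray:
  assumes "z \<in> Om"
  shows "(\<Sum>i\<in>UNIV. gmat f z $ j $ i * spray f i z)
    = 1/4 * ((\<Sum>k\<in>UNIV. dY j (dX k f2) z * snd z $ k) - dX j f2 z)"
proof -
  define T where "T l = (\<Sum>k\<in>UNIV. dY l (dX k f2) z * snd z $ k) - dX l f2 z" for l
  have "(\<Sum>i\<in>UNIV. gmat f z $ j $ i * spray f i z)
      = (\<Sum>i\<in>UNIV. \<Sum>l\<in>UNIV. 1/4 * (gmat f z $ j $ i * ginv z $ i $ l * T l))"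
  proof -
    have "spray f i z = 1/4 * (\<Sum>l\<in>UNIV. ginv z $ i $ l * T l)" for i
      by (simp add: spray_def T_def)
    then show ?thesis by (simp add: sum_distrib_left algebra_simps)
  qed
  also have "\<dots> = (\<Sum>l\<in>UNIV. 1/4 * T l * (\<Sum>i\<in>UNIV. gmat f z $ j $ i * ginv z $ i $ l))"
    by (subst sum.swap) (simp add: sum_distrib_left algebra_simps)
  also have "\<dots> = 1/4 * T j"
    by (simp add: ginv_mult(1)[OF assms] if_distrib cong: if_cong)
  finally show ?thesis by (simp add: T_def)
qed

text \<open>In other words, F^2 is constant along the spray y^k d/dx^k - 2 G^k d/dy^k. This follows
  by contracting \<open>gmat_spray\<close> with y, since the x-derivatives of F^2 are 2-homogeneous
  in y.\<close>

lemma dY_f2_spray: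
  assumes z: "z \<in> Om"
  shows "(\<Sum>i\<in>UNIV. dY i f2 z * spray f i z) = 1/2 * (\<Sum>k\<in>UNIV. snd z $ k * dX k f2 z)"
proof -
  have eul: "(\<Sum>l\<in>UNIV. snd z $ l * dY l (dX k f2) z) = 2 * dX k f2 z" for k
    by (rule euler_homog(2)[OF smooth_on_dX[OF smooth_f2] homog_dX[OF smooth_f2 homog_f2] z])
  have "(\<Sum>i\<in>UNIV. dY i f2 z * spray f i z)
      = 2 * (\<Sum>i\<in>UNIV. (\<Sum>j\<in>UNIV. gmat f z $ j $ i * snd z $ j) * spray f i z)"
  proof -
    have "(\<Sum>j\<in>UNIV. gmat f z $ j $ i * snd z $ j) = (\<Sum>j\<in>UNIV. gmat f z $ i $ j * snd z $ j)" for i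
      by (rule sum.cong[OF refl]) (metis gmat_sym[OF z])
    then have "dY i f2 z = 2 * (\<Sum>j\<in>UNIV. gmat f z $ j $ i * snd z $ j)" for i
      using gmat_snd[OF z, of i] by simp
    then show ?thesis by (simp add: mult.assoc flip: sum_distrib_left)
  qed
  also have "(\<Sum>i\<in>UNIV. (\<Sum>j\<in>UNIV. gmat f z $ j $ i * snd z $ j) * spray f i z)
      = (\<Sum>j\<in>UNIV. snd z $ j * (\<Sum>i\<in>UNIV. gmat f z $ j $ i * spray f i z))"
    unfolding sum_distrib_left sum_distrib_right by (subst sum.swap) (simp add: algebra_simps)
  also have "\<dots> = 1/4 * ((\<Sum>j\<in>UNIV. \<Sum>k\<in>UNIV. snd z $ k * (snd z $ j * dY j (dX k f2) z))
      - (\<Sum>j\<in>UNIV. snd z $ j * dX j f2 z))"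
    unfolding gmat_spray[OF z] by (simp add: sum_distrib_left algebra_simps sum_subtractf)
  also have "(\<Sum>j\<in>UNIV. \<Sum>k\<in>UNIV. snd z $ k * (snd z $ j * dY j (dX k f2) z))
      = (\<Sum>k\<in>UNIV. snd z $ k * (2 * dX k f2 z))"
    by (subst sum.swap) (simp add: sum_distrib_left[symmetric] eul)
  also have "(\<Sum>k\<in>UNIV. snd z $ k * (2 * dX k f2 z)) = 2 * (\<Sum>k\<in>UNIV. snd z $ k * dX k f2 z)"
    by (simp add: sum_distrib_left algebra_simps)
  finally show ?thesis by simp
qed

text \<open>This is delta F^2 / delta x^j = 0. Differentiating \<open>dY_f2_spray\<close> in y^j
  gives it, because \<open>gmat_spray\<close> turns the term with the Hessian of F^2 into one that
  cancels the mixed derivatives.\<close>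

lemma dX_f2_nonlin:
  assumes z: "z \<in> Om"
  shows "dX j f2 z = (\<Sum>i\<in>UNIV. dY i f2 z * nonlin f i j z)"
proof -
  note [simp] = diff_Om[OF _ z] smooth_spray smooth_f2 smooth_on_dY smooth_on_dX smooth_on_coord open_Om
  have "dY j (\<lambda>z. \<Sum>i\<in>UNIV. dY i f2 z * spray f i z) z = dY j (\<lambda>z. 1/2 * (\<Sum>k\<in>UNIV. snd z $ k * dX k f2 z)) z"
    unfolding dY_eq_dd[of j] by (rule dd_cong[OF open_Om z]) (rule dY_f2_spray)
  moreover have "dY j (\<lambda>z. \<Sum>i\<in>UNIV. dY i f2 z * spray f i z) z
      = (\<Sum>i\<in>UNIV. dY i f2 z * nonlin f i j z) + (\<Sum>i\<in>UNIV. dY j (dY i f2) z * spray f i z)"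
    unfolding nonlin_def dY_eq_dd[of j] by (simp add: dd_sum dd_mult sum.distrib)
  moreover have "dY j (\<lambda>z. 1/2 * (\<Sum>k\<in>UNIV. snd z $ k * dX k f2 z)) z
      = 1/2 * ((\<Sum>k\<in>UNIV. snd z $ k * dY j (dX k f2) z) + dX j f2 z)"
  proof -
    have "dY j (\<lambda>z. 1/2 * (\<Sum>k\<in>UNIV. snd z $ k * dX k f2 z)) z
      = 1/2 * (\<Sum>k\<in>UNIV. snd z $ k * dY j (dX k f2) z + axis j 1 $ k * dX k f2 z)"
      unfolding dY_eq_dd[of j] by (subst dd_cmult, simp add: smooth_on_sum smooth_on_mult, subst dd_sum)
        (simp_all add: smooth_on_mult dd_mult)
    moreover have "(\<Sum>k\<in>UNIV. axis j 1 $ k * dX k f2 z) = dX j f2 z"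
      by (simp add: axis_def if_distrib if_distribR cong: if_cong)
    ultimately show ?thesis by (simp add: sum.distrib)
  qed
  moreover have "(\<Sum>i\<in>UNIV. dY j (dY i f2) z * spray f i z) = 2 * (\<Sum>i\<in>UNIV. gmat f z $ j $ i * spray f i z)"
    unfolding sum_distrib_left using gmat_sym[OF z] by (intro sum.cong) (simp_all add: gmat_eq)
  ultimately show ?thesis
    using gmat_spray[OF z, of j] by (simp add: mult.commute)
qed

lemma dX_f_nonlin:
  assumes z: "z \<in> Om"
  shows "dX j f z = (\<Sum>i\<in>UNIV. dY i f z * nonlin f i j z)"
proof -
  have "2 * f z * dX j f z = 2 * f z * (\<Sum>i\<in>UNIV. dY i f z * nonlin f i j z)"
    using dX_f2_nonlin[OF z, of j] unfolding dX_f2[OF z] dY_f2[OF z] sum_distrib_left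
    by (simp add: mult.assoc)
  then show ?thesis using f_pos[OF z] by simp
qed

lemma dd_delta_x:
  assumes "smooth_on Om h" "z \<in> Om"
  shows "dd (delta_x f j z) h z = dX j h z - (\<Sum>k\<in>UNIV. nonlin f k j z * dY k h z)"
  unfolding delta_x_def dd_tb[OF diff_Om[OF assms]]
  by (simp add: axis_def sum_negf if_distrib if_distribR cong: if_cong)

text \<open>Differentiating delta F / delta x^a = 0 in y^b shows that both sides equal F_p times the
  second y-derivative of G^p. Thus the exterior derivative of the Hilbert form vanishes on pairs of
  horizontal vectors, and subtracting a multiple of F from S will not disturb the closedness of
  xi.\<close>

lemma delta_x_dY_f_sym:
  assumes z: "z \<in> Om"
  shows "dd (delta_x f a z) (dY b f) z = dd (delta_x f b z) (dY a f) z"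
proof -
  note [simp] = diff_Om[OF _ z] smooth_nonlin smooth_f smooth_on_dY smooth_on_dX open_Om
  have *: "dd (delta_x f a z) (dY b f) z = (\<Sum>p\<in>UNIV. dY p f z * dY b (dY a (spray f p)) z)" for a b
  proof -
    have "dY b (dX a f) z = dY b (\<lambda>z. \<Sum>i\<in>UNIV. dY i f z * nonlin f i a z) z"
      unfolding dY_eq_dd[of b] by (rule dd_cong[OF open_Om z]) (rule dX_f_nonlin)
    also have "\<dots> = (\<Sum>i\<in>UNIV. dY i f z * dY b (nonlin f i a) z) + (\<Sum>i\<in>UNIV. dY b (dY i f) z * nonlin f i a z)"
      unfolding dY_eq_dd[of b] by (simp add: dd_sum dd_mult sum.distrib)
    finally have "dX a (dY b f) z = (\<Sum>i\<in>UNIV. dY i f z * dY b (nonlin f i a) z) + (\<Sum>i\<in>UNIV. dY i (dY b f) z * nonlin f i a z)"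
      unfolding dX_eq_dd dY_eq_dd by (simp add: dd_commute[OF smooth_f z])
    then show ?thesis
      unfolding dd_delta_x[OF smooth_on_dY[OF smooth_f] z] nonlin_def by (simp add: mult.commute)
  qed
  have "dY b (dY a (spray f p)) z = dY a (dY b (spray f p)) z" for p
    unfolding dY_eq_dd by (rule dd_commute[OF smooth_spray z])
  then show ?thesis by (simp add: *)
qed

text \<open>Euler's relation N^k_i y^i = 2 G^k identifies the horizontal lift of y with the
  spray.\<close>

lemma spray_vector_eq:
  assumes z: "z \<in> Om"
  shows "(\<Sum>i\<in>UNIV. snd z $ i *\<^sub>R delta_x f i z) = (snd z, - 2 *\<^sub>R (\<chi> k. spray f k z))"
proof (rule prod_eqI)
  show "fst (\<Sum>i\<in>UNIV. snd z $ i *\<^sub>R delta_x f i z) = fst (snd z, - 2 *\<^sub>R (\<chi> k. spray f k z))"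
    using vec_eq_sum_axis[of "snd z"] by (simp add: fst_sum delta_x_def)
  show "snd (\<Sum>i\<in>UNIV. snd z $ i *\<^sub>R delta_x f i z) = snd (snd z, - 2 *\<^sub>R (\<chi> k. spray f k z))"
    using nonlin_snd[OF z] by (simp add: snd_sum delta_x_def vec_eq_iff sum_negf)
qed

lemma reeb_eq: "reeb f z = (1 / f z) *\<^sub>R (\<Sum>i\<in>UNIV. snd z $ i *\<^sub>R delta_x f i z)"
  by (simp add: reeb_def scaleR_sum_right)

end

section \<open>Smooth 1-forms\<close>

definition form_on :: "'a::euclidean_space set \<Rightarrow> ('a \<Rightarrow> 'a \<Rightarrow> real) \<Rightarrow> bool" where
  "form_on W \<omega> \<longleftrightarrow> open W \<and> (\<forall>a. smooth_on W (\<lambda>w. \<omega> w a)) \<and> (\<forall>w\<in>W. linear (\<omega> w))"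

lemma form_on_smooth: "form_on W \<omega> \<Longrightarrow> smooth_on W (\<lambda>w. \<omega> w a)"
  and form_on_linear: "form_on W \<omega> \<Longrightarrow> w \<in> W \<Longrightarrow> linear (\<omega> w)"
  and form_on_open: "form_on W \<omega> \<Longrightarrow> open W"
  by (auto simp: form_on_def)

lemma form_onI: "open W \<Longrightarrow> (\<And>a. smooth_on W (\<lambda>w. \<omega> w a)) \<Longrightarrow> (\<And>w. w \<in> W \<Longrightarrow> linear (\<omega> w)) \<Longrightarrow> form_on W \<omega>"
  by (auto simp: form_on_def)

lemma form_on_cong:
  assumes "form_on W \<omega>" "\<And>w a. w \<in> W \<Longrightarrow> \<eta> w a = \<omega> w a"
  shows "form_on W \<eta>"
proof (rule form_onI)
  show "open W" by (rule form_on_open[OF assms(1)])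
  show "smooth_on W (\<lambda>w. \<eta> w a)" for a
    by (rule smooth_on_congI[OF form_on_smooth[OF assms(1)]]) (rule assms(2))
  show "linear (\<eta> w)" if "w \<in> W" for w
  proof -
    have "\<eta> w = \<omega> w" using assms(2)[OF that] by blast
    then show ?thesis using form_on_linear[OF assms(1) that] by simp
  qed
qed

lemma form_on_add: "form_on W \<omega> \<Longrightarrow> form_on W \<eta> \<Longrightarrow> form_on W (\<lambda>w a. \<omega> w a + \<eta> w a)"
  by (intro form_onI smooth_on_add linear_compose_add) (auto intro: form_on_smooth form_on_open form_on_linear)

lemma form_on_cmult:
  assumes "form_on W \<omega>" "smooth_on W h"
  shows "form_on W (\<lambda>w a. h w * \<omega> w a)"
proof (rule form_onI)
  show "open W" by (rule form_on_open[OF assms(1)])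
  show "smooth_on W (\<lambda>w. h w * \<omega> w a)" for a
    by (intro smooth_on_mult assms(2) form_on_smooth[OF assms(1)])
  show "linear (\<lambda>a. h w * \<omega> w a)" if "w \<in> W" for w
    using form_on_linear[OF assms(1) that]
    by (intro linearI) (simp_all add: linear_add linear_scale algebra_simps)
qed

lemma form_on_minus: "form_on W \<omega> \<Longrightarrow> form_on W (\<lambda>w a. - \<omega> w a)"
  using form_on_cmult[of W \<omega> "\<lambda>_. - 1"] by (simp add: smooth_on_const form_on_open)

lemma form_on_diff: "form_on W \<omega> \<Longrightarrow> form_on W \<eta> \<Longrightarrow> form_on W (\<lambda>w a. \<omega> w a - \<eta> w a)"
  using form_on_add[of W \<omega> "\<lambda>w a. - \<eta> w a"] form_on_minus by auto

lemma form_on_sum: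
  assumes "open W" "\<And>i. i \<in> I \<Longrightarrow> form_on W (\<omega> i)"
  shows "form_on W (\<lambda>w a. \<Sum>i\<in>I. \<omega> i w a)"
  using assms by (intro form_onI smooth_on_sum linear_compose_sum) (auto intro: form_on_smooth form_on_linear)

lemma form_on_apply:
  assumes "form_on W \<omega>" "smooth_on W e"
  shows "smooth_on W (\<lambda>w. \<omega> w (e w))"
proof -
  have "smooth_on W (\<lambda>w. \<Sum>b\<in>Basis. (e w \<bullet> b) * \<omega> w b)"
    by (intro smooth_on_sum smooth_on_mult form_on_smooth[OF assms(1)] form_on_open[OF assms(1)]
        smooth_on_linear[OF bounded_linear_inner_left assms(2)])
  then show ?thesis
  proof (rule smooth_on_congI)
    fix w assume "w \<in> W"
    note lin = form_on_linear[OF assms(1) this]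
    have "\<omega> w (e w) = \<omega> w (\<Sum>b\<in>Basis. (e w \<bullet> b) *\<^sub>R b)" by (simp add: euclidean_representation)
    then show "\<omega> w (e w) = (\<Sum>b\<in>Basis. (e w \<bullet> b) * \<omega> w b)"
      by (simp add: linear_sum[OF lin] linear_scale[OF lin])
  qed
qed

lemma ext_d_dd: "ext_d \<omega> z a b = dd a (\<lambda>w. \<omega> w b) z - dd b (\<lambda>w. \<omega> w a) z"
  by (simp add: ext_d_def dd_def)

lemma ext_d_antisym: "ext_d \<omega> z a b = - ext_d \<omega> z b a"
  by (simp add: ext_d_dd)

lemma ext_d_cong:
  assumes "open W" "z \<in> W" "\<And>w a. w \<in> W \<Longrightarrow> \<omega> w a = \<eta> w a"
  shows "ext_d \<omega> z a b = ext_d \<eta> z a b"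
  unfolding ext_d_dd using dd_cong[OF assms(1,2), of "\<lambda>w. \<omega> w b" "\<lambda>w. \<eta> w b"]
    dd_cong[OF assms(1,2), of "\<lambda>w. \<omega> w a" "\<lambda>w. \<eta> w a"] assms(3) by simp

lemma form_on_diffble: "form_on W \<omega> \<Longrightarrow> z \<in> W \<Longrightarrow> (\<lambda>w. \<omega> w a) differentiable (at z)"
  using smooth_on_differentiable form_on_smooth by blast

lemma ext_d_diff:
  assumes "form_on W \<omega>" "form_on W \<eta>" "z \<in> W"
  shows "ext_d (\<lambda>w a. \<omega> w a - \<eta> w a) z a b = ext_d \<omega> z a b - ext_d \<eta> z a b"
  unfolding ext_d_dd using assms by (simp add: dd_diff form_on_diffble)

lemma ext_d_sum:
  assumes "\<And>i. i \<in> I \<Longrightarrow> form_on W (\<omega> i)" "z \<in> W"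
  shows "ext_d (\<lambda>w a. \<Sum>i\<in>I. \<omega> i w a) z a b = (\<Sum>i\<in>I. ext_d (\<omega> i) z a b)"
  unfolding ext_d_dd using assms by (subst (1 2) dd_sum) (auto simp: sum_subtractf intro: form_on_diffble)

lemma linear_ext_d:
  assumes "form_on W \<omega>" "z \<in> W"
  shows "linear (\<lambda>a. ext_d \<omega> z a b)" "linear (ext_d \<omega> z a)"
proof -
  have *: "linear (\<lambda>a. ext_d \<omega> z a b)" for b
  proof (rule linearI)
    fix a a' :: 'a and c :: real
    have "dd b (\<lambda>w. \<omega> w (a + a')) z = dd b (\<lambda>w. \<omega> w a + \<omega> w a') z"
      by (rule dd_cong[OF form_on_open[OF assms(1)] assms(2)]) (simp add: linear_add[OF form_on_linear[OF assms(1)]])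
    then show "ext_d \<omega> z (a + a') b = ext_d \<omega> z a b + ext_d \<omega> z a' b"
      by (simp add: ext_d_dd dd_add form_on_diffble[OF assms] dd_dir_add)
    have "dd b (\<lambda>w. \<omega> w (c *\<^sub>R a)) z = dd b (\<lambda>w. c * \<omega> w a) z"
      by (rule dd_cong[OF form_on_open[OF assms(1)] assms(2)]) (simp add: linear_scale[OF form_on_linear[OF assms(1)]])
    then show "ext_d \<omega> z (c *\<^sub>R a) b = c *\<^sub>R ext_d \<omega> z a b"
      by (simp add: ext_d_dd dd_cmult form_on_diffble[OF assms] dd_dir_scaleR algebra_simps)
  qed
  then show "linear (\<lambda>a. ext_d \<omega> z a b)" .
  have "ext_d \<omega> z a = (\<lambda>b. - ext_d \<omega> z b a)" by (rule ext) (rule ext_d_antisym)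
  then show "linear (ext_d \<omega> z a)" using linear_compose_neg[OF *[of a]] by simp
qed

lemma form_on_ext_d:
  assumes "form_on W \<omega>" "smooth_on W e"
  shows "form_on W (\<lambda>z b. ext_d \<omega> z (e z) b)"
proof (rule form_onI)
  show W: "open W" by (rule form_on_open[OF assms(1)])
  have "form_on W (\<lambda>z a. ext_d \<omega> z a b)" for b
  proof (rule form_onI[OF W])
    show "smooth_on W (\<lambda>w. ext_d \<omega> w a b)" for a
      unfolding ext_d_dd by (intro smooth_on_diff smooth_on_dd form_on_smooth[OF assms(1)])
  qed (rule linear_ext_d(1)[OF assms(1)])
  then show "smooth_on W (\<lambda>w. ext_d \<omega> w (e w) b)" for b
    by (rule form_on_apply[OF _ assms(2)])
  show "linear (ext_d \<omega> w (e w))" if "w \<in> W" for w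
    by (rule linear_ext_d(2)[OF assms(1) that])
qed

lemma smooth_ext_d:
  "form_on W \<omega> \<Longrightarrow> smooth_on W e \<Longrightarrow> smooth_on W e' \<Longrightarrow> smooth_on W (\<lambda>z. ext_d \<omega> z (e z) (e' z))"
  by (rule form_on_apply[OF form_on_ext_d])

lemma form_on_dd: "smooth_on W h \<Longrightarrow> form_on W (\<lambda>z a. dd a h z)"
  by (intro form_onI smooth_on_dd linear_dd) (auto intro: smooth_on_open smooth_on_differentiable)

lemma ext_d_dd_eq_0:
  fixes h :: "'a::euclidean_space \<Rightarrow> real"
  shows "smooth_on W h \<Longrightarrow> z \<in> W \<Longrightarrow> ext_d (\<lambda>z a. dd a h z) z a b = 0"
  by (simp add: ext_d_dd dd_commute[of W h z])

lemma form_on_basic: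
  fixes h :: "'n::finite \<Rightarrow> 'n tb \<Rightarrow> real"
  assumes "open W" "\<And>k. smooth_on W (h k)"
  shows "form_on W (\<lambda>z a. \<Sum>k\<in>UNIV. h k z * fst a $ k)"
  using assms by (intro form_onI smooth_on_sum smooth_on_mult smooth_on_const)
    (auto intro!: linearI simp: algebra_simps sum.distrib sum_distrib_left)

text \<open>A vertical vector annihilates the form at every point, so only the derivative of the
  coefficients along it remains. The traces of the mixed curvature components are read off this
  way.\<close>

lemma ext_d_basic_vertical:
  fixes h :: "'n::finite \<Rightarrow> 'n tb \<Rightarrow> real"
  assumes "\<And>k. h k differentiable (at z)" "fst b = 0"
  shows "ext_d (\<lambda>z a. \<Sum>k\<in>UNIV. h k z * fst a $ k) z a b = - (\<Sum>k\<in>UNIV. dd b (h k) z * fst a $ k)"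
  unfolding ext_d_dd using assms by (simp add: dd_sum dd_mult)

text \<open>Exchanging the two summed indices reverses the sign of the quadratic term, so it drops
  out of the trace. The curvature traces in the hypotheses therefore depend on the traces of the
  connection forms only.\<close>

lemma curv_form_trace:
  assumes "\<And>i. form_on W (w i i)" "z \<in> W"
  shows "(\<Sum>i\<in>UNIV. curv_form w i i z a b) = ext_d (\<lambda>z a. \<Sum>i\<in>UNIV. w i i z a) z a b"
proof -
  have "(\<Sum>i\<in>UNIV. \<Sum>k\<in>UNIV. wedge (w k i z) (w i k z) a b)
    = (\<Sum>i\<in>UNIV. \<Sum>k\<in>UNIV. w k i z a * w i k z b) - (\<Sum>i\<in>UNIV. \<Sum>k\<in>UNIV. w k i z b * w i k z a)"
    by (simp add: wedge_def sum_subtractf)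
  also have "(\<Sum>i\<in>UNIV. \<Sum>k\<in>UNIV. w k i z b * w i k z a) = (\<Sum>i\<in>UNIV. \<Sum>k\<in>UNIV. w k i z a * w i k z b)"
    by (subst sum.swap) (simp add: mult.commute)
  finally have "(\<Sum>i\<in>UNIV. \<Sum>k\<in>UNIV. wedge (w k i z) (w i k z) a b) = 0" by simp
  then show ?thesis
    by (simp add: curv_form_def sum_subtractf ext_d_sum[of UNIV W "\<lambda>i. w i i", OF assms])
qed

section \<open>The Chern connection\<close>

lemma linear_delta_y: "linear (delta_y f i z)"
  by (rule linearI) (simp_all add: delta_y_def algebra_simps sum.distrib sum_distrib_left)

context finsler_frame
begin

lemma diff_W: "smooth_on W h \<Longrightarrow> z \<in> W \<Longrightarrow> h differentiable (at z)"
  by (rule smooth_on_differentiable)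

lemma smooth_coframe: "smooth_on W (\<lambda>z. coframe_mat u z $ i $ j)"
proof -
  have "smooth_on W (\<lambda>z. \<Sum>k\<in>UNIV. gmat f z $ k $ j * u i z $ k)"
    by (intro smooth_on_sum smooth_on_mult open_W smooth_W smooth_g smooth_on_vec_nth smooth_u)
  then show ?thesis
    by (rule smooth_on_congI) (rule coframe_eq)
qed

lemma form_co_h: "form_on W (co_h u i)"
  using form_on_basic[OF open_W, of "\<lambda>j z. coframe_mat u z $ i $ j"] smooth_coframe
  by (simp add: co_h_def[abs_def])

lemma smooth_delta_x: "smooth_on Om (delta_x f j)"
proof -
  have "smooth_on Om (\<lambda>z. \<chi> k. nonlin f k j z)"
    by (intro smooth_on_vec open_Om) (simp add: smooth_nonlin)
  then have "smooth_on Om (\<lambda>z. (axis j 1, 0) - (0, \<chi> k. nonlin f k j z))"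
    by (intro smooth_on_diff smooth_on_const open_Om smooth_on_linear[of "\<lambda>v. (0, v)"])
      (auto intro: bounded_linear_Pair bounded_linear_zero bounded_linear_ident)
  then show ?thesis by (simp add: delta_x_def[abs_def])
qed

lemma smooth_e_h: "smooth_on W (e_h f u i)"
  unfolding e_h_def[abs_def]
  by (intro smooth_on_sum smooth_on_scaleR open_W smooth_on_vec_nth smooth_u smooth_W smooth_delta_x)

lemma smooth_e_v: "smooth_on W (e_v f u i)"
proof -
  have bl: "bounded_linear (\<lambda>v :: real ^ 'a. (0 :: real ^ 'a, v))"
    by (intro bounded_linear_Pair bounded_linear_zero bounded_linear_ident)
  have "smooth_on W (\<lambda>z. (0 :: real ^ 'a, - (f z *\<^sub>R u i z)))"
    by (intro smooth_on_linear[OF bl] smooth_on_minus smooth_on_scaleR smooth_u smooth_W smooth_f)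
  then show ?thesis by (simp add: e_v_def[abs_def])
qed

lemma fst_e_h: "fst (e_h f u i z) = u i z"
  using vec_eq_sum_axis[of "u i z"] by (simp add: e_h_def fst_sum delta_x_def)

lemma delta_y_e_h: "delta_y f k (z) (e_h f u i z) = 0"
proof -
  have "snd (e_h f u i z) $ k = - (\<Sum>j\<in>UNIV. u i z $ j * nonlin f k j z)"
    by (simp add: e_h_def snd_sum delta_x_def sum_negf)
  then show ?thesis by (simp add: delta_y_def fst_e_h mult.commute)
qed

lemma co_h_e_h: "z \<in> W \<Longrightarrow> co_h u i z (e_h f u j z) = (if i = j then 1 else 0)"
  by (simp add: co_h_def fst_e_h coframe_u)

text \<open>The adapted frame lacks the radial vertical direction, being a frame of the sphere
  bundle. On the slit tangent bundle the full vertical part of a vector is needed, given here by its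
  components \<open>delta_y\<close>.\<close>

definition vert :: "'a tb \<Rightarrow> 'a tb \<Rightarrow> 'a tb" where
  "vert z a = (0, \<chi> k. delta_y f k z a)"

lemma co_h_vertical: "fst a = 0 \<Longrightarrow> co_h u i z a = 0"
  by (simp add: co_h_def)

lemma frame_decomp:
  assumes "z \<in> W"
  shows "a = (\<Sum>k\<in>UNIV. co_h u k z a *\<^sub>R e_h f u k z) + vert z a"
proof -
  define h where "h = (\<Sum>k\<in>UNIV. co_h u k z a *\<^sub>R e_h f u k z)"
  have "fst h $ j = fst a $ j" for j
  proof -
    have "fst h $ j = (\<Sum>k\<in>UNIV. \<Sum>l\<in>UNIV. u k z $ j * coframe_mat u z $ k $ l * fst a $ l)"
      by (simp add: h_def fst_sum fst_e_h co_h_def sum_distrib_right sum_distrib_left algebra_simps)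
    also have "\<dots> = (\<Sum>l\<in>UNIV. (\<Sum>k\<in>UNIV. u k z $ j * coframe_mat u z $ k $ l) * fst a $ l)"
      by (subst sum.swap) (simp add: sum_distrib_right)
    finally show ?thesis
      by (simp add: u_coframe[OF assms] if_distrib if_distribR cong: if_cong)
  qed
  then have 1: "fst h = fst a" by (simp add: vec_eq_iff)
  have "delta_y f k z h = 0" for k
    by (simp add: h_def linear_sum[OF linear_delta_y] linear_scale[OF linear_delta_y] delta_y_e_h)
  then have "snd h $ k = - (\<Sum>j\<in>UNIV. nonlin f k j z * fst a $ j)" for k
    using 1 by (simp add: delta_y_def add_eq_0_iff)
  then have "snd a = snd h + (\<chi> k. delta_y f k z a)"
    by (simp add: vec_eq_iff delta_y_def)
  then show ?thesis using 1 by (simp add: h_def[symmetric] vert_def prod_eq_iff)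
qed

lemma form_vert:
  assumes "form_on W \<omega>"
  shows "form_on W (\<lambda>z a. \<omega> z (vert z a))"
proof (rule form_onI[OF open_W])
  have lin: "linear (vert z)" for z
    by (rule linearI) (auto simp: vert_def vec_eq_iff linear_add[OF linear_delta_y] linear_scale[OF linear_delta_y])
  show "linear (\<lambda>a. \<omega> z (vert z a))" if "z \<in> W" for z
    using linear_compose[OF lin form_on_linear[OF assms that]] by (simp add: o_def)
  have bl: "bounded_linear (\<lambda>v :: real ^ 'a. (0 :: real ^ 'a, v))"
    by (intro bounded_linear_Pair bounded_linear_zero bounded_linear_ident)
  have "smooth_on W (\<lambda>z. (\<chi> k. delta_y f k z a) $ k)" for a k
    unfolding delta_y_def vec_lambda_beta
    by (intro smooth_on_add smooth_on_const open_W smooth_on_sum smooth_on_mult smooth_W smooth_nonlin)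
  then have "smooth_on W (\<lambda>z. vert z a)" for a
    unfolding vert_def by (intro smooth_on_linear[OF bl] smooth_on_vec open_W)
  then show "smooth_on W (\<lambda>z. \<omega> z (vert z a))" for a
    by (rule form_on_apply[OF assms])
qed

text \<open>In the orthonormal frame, the horizontal part of the connection is given by the Koszul formula
  for the structure coefficients \<open>d\<omega>\<^sup>i(e\<^sub>j, e\<^sub>k)\<close>.\<close>

definition chern_form :: "'a \<Rightarrow> 'a \<Rightarrow> 'a tb \<Rightarrow> 'a tb \<Rightarrow> real" where
  "chern_form i j z a = ext_d (co_h u i) z (e_h f u j z) (vert z a) +
     (\<Sum>k\<in>UNIV. 1/2 * (ext_d (co_h u i) z (e_h f u j z) (e_h f u k z)
        - ext_d (co_h u j) z (e_h f u i z) (e_h f u k z)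
        - ext_d (co_h u k) z (e_h f u i z) (e_h f u j z)) * co_h u k z a)"

lemma form_chern_form: "form_on W (chern_form i j)"
  unfolding chern_form_def[abs_def]
  by (intro form_on_add form_vert form_on_ext_d form_co_h smooth_e_h form_on_sum form_on_cmult open_W
      smooth_on_mult smooth_on_const smooth_on_diff smooth_ext_d)

lemma cartan_eq: "z \<in> Om \<Longrightarrow> cartan f p q k z = 1/2 * f z * dY k (\<lambda>z. gmat f z $ p $ q) z"
proof -
  assume z: "z \<in> Om"
  have "dY k (\<lambda>z. gmat f z $ p $ q) z = 1/2 * dY k (dY q (dY p f2)) z"
    unfolding gmat_eq dY_eq_dd[of k]
    by (rule dd_cmult[OF diff_Om[OF _ z]]) (intro smooth_on_dY smooth_f2)
  then show ?thesis by (simp add: cartan_def)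
qed

text \<open>The missing index \<open>m\<close> contributes nothing, because \<open>u\<^sub>m\<close> is radial.\<close>

lemma greek_projection:
  assumes z: "z \<in> W" and T: "(\<Sum>k\<in>UNIV. T k * snd z $ k) = 0"
  shows "(\<Sum>\<gamma>\<in>-{m}. (\<Sum>k\<in>UNIV. T k * u \<gamma> z $ k) * (\<Sum>j\<in>UNIV. coframe_mat u z $ \<gamma> $ j * d $ j))
    = (\<Sum>k\<in>UNIV. T k * d $ k)"
proof -
  have "(\<Sum>k\<in>UNIV. T k * u m z $ k) = (1 / f z) * (\<Sum>k\<in>UNIV. T k * snd z $ k)"
    by (simp add: u_m[OF z] sum_distrib_left)
  then have 0: "(\<Sum>k\<in>UNIV. T k * u m z $ k) = 0" using T by simp
  have "(\<Sum>\<gamma>\<in>-{m}. (\<Sum>k\<in>UNIV. T k * u \<gamma> z $ k) * (\<Sum>j\<in>UNIV. coframe_mat u z $ \<gamma> $ j * d $ j))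
      = (\<Sum>\<gamma>\<in>UNIV. (\<Sum>k\<in>UNIV. T k * u \<gamma> z $ k) * (\<Sum>j\<in>UNIV. coframe_mat u z $ \<gamma> $ j * d $ j))"
    using 0 by (intro sum.mono_neutral_left) auto
  also have "\<dots> = (\<Sum>\<gamma>\<in>UNIV. \<Sum>k\<in>UNIV. \<Sum>j\<in>UNIV. T k * (u \<gamma> z $ k * coframe_mat u z $ \<gamma> $ j) * d $ j)"
    by (simp add: sum_product algebra_simps)
  also have "\<dots> = (\<Sum>k\<in>UNIV. \<Sum>\<gamma>\<in>UNIV. \<Sum>j\<in>UNIV. T k * (u \<gamma> z $ k * coframe_mat u z $ \<gamma> $ j) * d $ j)"
    by (rule sum.swap)
  also have "\<dots> = (\<Sum>k\<in>UNIV. \<Sum>j\<in>UNIV. T k * (\<Sum>\<gamma>\<in>UNIV. u \<gamma> z $ k * coframe_mat u z $ \<gamma> $ j) * d $ j)"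
    by (rule sum.cong[OF refl], subst sum.swap) (simp add: sum_distrib_left sum_distrib_right)
  also have "\<dots> = (\<Sum>k\<in>UNIV. T k * d $ k)"
    by (simp add: u_coframe[OF z] if_distrib if_distribR cong: if_cong)
  finally show ?thesis .
qed

text \<open>Up to the factor F/2 the Cartan tensor is the y-derivative of g, so the right-hand side
  is the vertical derivative of g evaluated on the frame; the signs in \<open>H_coeff\<close> and
  \<open>co_v\<close> cancel. The Greek sum becomes a full sum because g is 0-homogeneous.\<close>

lemma two_H_form:
  assumes z: "z \<in> W"
  shows "2 * H_form m f u i j z a = (\<Sum>p\<in>UNIV. \<Sum>q\<in>UNIV.
    (\<Sum>k\<in>UNIV. dY k (\<lambda>z. gmat f z $ p $ q) z * delta_y f k z a) * u i z $ p * u j z $ q)"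
proof -
  have zOm: "z \<in> Om" using z W_sub by auto
  have F: "f z > 0" by (rule f_pos[OF zOm])
  define T where "T k = (\<Sum>p\<in>UNIV. \<Sum>q\<in>UNIV. dY k (\<lambda>z. gmat f z $ p $ q) z * u i z $ p * u j z $ q)" for k
  have "(\<Sum>k\<in>UNIV. T k * snd z $ k)
      = (\<Sum>p\<in>UNIV. \<Sum>q\<in>UNIV. (\<Sum>k\<in>UNIV. snd z $ k * dY k (\<lambda>z. gmat f z $ p $ q) z) * u i z $ p * u j z $ q)"
    unfolding T_def sum_distrib_right
    by (subst sum.swap, rule sum.cong[OF refl], subst sum.swap) (simp add: algebra_simps)
  also have "\<dots> = 0"
    by (simp add: euler_homog(2)[OF smooth_g homog_g zOm])
  finally have Ty: "(\<Sum>k\<in>UNIV. T k * snd z $ k) = 0" .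
  have H: "H_coeff f u i j \<gamma> z = - (1/2 * f z) * (\<Sum>k\<in>UNIV. T k * u \<gamma> z $ k)" for \<gamma>
  proof -
    have "(\<Sum>k\<in>UNIV. T k * u \<gamma> z $ k) = (\<Sum>p\<in>UNIV. \<Sum>q\<in>UNIV. \<Sum>k\<in>UNIV.
        dY k (\<lambda>z. gmat f z $ p $ q) z * u i z $ p * u j z $ q * u \<gamma> z $ k)"
      unfolding T_def sum_distrib_right
      by (subst sum.swap, rule sum.cong[OF refl], subst sum.swap) simp
    moreover have "(\<Sum>p\<in>UNIV. \<Sum>q\<in>UNIV. \<Sum>k\<in>UNIV. cartan f p q k z * u i z $ p * u j z $ q * u \<gamma> z $ k)
      = (1/2 * f z) * (\<Sum>p\<in>UNIV. \<Sum>q\<in>UNIV. \<Sum>k\<in>UNIV.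
        dY k (\<lambda>z. gmat f z $ p $ q) z * u i z $ p * u j z $ q * u \<gamma> z $ k)"
      unfolding sum_distrib_left by (intro sum.cong refl) (simp add: cartan_eq[OF zOm])
    ultimately show ?thesis
      by (simp add: H_coeff_def)
  qed
  have "2 * H_form m f u i j z a = (\<Sum>\<gamma>\<in>-{m}. (\<Sum>k\<in>UNIV. T k * u \<gamma> z $ k) *
      (\<Sum>l\<in>UNIV. coframe_mat u z $ \<gamma> $ l * (\<chi> k. delta_y f k z a) $ l))"
    unfolding H_form_def H co_v_def sum_distrib_left[of 2] using F
    by (intro sum.cong[OF refl]) (simp add: field_simps)
  also have "\<dots> = (\<Sum>k\<in>UNIV. T k * (\<chi> k. delta_y f k z a) $ k)"
    by (rule greek_projection[OF z Ty])
  also have "\<dots> = (\<Sum>p\<in>UNIV. \<Sum>q\<in>UNIV.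
    (\<Sum>k\<in>UNIV. dY k (\<lambda>z. gmat f z $ p $ q) z * delta_y f k z a) * u i z $ p * u j z $ q)"
    unfolding T_def sum_distrib_right
    by (subst sum.swap, rule sum.cong[OF refl], subst sum.swap) (simp add: algebra_simps)
  finally show ?thesis .
qed

text \<open>The derivative is moved from the coframe to the frame by differentiating their duality
  relation.\<close>

lemma ext_d_co_h_vertical:
  assumes z: "z \<in> W" and a: "fst a = 0"
  shows "ext_d (co_h u i) z (e_h f u j z) a = (\<Sum>k\<in>UNIV. coframe_mat u z $ i $ k * dd a (\<lambda>z. u j z $ k) z)"
proof -
  note [simp] = diff_W[OF smooth_coframe z] diff_W[OF smooth_on_vec_nth[OF smooth_u] z]
  have "dd a (\<lambda>z. \<Sum>k\<in>UNIV. coframe_mat u z $ i $ k * u j z $ k) z = dd a (\<lambda>z. if i = j then 1 else 0) z"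
    by (rule dd_cong[OF open_W z]) (rule coframe_u)
  then have "(\<Sum>k\<in>UNIV. coframe_mat u z $ i $ k * dd a (\<lambda>z. u j z $ k) z)
      = - (\<Sum>k\<in>UNIV. dd a (\<lambda>z. coframe_mat u z $ i $ k) z * u j z $ k)"
    by (simp add: dd_sum dd_mult sum.distrib split: if_splits)
  then show ?thesis
    using ext_d_basic_vertical[of "\<lambda>k z. coframe_mat u z $ i $ k" z a "e_h f u j z"] a
    by (simp add: co_h_def[abs_def] fst_e_h)
qed

text \<open>The vertical derivative of the orthonormality relation has three terms: the derivative
  of g gives \<open>H_form\<close>, and by \<open>ext_d_co_h_vertical\<close> the derivatives of the
  two frame vectors give the left-hand side.\<close>

lemma chern_form_vertical_sym:
  assumes z: "z \<in> W"
  shows "ext_d (co_h u i) z (e_h f u j z) (vert z a) + ext_d (co_h u j) z (e_h f u i z) (vert z a)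
    = - 2 * H_form m f u i j z a"
proof -
  let ?v = "vert z a"
  have zOm: "z \<in> Om" using z W_sub by auto
  note [simp] = diff_Om[OF smooth_g zOm] diff_W[OF smooth_on_vec_nth[OF smooth_u] z]
  have v: "fst ?v = 0" by (simp add: vert_def)
  have "dd ?v (\<lambda>z. bil (gmat f z) (u i z) (u j z)) z = dd ?v (\<lambda>z. if i = j then 1 else 0) z"
    by (rule dd_cong[OF open_W z]) (rule u_orth)
  then have "0 = dd ?v (\<lambda>z. \<Sum>k\<in>UNIV. \<Sum>l\<in>UNIV. gmat f z $ k $ l * u i z $ k * u j z $ l) z"
    by (simp add: bil_def split: if_splits)
  also have "\<dots> = (\<Sum>k\<in>UNIV. \<Sum>l\<in>UNIV. dd ?v (\<lambda>z. gmat f z $ k $ l) z * u i z $ k * u j z $ l)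
      + (\<Sum>k\<in>UNIV. \<Sum>l\<in>UNIV. gmat f z $ k $ l * dd ?v (\<lambda>z. u i z $ k) z * u j z $ l)
      + (\<Sum>k\<in>UNIV. \<Sum>l\<in>UNIV. gmat f z $ k $ l * u i z $ k * dd ?v (\<lambda>z. u j z $ l) z)"
    by (simp add: dd_sum dd_mult sum.distrib algebra_simps)
  also have "(\<Sum>k\<in>UNIV. \<Sum>l\<in>UNIV. gmat f z $ k $ l * u i z $ k * dd ?v (\<lambda>z. u j z $ l) z)
      = ext_d (co_h u i) z (e_h f u j z) ?v"
    unfolding ext_d_co_h_vertical[OF z v] coframe_eq[OF z] sum_distrib_right by (rule sum.swap)
  also have "(\<Sum>k\<in>UNIV. \<Sum>l\<in>UNIV. gmat f z $ k $ l * dd ?v (\<lambda>z. u i z $ k) z * u j z $ l)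
      = ext_d (co_h u j) z (e_h f u i z) ?v"
    unfolding ext_d_co_h_vertical[OF z v] coframe_eq[OF z] sum_distrib_right
    by (intro sum.cong[OF refl]) (subst gmat_sym[OF zOm], simp add: ac_simps)
  also have "(\<Sum>k\<in>UNIV. \<Sum>l\<in>UNIV. dd ?v (\<lambda>z. gmat f z $ k $ l) z * u i z $ k * u j z $ l)
      = 2 * H_form m f u i j z a"
    unfolding two_H_form[OF z] vert_def
    by (simp add: dd_vertical mult.commute)
  finally show ?thesis by simp
qed

text \<open>In the torsion equation both arguments are split into horizontal and vertical parts.
  Horizontal pairs are matched by the Koszul combination \<open>Q\<close>, mixed pairs by the
  vertical part of \<open>chern_form\<close>, and vertical pairs give nothing.\<close>

lemma is_chern_at_chern_form:
  assumes z: "z \<in> W"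
  shows "is_chern_at m f u z (\<lambda>i j. chern_form i j z)"
  unfolding is_chern_at_def
proof (intro conjI allI)
  fix i j
  show "linear (chern_form i j z)" by (rule form_on_linear[OF form_chern_form z])
next
  fix i a b
  define T where "T i j k = ext_d (co_h u i) z (e_h f u j z) (e_h f u k z)" for i j k
  define V where "V j a = ext_d (co_h u i) z (e_h f u j z) (vert z a)" for j a
  define Q where "Q j k = 1/2 * (T i j k - T j i k - T k i j)" for j k
  have anti: "T i j k = - T i k j" for i j k unfolding T_def by (rule ext_d_antisym)
  have Q: "Q j k - Q k j = T i j k" for j k
    using anti[of i k j] by (simp add: Q_def field_simps)
  note lin = linear_ext_d[OF form_co_h z, of i]
  have "ext_d (co_h u i) z a b = ext_d (co_h u i) z ((\<Sum>k\<in>UNIV. co_h u k z a *\<^sub>R e_h f u k z) + vert z a)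
      ((\<Sum>k\<in>UNIV. co_h u k z b *\<^sub>R e_h f u k z) + vert z b)"
    using frame_decomp[OF z, of a] frame_decomp[OF z, of b] by metis
  also have "\<dots> = (\<Sum>j\<in>UNIV. \<Sum>k\<in>UNIV. co_h u j z a * co_h u k z b * T i j k)
      + (\<Sum>j\<in>UNIV. co_h u j z a * V j b) - (\<Sum>k\<in>UNIV. co_h u k z b * V k a)
      + ext_d (co_h u i) z (vert z a) (vert z b)"
  proof -
    have 1: "ext_d (co_h u i) z ((\<Sum>j\<in>UNIV. co_h u j z a *\<^sub>R e_h f u j z) + vert z a) c
       = (\<Sum>j\<in>UNIV. co_h u j z a * ext_d (co_h u i) z (e_h f u j z) c) + ext_d (co_h u i) z (vert z a) c" for c
      by (simp add: linear_add[OF lin(1)] linear_sum[OF lin(1)] linear_scale[OF lin(1)])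
    have 2: "ext_d (co_h u i) z c ((\<Sum>k\<in>UNIV. co_h u k z b *\<^sub>R e_h f u k z) + vert z b)
       = (\<Sum>k\<in>UNIV. co_h u k z b * ext_d (co_h u i) z c (e_h f u k z)) + ext_d (co_h u i) z c (vert z b)" for c
      by (simp add: linear_add[OF lin(2)] linear_sum[OF lin(2)] linear_scale[OF lin(2)])
    have 3: "ext_d (co_h u i) z (vert z a) (e_h f u k z) = - V k a" for k
      unfolding V_def by (rule ext_d_antisym)
    show ?thesis
      unfolding 1 unfolding 2 3 T_def[symmetric] V_def[symmetric]
      by (simp add: distrib_left sum.distrib sum_distrib_left sum_negf algebra_simps)
  qed
  also have "ext_d (co_h u i) z (vert z a) (vert z b) = 0"
    by (simp add: ext_d_dd co_h_vertical vert_def)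
  also have "(\<Sum>j\<in>UNIV. \<Sum>k\<in>UNIV. co_h u j z a * co_h u k z b * T i j k)
      = (\<Sum>j\<in>UNIV. co_h u j z a * (\<Sum>k\<in>UNIV. Q j k * co_h u k z b)) - (\<Sum>j\<in>UNIV. co_h u j z b * (\<Sum>k\<in>UNIV. Q j k * co_h u k z a))"
  proof -
    have "(\<Sum>j\<in>UNIV. co_h u j z b * (\<Sum>k\<in>UNIV. Q j k * co_h u k z a))
        = (\<Sum>j\<in>UNIV. \<Sum>k\<in>UNIV. co_h u j z a * co_h u k z b * Q k j)"
      unfolding sum_distrib_left by (subst sum.swap) (simp add: algebra_simps)
    moreover have "(\<Sum>j\<in>UNIV. co_h u j z a * (\<Sum>k\<in>UNIV. Q j k * co_h u k z b))
        = (\<Sum>j\<in>UNIV. \<Sum>k\<in>UNIV. co_h u j z a * co_h u k z b * Q j k)"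
      unfolding sum_distrib_left by (simp add: algebra_simps)
    ultimately show ?thesis
      by (simp only: sum_subtractf[symmetric] right_diff_distrib[symmetric] Q)
  qed
  finally have "ext_d (co_h u i) z a b
    = (\<Sum>j\<in>UNIV. co_h u j z a * (\<Sum>k\<in>UNIV. Q j k * co_h u k z b))
      - (\<Sum>j\<in>UNIV. co_h u j z b * (\<Sum>k\<in>UNIV. Q j k * co_h u k z a))
      + (\<Sum>j\<in>UNIV. co_h u j z a * V j b) - (\<Sum>k\<in>UNIV. co_h u k z b * V k a)" by simp
  moreover have "chern_form i j z c = V j c + (\<Sum>k\<in>UNIV. Q j k * co_h u k z c)" for j c
    unfolding chern_form_def V_def Q_def T_def by (rule refl)
  ultimately show "ext_d (co_h u i) z a b = (\<Sum>j\<in>UNIV. wedge (co_h u j z) (chern_form i j z) a b)"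
    by (simp add: wedge_def sum_subtractf sum.distrib distrib_left)
next
  fix i j a
  \<comment> \<open>The horizontal part is antisymmetric in i and j, so the metric condition
    concerns the vertical part only.\<close>
  define K where "K i j k = 1/2 * (ext_d (co_h u i) z (e_h f u j z) (e_h f u k z)
        - ext_d (co_h u j) z (e_h f u i z) (e_h f u k z)
        - ext_d (co_h u k) z (e_h f u i z) (e_h f u j z))" for i j k
  have K: "K i j k = - K j i k" for i j k
    using ext_d_antisym[of "co_h u k" z "e_h f u i z" "e_h f u j z"] by (simp add: K_def field_simps)
  have "(\<Sum>k\<in>UNIV. K i j k * co_h u k z a) = (\<Sum>k\<in>UNIV. - (K j i k * co_h u k z a))"
    by (rule sum.cong[OF refl]) (subst K, simp)
  then have "(\<Sum>k\<in>UNIV. K i j k * co_h u k z a) = - (\<Sum>k\<in>UNIV. K j i k * co_h u k z a)"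
    by (simp add: sum_negf)
  then show "chern_form i j z a + chern_form j i z a = - 2 * H_form m f u i j z a"
    using chern_form_vertical_sym[OF z, of i j a]
    unfolding chern_form_def K_def[symmetric] by simp
qed

text \<open>The difference \<open>D\<close> of two solutions vanishes on vertical vectors by the
  torsion equation. On horizontal ones it is symmetric in the last two indices and antisymmetric in
  the first two, which forces it to vanish.\<close>

lemma is_chern_at_unique:
  assumes z: "z \<in> W" and \<theta>: "is_chern_at m f u z \<theta>" and \<theta>': "is_chern_at m f u z \<theta>'"
  shows "\<theta> = \<theta>'"
proof -
  define D where "D i j a = \<theta> i j a - \<theta>' i j a" for i j a
  have lin: "linear (D i j)" for i j
    using \<theta> \<theta>' linear_compose_sub[of "\<theta> i j" "\<theta>' i j"] by (simp add: D_def[abs_def] is_chern_at_def)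
  have "(\<Sum>j\<in>UNIV. wedge (co_h u j z) (\<theta> i j) a b) = (\<Sum>j\<in>UNIV. wedge (co_h u j z) (\<theta>' i j) a b)" for i a b
    using \<theta> \<theta>' unfolding is_chern_at_def by metis
  then have tors: "(\<Sum>j\<in>UNIV. co_h u j z a * D i j b) = (\<Sum>j\<in>UNIV. co_h u j z b * D i j a)" for i a b
    by (simp add: wedge_def D_def sum_subtractf algebra_simps)
  have "\<theta> i j a + \<theta> j i a = - 2 * H_form m f u i j z a" "\<theta>' i j a + \<theta>' j i a = - 2 * H_form m f u i j z a" for i j a
    using \<theta> \<theta>' unfolding is_chern_at_def by blast+
  then have "\<theta> i j a + \<theta> j i a = \<theta>' i j a + \<theta>' j i a" for i j a
    by simp
  then have anti: "D i j a = - D j i a" for i j a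
    by (simp add: D_def algebra_simps)
  have vz: "D i j (vert z a) = 0" for i j a
    using tors[of "e_h f u j z" i "vert z a"]
    by (simp add: co_h_e_h[OF z] co_h_vertical vert_def if_distribR if_distrib cong: if_cong)
  have sym: "D i j (e_h f u k z) = D i k (e_h f u j z)" for i j k
    using tors[of "e_h f u j z" i "e_h f u k z"]
    by (simp add: co_h_e_h[OF z] if_distribR if_distrib cong: if_cong)
  have hz: "D i j (e_h f u k z) = 0" for i j k
    using sym anti by (smt (verit))
  have "D i j a = 0" for i j a
    by (subst frame_decomp[OF z, of a])
      (simp add: linear_add[OF lin] linear_sum[OF lin] linear_scale[OF lin] vz hz)
  then show ?thesis by (simp add: D_def fun_eq_iff)
qed

lemma chern_eq:
  assumes "z \<in> W"
  shows "chern m f u i j z = chern_form i j z"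
proof -
  have "(THE \<theta>. is_chern_at m f u z \<theta>) = (\<lambda>i j. chern_form i j z)"
    by (rule the_equality) (use is_chern_at_chern_form is_chern_at_unique assms in blast)+
  then show ?thesis by (simp add: chern_def)
qed

lemma form_chern: "form_on W (chern m f u i j)"
  by (rule form_on_cong[OF form_chern_form]) (simp add: chern_eq)

text \<open>The metric condition alone fixes the diagonal forms. Hence the trace has vertical
  components only, and no Koszul term has to be computed for it.\<close>

lemma chern_diag:
  assumes "z \<in> W"
  shows "chern m f u i i z a = - H_form m f u i i z a"
  using is_chern_at_chern_form[OF assms] unfolding chern_eq[OF assms] is_chern_at_def
  by (smt (verit, best))

end

section \<open>The S-curvature and the traces of the curvature forms\<close>

lemma dd_ln:
  fixes h :: "'a::euclidean_space \<Rightarrow> real"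
  assumes "h differentiable (at z)" "h z > 0"
  shows "dd v (\<lambda>x. ln (h x)) z = dd v h z / h z"
  by (rule dd_eqI) (use assms in \<open>auto intro!: derivative_eq_intros dest: has_derivative_dd simp: field_simps\<close>)

locale finsler_density = finsler_chart +
  fixes s :: "real ^ 'a \<Rightarrow> real"
  assumes smooth_s: "smooth_on U s" and s_pos: "\<And>x. x \<in> U \<Longrightarrow> s x > 0"
begin

abbreviation "\<tau> \<equiv> distortion f s"

lemma distortion_eq: "z \<in> Om \<Longrightarrow> \<tau> z = 1/2 * ln (det (gmat f z)) - ln (s (fst z))"
  using det_gmat_pos[of z] s_pos[of "fst z"]
  by (simp add: distortion_def ln_div ln_sqrt slit_over_def)

lemma smooth_s_fst: "smooth_on Om (\<lambda>z. s (fst z))"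
  by (rule smooth_on_compose[OF smooth_s smooth_on_linear[OF bounded_linear_fst smooth_on_id[OF open_Om]]])
    (auto simp: slit_over_def)

lemma s_fst_pos: "z \<in> Om \<Longrightarrow> s (fst z) > 0"
  by (simp add: slit_over_def s_pos)

lemma smooth_distortion: "smooth_on Om \<tau>"
proof -
  have "smooth_on Om (\<lambda>z. 1/2 * ln (det (gmat f z)) - ln (s (fst z)))"
    by (intro smooth_on_diff smooth_on_mult smooth_on_const open_Om smooth_on_ln smooth_s_fst s_fst_pos
        smooth_det_gmat det_gmat_pos)
  then show ?thesis by (rule smooth_on_congI) (rule distortion_eq)
qed

lemma homog_distortion: "homog U 0 \<tau>"
  by (rule homogI) (simp add: distortion_def gmat_scale)

text \<open>Jacobi's formula, together with the fact that the density depends on x alone. Multiplied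
  by F, this is the trace of the tensor \<open>cartan\<close>.\<close>

lemma dY_distortion:
  assumes z: "z \<in> Om"
  shows "dY k \<tau> z = 1/2 * (\<Sum>i\<in>UNIV. \<Sum>j\<in>UNIV. ginv z $ i $ j * dY k (\<lambda>z. gmat f z $ j $ i) z)"
proof -
  note d = diff_Om[OF smooth_det_gmat z] diff_Om[OF smooth_s_fst z] det_gmat_pos[OF z] s_fst_pos[OF z]
  have dl: "(\<lambda>z. ln (det (gmat f z))) differentiable (at z)" "(\<lambda>z. ln (s (fst z))) differentiable (at z)"
    by (rule diff_Om[OF _ z], intro smooth_on_ln smooth_det_gmat smooth_s_fst det_gmat_pos s_fst_pos, assumption)+
  have "fst z \<in> U" using z by (simp add: slit_over_def)
  then have "s differentiable (at (fst z))" by (rule smooth_on_differentiable[OF smooth_s])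
  then have 0: "dd (0, axis k 1) (\<lambda>z. s (fst z)) z = 0"
    using bounded_linear_imp_differentiable[OF bounded_linear_fst]
    by (subst dd_compose) (simp_all add: dd_bounded_linear bounded_linear_fst dd_dir_zero)
  have "dY k \<tau> z = dY k (\<lambda>z. 1/2 * ln (det (gmat f z)) - ln (s (fst z))) z"
    unfolding dY_eq_dd by (rule dd_cong[OF open_Om z distortion_eq])
  also have "\<dots> = 1/2 * dY k (\<lambda>z. ln (det (gmat f z))) z - dY k (\<lambda>z. ln (s (fst z))) z"
  proof -
    have "(\<lambda>z. 1/2 * ln (det (gmat f z))) differentiable (at z)"
      using dl(1) by (intro differentiable_mult) simp_all
    then show ?thesis
      unfolding dY_eq_dd using dl by (simp only: dd_diff dd_cmult)
  qed
  also have "\<dots> = 1/2 * (dY k (\<lambda>z. det (gmat f z)) z / det (gmat f z))"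
    unfolding dY_eq_dd using d 0 by (simp add: dd_ln)
  finally show ?thesis using d(3) by (simp add: dY_det_gmat[OF z])
qed

text \<open>\<open>kap a\<close> is \<open>\<delta>\<tau>/\<delta>x\<^sup>a\<close>, and \<open>Sh\<close> is the \<open>1\<close>-homogeneous function \<open>F S\<close>.\<close>

definition kap :: "'a \<Rightarrow> 'a tb \<Rightarrow> real" where
  "kap a z = dX a \<tau> z - (\<Sum>p\<in>UNIV. nonlin f p a z * dY p \<tau> z)"

definition Sh :: "'a tb \<Rightarrow> real" where
  "Sh z = (\<Sum>a\<in>UNIV. snd z $ a * kap a z)"

lemma smooth_kap: "smooth_on Om (kap a)"
  unfolding kap_def[abs_def]
  by (intro smooth_on_diff smooth_on_dX smooth_on_sum smooth_on_mult smooth_on_dY smooth_distortion smooth_nonlin open_Om)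

lemma homog_kap: "homog U 0 (kap a)"
proof -
  have "homog U (1 + (0 - 1)) (\<lambda>z. nonlin f p a z * dY p \<tau> z)" for p
    by (intro homog_mult homog_nonlin homog_dY smooth_distortion homog_distortion)
  then show ?thesis
    unfolding kap_def[abs_def] by (intro homog_diff homog_dX smooth_distortion homog_distortion homog_sum) simp
qed

lemma smooth_Sh: "smooth_on Om Sh"
  unfolding Sh_def[abs_def] by (intro smooth_on_sum smooth_on_mult smooth_on_coord smooth_kap open_Om)

lemma homog_Sh: "homog U 1 Sh"
proof -
  have "homog U (1 + 0) (\<lambda>z. snd z $ a * kap a z)" for a
    by (intro homog_mult homog_coord homog_kap)
  then show ?thesis unfolding Sh_def[abs_def] by (intro homog_sum) simp
qed

lemma Sh_eq_dd_spray:
  assumes z: "z \<in> Om"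
  shows "Sh z = dd (snd z, - 2 *\<^sub>R (\<chi> k. spray f k z)) \<tau> z"
proof -
  note d = diff_Om[OF smooth_distortion z]
  show ?thesis
    unfolding spray_vector_eq[OF z, symmetric] Sh_def kap_def
    by (simp add: dd_dir_sum[OF d] dd_dir_scaleR[OF d] dd_delta_x[OF smooth_distortion z])
qed

lemma S_curvature_eq:
  assumes z: "z \<in> Om"
  shows "S_curvature f s z = Sh z / f z"
proof -
  note d = diff_Om[OF smooth_distortion z]
  have "S_curvature f s z = dd (reeb f z) \<tau> z" by (simp add: S_curvature_def dd_def)
  also have "\<dots> = Sh z / f z"
    unfolding reeb_eq dd_dir_scaleR[OF d] spray_vector_eq[OF z] Sh_eq_dd_spray[OF z] by simp
  finally show ?thesis .
qed

lemma dY_Sh: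
  assumes z: "z \<in> Om"
  shows "dY j Sh z = kap j z + (\<Sum>a\<in>UNIV. snd z $ a * dY j (kap a) z)"
proof -
  note [simp] = diff_Om[OF _ z] smooth_kap smooth_on_coord open_Om smooth_on_mult
  have "dY j Sh z = (\<Sum>a\<in>UNIV. snd z $ a * dY j (kap a) z + axis j 1 $ a * kap a z)"
    unfolding Sh_def[abs_def] dY_eq_dd by (simp add: dd_sum dd_mult)
  moreover have "(\<Sum>a\<in>UNIV. axis j 1 $ a * kap a z) = kap j z"
    by (simp add: axis_def if_distrib if_distribR cong: if_cong)
  ultimately show ?thesis by (simp add: sum.distrib)
qed

text \<open>Up to sign these coefficients are the mean Landsberg curvature, see
  \<open>trace_landsberg\<close>. That they annihilate y is Euler's relation for S, and it is what
  \<open>greek_projection\<close> requires.\<close>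

lemma landsberg_radial:
  assumes z: "z \<in> Om"
  shows "(\<Sum>k\<in>UNIV. (dY k Sh z - kap k z) * snd z $ k) = 0"
proof -
  have "(\<Sum>k\<in>UNIV. snd z $ k * dY k Sh z) = 1 * Sh z"
    by (rule euler_homog(2)[OF smooth_Sh homog_Sh z])
  then show ?thesis by (simp add: Sh_def algebra_simps sum_subtractf)
qed

section \<open>The one-forms that represent the traces of the two connections\<close>

definition kap_form :: "'a tb \<Rightarrow> 'a tb \<Rightarrow> real" where
  "kap_form z a = (\<Sum>k\<in>UNIV. kap k z * fst a $ k)"

definition Sh_form :: "'a tb \<Rightarrow> 'a tb \<Rightarrow> real" where
  "Sh_form z a = (\<Sum>k\<in>UNIV. dY k Sh z * fst a $ k)"

lemma form_kap_form: "form_on Om kap_form"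
  unfolding kap_form_def[abs_def] by (rule form_on_basic[OF open_Om smooth_kap])

lemma form_Sh_form: "form_on Om Sh_form"
  unfolding Sh_form_def[abs_def] by (rule form_on_basic[OF open_Om]) (intro smooth_on_dY smooth_Sh)

lemma kap_form_minus_d_distortion:
  assumes z: "z \<in> Om"
  shows "kap_form z a - dd a \<tau> z = - (\<Sum>k\<in>UNIV. dY k \<tau> z * delta_y f k z a)"
proof -
  have "dd a \<tau> z = (\<Sum>i\<in>UNIV. fst a $ i * dX i \<tau> z) + (\<Sum>i\<in>UNIV. snd a $ i * dY i \<tau> z)"
    using dd_tb[OF diff_Om[OF smooth_distortion z], of "fst a" "snd a"] by simp
  moreover have "(\<Sum>k\<in>UNIV. (\<Sum>p\<in>UNIV. nonlin f p k z * dY p \<tau> z) * fst a $ k)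
      = (\<Sum>k\<in>UNIV. dY k \<tau> z * (\<Sum>j\<in>UNIV. nonlin f k j z * fst a $ j))"
    unfolding sum_distrib_left sum_distrib_right by (subst sum.swap) (simp add: algebra_simps)
  ultimately show ?thesis
    by (simp add: kap_form_def kap_def delta_y_def distrib_left left_diff_distrib sum.distrib sum_subtractf
        mult.commute[of "fst a $ _"] mult.commute[of "snd a $ _"])
qed

text \<open>\<open>kap_form\<close> differs by the exact form \<open>d\<tau>\<close> from a form that involves only \<open>\<partial>\<tau>/\<partial>y\<close>.\<close>

lemma ext_d_kap_form_horizontal:
  assumes z: "z \<in> Om" and \<tau>: "\<And>k. dY k \<tau> z = 0"
    and hor: "\<And>k. delta_y f k z a = 0" "\<And>k. delta_y f k z b = 0"
  shows "ext_d kap_form z a b = 0"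
proof -
  \<comment> \<open>Each summand is a product whose two factors both vanish at \<open>z\<close>, so
    the product rule gives 0.\<close>
  have *: "dd a (\<lambda>w. \<Sum>k\<in>UNIV. dY k \<tau> w * delta_y f k w b) z = 0"
    if "\<And>k. delta_y f k z b = 0" for a b
  proof -
    have "(\<lambda>w. delta_y f k w b) differentiable (at z)" for k
      unfolding delta_y_def
      by (rule diff_Om[OF _ z]) (intro smooth_on_add smooth_on_const open_Om smooth_on_sum smooth_on_mult smooth_nonlin)
    moreover have "dY k \<tau> differentiable (at z)" for k
      by (rule diff_Om[OF _ z]) (intro smooth_on_dY smooth_distortion)
    ultimately show ?thesis
      by (simp add: dd_sum dd_mult that \<tau>)
  qed
  have d: "(\<lambda>w. \<Sum>k\<in>UNIV. dY k \<tau> w * delta_y f k w a) differentiable (at z)" for a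
    unfolding delta_y_def
    by (rule diff_Om[OF _ z])
      (intro smooth_on_add smooth_on_const open_Om smooth_on_sum smooth_on_mult smooth_nonlin smooth_on_dY smooth_distortion)
  have "ext_d (\<lambda>w a. kap_form w a - dd a \<tau> w) z a b = ext_d (\<lambda>w a. - (\<Sum>k\<in>UNIV. dY k \<tau> w * delta_y f k w a)) z a b"
    by (rule ext_d_cong[OF open_Om z]) (rule kap_form_minus_d_distortion)
  also have "\<dots> = 0"
    unfolding ext_d_dd using *[of b a] *[of a b] hor by (simp add: dd_minus[OF d])
  finally show ?thesis
    unfolding ext_d_diff[OF form_kap_form form_on_dd[OF smooth_distortion] z] ext_d_dd_eq_0[OF smooth_distortion z]
    by simp
qed

end

locale finsler_density_frame = finsler_frame U f m W u + finsler_density U f s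
  for U :: "(real ^ 'n::finite) set" and f m W u s
begin

text \<open>Summing \<open>H_form\<close> over the diagonal contracts the vertical derivative of g
  with the inverse metric (\<open>ginv_eq\<close>). By \<open>dY_distortion\<close> the result is
  the vertical part of d tau, and the Chern trace is its negative.\<close>

lemma trace_chern:
  assumes z: "z \<in> W"
  shows "(\<Sum>i\<in>UNIV. chern m f u i i z a) = kap_form z a - dd a \<tau> z"
proof -
  have zOm: "z \<in> Om" using z W_sub by auto
  let ?D = "\<lambda>p q. \<Sum>k\<in>UNIV. dY k (\<lambda>z. gmat f z $ p $ q) z * delta_y f k z a"
  have "2 * (\<Sum>i\<in>UNIV. chern m f u i i z a) = - (\<Sum>i\<in>UNIV. 2 * H_form m f u i i z a)"
    by (simp add: chern_diag[OF z] sum_distrib_left sum_negf)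
  also have "(\<Sum>i\<in>UNIV. 2 * H_form m f u i i z a)
      = (\<Sum>i\<in>UNIV. \<Sum>p\<in>UNIV. \<Sum>q\<in>UNIV. ?D p q * (u i z $ q * u i z $ p))"
    unfolding two_H_form[OF z] by (simp add: algebra_simps)
  also have "\<dots> = (\<Sum>p\<in>UNIV. \<Sum>q\<in>UNIV. \<Sum>i\<in>UNIV. ?D p q * (u i z $ q * u i z $ p))"
    by (subst sum.swap, rule sum.cong[OF refl], rule sum.swap)
  also have "\<dots> = (\<Sum>p\<in>UNIV. \<Sum>q\<in>UNIV. ?D p q * ginv z $ q $ p)"
    by (simp add: ginv_eq[OF z] sum_distrib_left)
  also have "\<dots> = (\<Sum>k\<in>UNIV. \<Sum>q\<in>UNIV. \<Sum>p\<in>UNIV. ginv z $ q $ p * dY k (\<lambda>z. gmat f z $ p $ q) z * delta_y f k z a)"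
  proof -
    have "(\<Sum>p\<in>UNIV. \<Sum>q\<in>UNIV. ?D p q * ginv z $ q $ p)
      = (\<Sum>q\<in>UNIV. \<Sum>p\<in>UNIV. \<Sum>k\<in>UNIV. ginv z $ q $ p * dY k (\<lambda>z. gmat f z $ p $ q) z * delta_y f k z a)"
      by (subst sum.swap) (simp add: sum_distrib_right sum_distrib_left algebra_simps)
    also have "\<dots> = (\<Sum>q\<in>UNIV. \<Sum>k\<in>UNIV. \<Sum>p\<in>UNIV. ginv z $ q $ p * dY k (\<lambda>z. gmat f z $ p $ q) z * delta_y f k z a)"
      by (rule sum.cong[OF refl], rule sum.swap)
    also have "\<dots> = (\<Sum>k\<in>UNIV. \<Sum>q\<in>UNIV. \<Sum>p\<in>UNIV. ginv z $ q $ p * dY k (\<lambda>z. gmat f z $ p $ q) z * delta_y f k z a)"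
      by (rule sum.swap)
    finally show ?thesis .
  qed
  also have "\<dots> = 2 * (\<Sum>k\<in>UNIV. dY k \<tau> z * delta_y f k z a)"
    unfolding dY_distortion[OF zOm] by (simp add: sum_distrib_left sum_distrib_right)
  finally show ?thesis
    using kap_form_minus_d_distortion[OF zOm, of a] by simp
qed

lemma trace_curv_chern:
  assumes z: "z \<in> W"
  shows "(\<Sum>i\<in>UNIV. curv_form (chern m f u) i i z a b) = ext_d kap_form z a b"
proof -
  have zOm: "z \<in> Om" using z W_sub by auto
  have "(\<Sum>i\<in>UNIV. curv_form (chern m f u) i i z a b) = ext_d (\<lambda>z a. \<Sum>i\<in>UNIV. chern m f u i i z a) z a b"
    by (rule curv_form_trace[OF form_chern z])
  also have "\<dots> = ext_d (\<lambda>w a. kap_form w a - dd a \<tau> w) z a b"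
    by (rule ext_d_cong[OF open_W z]) (rule trace_chern)
  also have "\<dots> = ext_d kap_form z a b"
    unfolding ext_d_diff[OF form_kap_form form_on_dd[OF smooth_distortion] zOm] ext_d_dd_eq_0[OF smooth_distortion zOm]
    by simp
  finally show ?thesis .
qed

text \<open>The first argument e_m lies over y/F and so contracts the vertical derivatives of
  \<open>kap\<close> with y; the factor F in \<open>e_v\<close> cancels the 1/F. What remains is
  recognized by \<open>dY_Sh\<close>.\<close>

lemma trace_landsberg:
  assumes z: "z \<in> W"
  shows "(\<Sum>i\<in>UNIV. landsberg m f u i i \<alpha> z) = - (\<Sum>j\<in>UNIV. (dY j Sh z - kap j z) * u \<alpha> z $ j)"
proof -
  have zOm: "z \<in> Om" using z W_sub by auto
  note d = diff_Om[OF smooth_kap zOm]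
  have F: "f z > 0" by (rule f_pos[OF zOm])
  have "(\<Sum>i\<in>UNIV. landsberg m f u i i \<alpha> z) = - ext_d kap_form z (e_h f u m z) (e_v f u \<alpha> z)"
    by (simp add: landsberg_def hv_coeff_def sum_negf trace_curv_chern[OF z])
  also have "\<dots> = (\<Sum>k\<in>UNIV. dd (e_v f u \<alpha> z) (kap k) z * u m z $ k)"
    unfolding kap_form_def[abs_def]
    by (subst ext_d_basic_vertical[OF d]) (simp_all add: e_v_def fst_e_h)
  also have "\<dots> = (\<Sum>k\<in>UNIV. \<Sum>j\<in>UNIV. - (u \<alpha> z $ j * (snd z $ k * dY j (kap k) z)))"
    unfolding e_v_def dd_vertical[OF d] u_m[OF z] sum_distrib_right
    using F by (intro sum.cong refl) (simp add: field_simps)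
  also have "\<dots> = - (\<Sum>j\<in>UNIV. u \<alpha> z $ j * (\<Sum>k\<in>UNIV. snd z $ k * dY j (kap k) z))"
    by (subst sum.swap) (simp add: sum_distrib_left sum_negf)
  finally show ?thesis by (simp add: dY_Sh[OF zOm] mult.commute)
qed

lemma smooth_landsberg: "smooth_on W (landsberg m f u i j \<alpha>)"
proof -
  have "smooth_on W (\<lambda>z. - (ext_d (chern m f u i j) z (e_h f u m z) (e_v f u \<alpha> z) -
      (\<Sum>k\<in>UNIV. chern m f u k j z (e_h f u m z) * chern m f u i k z (e_v f u \<alpha> z)
        - chern m f u k j z (e_v f u \<alpha> z) * chern m f u i k z (e_h f u m z))))"
    by (intro smooth_on_minus smooth_on_diff smooth_on_sum smooth_on_mult smooth_ext_d form_on_apply form_chern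
      smooth_e_h smooth_e_v open_W)
  then show ?thesis
    by (simp add: landsberg_def[abs_def] hv_coeff_def curv_form_def wedge_def)
qed

lemma form_berwald: "form_on W (berwald m f u i j)"
  unfolding berwald_def[abs_def]
  by (intro form_on_diff form_chern form_on_sum open_W form_on_cmult form_co_h smooth_landsberg)

text \<open>Removing the Landsberg term changes the coefficient of dx^k from delta tau / delta x^k
  to the y^k-derivative of S; the index \<open>m\<close> missing from the sum is supplied by
  \<open>landsberg_radial\<close>.\<close>

lemma trace_berwald:
  assumes z: "z \<in> W"
  shows "(\<Sum>i\<in>UNIV. berwald m f u i i z a) = Sh_form z a - dd a \<tau> z"
proof -
  have zOm: "z \<in> Om" using z W_sub by auto
  have "(\<Sum>i\<in>UNIV. berwald m f u i i z a) = (\<Sum>i\<in>UNIV. chern m f u i i z a)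
      - (\<Sum>\<alpha>\<in>-{m}. (\<Sum>i\<in>UNIV. landsberg m f u i i \<alpha> z) * co_h u \<alpha> z a)"
    unfolding berwald_def sum_subtractf sum_distrib_right by (subst sum.swap) (rule refl)
  also have "(\<Sum>\<alpha>\<in>-{m}. (\<Sum>i\<in>UNIV. landsberg m f u i i \<alpha> z) * co_h u \<alpha> z a)
      = - (\<Sum>\<alpha>\<in>-{m}. (\<Sum>k\<in>UNIV. (dY k Sh z - kap k z) * u \<alpha> z $ k) * (\<Sum>j\<in>UNIV. coframe_mat u z $ \<alpha> $ j * fst a $ j))"
    by (simp add: trace_landsberg[OF z] co_h_def sum_negf)
  also have "(\<Sum>\<alpha>\<in>-{m}. (\<Sum>k\<in>UNIV. (dY k Sh z - kap k z) * u \<alpha> z $ k) * (\<Sum>j\<in>UNIV. coframe_mat u z $ \<alpha> $ j * fst a $ j))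
      = (\<Sum>k\<in>UNIV. (dY k Sh z - kap k z) * fst a $ k)"
    by (rule greek_projection[OF z landsberg_radial[OF zOm]])
  finally show ?thesis
    by (simp add: trace_chern[OF z] kap_form_def Sh_form_def left_diff_distrib sum_subtractf)
qed

lemma trace_curv_berwald:
  assumes z: "z \<in> W"
  shows "(\<Sum>i\<in>UNIV. curv_form (berwald m f u) i i z a b) = ext_d Sh_form z a b"
proof -
  have zOm: "z \<in> Om" using z W_sub by auto
  have "(\<Sum>i\<in>UNIV. curv_form (berwald m f u) i i z a b) = ext_d (\<lambda>z a. \<Sum>i\<in>UNIV. berwald m f u i i z a) z a b"
    by (rule curv_form_trace[OF form_berwald z])
  also have "\<dots> = ext_d (\<lambda>w a. Sh_form w a - dd a \<tau> w) z a b"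
    by (rule ext_d_cong[OF open_W z]) (rule trace_berwald)
  also have "\<dots> = ext_d Sh_form z a b"
    unfolding ext_d_diff[OF form_Sh_form form_on_dd[OF smooth_distortion] zOm] ext_d_dd_eq_0[OF smooth_distortion zOm]
    by simp
  finally show ?thesis .
qed

text \<open>The Hessian of the 1-homogeneous S annihilates y, so the marked index may be added to
  the sum. A full sum over an orthonormal frame is the trace with the inverse metric.\<close>

lemma berwald_scalar_eq:
  assumes z: "z \<in> W"
  shows "berwald_scalar m f u z = f z * (\<Sum>j\<in>UNIV. \<Sum>k\<in>UNIV. ginv z $ j $ k * dY j (dY k Sh) z)"
proof -
  have zOm: "z \<in> Om" using z W_sub by auto
  have F: "f z > 0" by (rule f_pos[OF zOm])
  have d: "dY k Sh differentiable (at z)" for k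
    by (rule diff_Om[OF smooth_on_dY[OF smooth_Sh] zOm])
  have mb: "mean_berwald m f u \<gamma> \<gamma> z = f z * (\<Sum>k\<in>UNIV. \<Sum>j\<in>UNIV. u \<gamma> z $ j * u \<gamma> z $ k * dY j (dY k Sh) z)" for \<gamma>
  proof -
    have "mean_berwald m f u \<gamma> \<gamma> z = ext_d Sh_form z (e_h f u \<gamma> z) (e_v f u \<gamma> z)"
      by (simp add: mean_berwald_def hv_coeff_def trace_curv_berwald[OF z])
    also have "\<dots> = - (\<Sum>k\<in>UNIV. dd (e_v f u \<gamma> z) (dY k Sh) z * u \<gamma> z $ k)"
      unfolding Sh_form_def[abs_def]
      by (subst ext_d_basic_vertical[OF d]) (simp_all add: e_v_def fst_e_h)
    also have "\<dots> = (\<Sum>k\<in>UNIV. \<Sum>j\<in>UNIV. f z * (u \<gamma> z $ j * u \<gamma> z $ k * dY j (dY k Sh) z))"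
      unfolding e_v_def dd_vertical[OF d] sum_negf[symmetric] sum_distrib_right
      by (intro sum.cong refl) (simp add: field_simps)
    finally show ?thesis by (simp add: sum_distrib_left)
  qed
  have "(\<Sum>j\<in>UNIV. u m z $ j * dY j (dY k Sh) z) = 0" for k
  proof -
    have "(\<Sum>j\<in>UNIV. snd z $ j * dY j (dY k Sh) z) = (1 - 1) * dY k Sh z"
      by (rule euler_homog(2)[OF smooth_on_dY[OF smooth_Sh] homog_dY[OF smooth_Sh homog_Sh] zOm])
    then show ?thesis by (simp add: u_m[OF z] flip: sum_divide_distrib)
  qed
  then have "(\<Sum>k\<in>UNIV. u m z $ k * (\<Sum>j\<in>UNIV. u m z $ j * dY j (dY k Sh) z)) = 0" by simp
  then have "mean_berwald m f u m m z = 0"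
    unfolding mb by (simp add: sum_distrib_left algebra_simps)
  then have "berwald_scalar m f u z = (\<Sum>\<gamma>\<in>UNIV. mean_berwald m f u \<gamma> \<gamma> z)"
    unfolding berwald_scalar_def by (intro sum.mono_neutral_left) auto
  also have "\<dots> = f z * (\<Sum>\<gamma>\<in>UNIV. \<Sum>k\<in>UNIV. \<Sum>j\<in>UNIV. u \<gamma> z $ j * u \<gamma> z $ k * dY j (dY k Sh) z)"
    by (simp add: mb sum_distrib_left)
  also have "(\<Sum>\<gamma>\<in>UNIV. \<Sum>k\<in>UNIV. \<Sum>j\<in>UNIV. u \<gamma> z $ j * u \<gamma> z $ k * dY j (dY k Sh) z)
      = (\<Sum>k\<in>UNIV. \<Sum>j\<in>UNIV. \<Sum>\<gamma>\<in>UNIV. u \<gamma> z $ j * u \<gamma> z $ k * dY j (dY k Sh) z)"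
    by (subst sum.swap, rule sum.cong[OF refl], rule sum.swap)
  also have "\<dots> = (\<Sum>j\<in>UNIV. \<Sum>k\<in>UNIV. ginv z $ j $ k * dY j (dY k Sh) z)"
    by (subst sum.swap) (simp add: ginv_eq[OF z] sum_distrib_right)
  finally show ?thesis .
qed

lemma tr_hh_e_h:
  assumes z: "z \<in> W" and w: "\<And>a b. (\<Sum>i\<in>UNIV. curv_form w i i z a b) = ext_d \<eta> z a b"
  shows "tr_hh f u w z (e_h f u p z) (e_h f u q z) = ext_d \<eta> z (e_h f u p z) (e_h f u q z)"
proof -
  let ?E = "\<lambda>k l. ext_d \<eta> z (e_h f u k z) (e_h f u l z)"
  have "tr_hh f u w z (e_h f u p z) (e_h f u q z)
    = 1/2 * (\<Sum>k\<in>UNIV. \<Sum>l\<in>UNIV. \<Sum>i\<in>UNIV. hh_coeff f u w i i k l z * wedge (co_h u k z) (co_h u l z) (e_h f u p z) (e_h f u q z))"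
    unfolding tr_hh_def by (rule arg_cong[where f = "\<lambda>x. 1/2 * x"], subst sum.swap, rule sum.cong[OF refl], rule sum.swap)
  also have "\<dots> = 1/2 * (\<Sum>k\<in>UNIV. \<Sum>l\<in>UNIV. ?E k l * wedge (co_h u k z) (co_h u l z) (e_h f u p z) (e_h f u q z))"
    unfolding sum_distrib_right[symmetric] hh_coeff_def w by (rule refl)
  \<comment> \<open>The wedge selects (p, q) and (q, p) with opposite signs; antisymmetry of
    \<open>ext_d\<close> then absorbs the factor 1/2.\<close>
  also have "\<dots> = 1/2 * (?E p q - ?E q p)"
  proof -
    have \<delta>: "(\<Sum>k\<in>UNIV. \<Sum>l\<in>UNIV. ?E k l * ((if k = p then 1 else 0) * (if l = q then 1 else 0))) = ?E p q" for p q
    proof -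
      have "(\<Sum>l\<in>UNIV. ?E k l * ((if k = p then 1 else 0) * (if l = q then 1 else 0))) = (if k = p then ?E k q else 0)" for k
        by (cases "k = p") (simp_all add: if_distrib cong: if_cong)
      then show ?thesis by simp
    qed
    have "(\<Sum>k\<in>UNIV. \<Sum>l\<in>UNIV. ?E k l * wedge (co_h u k z) (co_h u l z) (e_h f u p z) (e_h f u q z))
      = (\<Sum>k\<in>UNIV. \<Sum>l\<in>UNIV. ?E k l * ((if k = p then 1 else 0) * (if l = q then 1 else 0)))
      - (\<Sum>k\<in>UNIV. \<Sum>l\<in>UNIV. ?E k l * ((if k = q then 1 else 0) * (if l = p then 1 else 0)))"
      unfolding wedge_def co_h_e_h[OF z] right_diff_distrib sum_subtractf by (rule refl)
    then show ?thesis by (simp only: \<delta>)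
  qed
  also have "\<dots> = ?E p q"
    using ext_d_antisym[of \<eta> z "e_h f u q z" "e_h f u p z"] by simp
  finally show ?thesis .
qed

lemma mean_stretch_e_h:
  assumes "z \<in> W"
  shows "mean_stretch m f u z (e_h f u p z) (e_h f u q z)
    = 2 * (ext_d Sh_form z (e_h f u p z) (e_h f u q z) - ext_d kap_form z (e_h f u p z) (e_h f u q z))"
  unfolding mean_stretch_def tr_hh_e_h[OF assms trace_curv_berwald[OF assms]]
    tr_hh_e_h[OF assms trace_curv_chern[OF assms]] ..

end

section \<open>Rigidity of one-homogeneous functions\<close>

lemma smooth_on_slice:
  fixes h :: "'n::finite tb \<Rightarrow> real"
  assumes "smooth_on (slit_over U) h" "x \<in> U"
  shows "smooth_on (- {0}) (\<lambda>y. h (x, y))"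
proof (rule smooth_on_compose[OF assms(1), of _ "\<lambda>y. (x, y)"])
  have "smooth_on (- {0}) (\<lambda>y. (x, 0) + (0, y) :: 'n tb)"
    by (intro smooth_on_add smooth_on_const smooth_on_linear[of "\<lambda>y. (0, y)"] smooth_on_id)
      (auto intro: bounded_linear_Pair bounded_linear_zero bounded_linear_ident)
  then show "smooth_on (- {0}) (\<lambda>y. (x, y) :: 'n tb)" by simp
qed (use assms(2) in \<open>auto simp: slit_over_def\<close>)

lemma has_derivative_slice:
  fixes h :: "'n::finite tb \<Rightarrow> real"
  assumes "h differentiable (at (x, y))"
  shows "((\<lambda>y. h (x, y)) has_derivative (\<lambda>b. dd (0, b) h (x, y))) (at y)"
  by (rule has_derivative_compose[of "\<lambda>y. (x, y)" _ _ _ h, OF _ has_derivative_dd[OF assms]])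
    (auto intro!: derivative_eq_intros)

text \<open>A fibre without its origin is connected in dimension at least 2; in dimension 1 the two
  rays could carry different constants.\<close>

lemma constant_on_fibre:
  fixes h :: "'n::finite tb \<Rightarrow> real"
  assumes "CARD('n) \<ge> 2" "smooth_on (slit_over U) h"
    and "\<And>z j. z \<in> slit_over U \<Longrightarrow> dY j h z = 0"
    and "x \<in> U" "y \<noteq> 0" "y' \<noteq> 0"
  shows "h (x, y) = h (x, y')"
proof -
  have "connected (- {0 :: real ^ 'n})"
    by (rule connected_punctured_universe) (use assms(1) in simp)
  moreover have "((\<lambda>y. h (x, y)) has_derivative (\<lambda>b. 0)) (at y)" if "y \<in> - {0}" for y
  proof -
    have z: "(x, y) \<in> slit_over U" using that assms(4) by (simp add: slit_over_def)
    note d = smooth_on_differentiable[OF assms(2) z]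
    show ?thesis
      using has_derivative_slice[OF d] by (simp add: dd_vertical[OF d] assms(3)[OF z])
  qed
  ultimately show ?thesis
    by (intro has_derivative_zero_unique_connected[of "- {0}" "\<lambda>y. h (x, y)"]) (use assms(5,6) in auto)
qed

context finsler_chart
begin

section \<open>Divergence identities for the Hessian metric of F^2/2\<close>

lemma dY_ginv:
  assumes z: "z \<in> Om"
  shows "dY k (\<lambda>z. ginv z $ i $ j) z =
    - (\<Sum>p\<in>UNIV. \<Sum>q\<in>UNIV. ginv z $ i $ p * dY k (\<lambda>z. gmat f z $ p $ q) z * ginv z $ q $ j)"
  unfolding dY_eq_dd using det_gmat_pos by (intro dd_matrix_inv[OF open_Om smooth_g _ z]) force

text \<open>The metric is half the Hessian of F^2, so its y-derivatives are third derivatives and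
  totally symmetric.\<close>

lemma dY_gmat_sym:
  assumes z: "z \<in> Om"
  shows "dY k (\<lambda>z. gmat f z $ p $ q) z = dY p (\<lambda>z. gmat f z $ k $ q) z"
    "dY k (\<lambda>z. gmat f z $ p $ q) z = dY k (\<lambda>z. gmat f z $ q $ p) z"
proof -
  have *: "dY k (\<lambda>z. gmat f z $ p $ q) z = 1/2 * dY k (dY q (dY p f2)) z" for k p q
    unfolding gmat_eq dY_eq_dd[of k]
    by (rule dd_cmult[OF diff_Om[OF _ z]]) (intro smooth_on_dY smooth_f2)
  have c: "dY k (dY p h) z = dY p (dY k h) z" if "smooth_on Om h" "z \<in> Om" for k p h z
    unfolding dY_eq_dd by (rule dd_commute[OF that])
  have "dY k (dY q (dY p f2)) z = dY q (dY k (dY p f2)) z" for k p q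
    by (rule c[OF smooth_on_dY[OF smooth_f2] z])
  moreover have 1: "dY q (dY k (dY p f2)) z = dY q (dY p (dY k f2)) z" for k p q
    unfolding dY_eq_dd[of q] by (rule dd_cong[OF open_Om z c[OF smooth_f2]])
  ultimately show "dY k (\<lambda>z. gmat f z $ p $ q) z = dY p (\<lambda>z. gmat f z $ k $ q) z"
    "dY k (\<lambda>z. gmat f z $ p $ q) z = dY k (\<lambda>z. gmat f z $ q $ p) z"
    unfolding * by metis+
qed

text \<open>Equivalently, det g times the inverse metric, the cofactor matrix, has divergence zero:
  the classical identity for Hessian matrices. Total symmetry of the derivatives of g turns the
  divergence of the inverse into the trace in Jacobi's formula.\<close>

lemma div_ginv:
  assumes z: "z \<in> Om"
  shows "det (gmat f z) * (\<Sum>j\<in>UNIV. dY j (\<lambda>z. ginv z $ j $ a) z)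
    = - (\<Sum>q\<in>UNIV. dY q (\<lambda>z. det (gmat f z)) z * ginv z $ q $ a)"
proof -
  let ?C = "\<lambda>k p q. dY k (\<lambda>z. gmat f z $ p $ q) z"
  define X where "X q = (\<Sum>j\<in>UNIV. \<Sum>p\<in>UNIV. ginv z $ j $ p * ?C q p j)" for q
  have "(\<Sum>j\<in>UNIV. dY j (\<lambda>z. ginv z $ j $ a) z)
      = - (\<Sum>j\<in>UNIV. \<Sum>p\<in>UNIV. \<Sum>q\<in>UNIV. ginv z $ j $ p * ?C j p q * ginv z $ q $ a)"
    by (simp add: dY_ginv[OF z] sum_negf)
  also have "(\<Sum>j\<in>UNIV. \<Sum>p\<in>UNIV. \<Sum>q\<in>UNIV. ginv z $ j $ p * ?C j p q * ginv z $ q $ a)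
      = (\<Sum>j\<in>UNIV. \<Sum>q\<in>UNIV. \<Sum>p\<in>UNIV. ginv z $ j $ p * ?C j p q * ginv z $ q $ a)"
    by (rule sum.cong[OF refl], rule sum.swap)
  also have "\<dots> = (\<Sum>q\<in>UNIV. \<Sum>j\<in>UNIV. \<Sum>p\<in>UNIV. ginv z $ j $ p * ?C j p q * ginv z $ q $ a)"
    by (rule sum.swap)
  also have "\<dots> = (\<Sum>q\<in>UNIV. \<Sum>j\<in>UNIV. \<Sum>p\<in>UNIV. ginv z $ j $ p * ?C q p j * ginv z $ q $ a)"
    by (intro sum.cong refl) (metis dY_gmat_sym[OF z])
  also have "\<dots> = (\<Sum>q\<in>UNIV. X q * ginv z $ q $ a)"
    by (simp add: X_def sum_distrib_right)
  finally show ?thesis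
    by (simp add: dY_det_gmat[OF z] X_def[symmetric] sum_distrib_left mult.assoc)
qed

text \<open>The derivative of the inverse metric with its direction raised is, up to a factor, the
  Cartan tensor with all indices raised, hence symmetric.\<close>

lemma ginv_dY_ginv_sym:
  assumes z: "z \<in> Om"
  shows "(\<Sum>j\<in>UNIV. ginv z $ j $ a * dY j (\<lambda>z. ginv z $ l $ b) z)
    = (\<Sum>p\<in>UNIV. ginv z $ l $ p * dY p (\<lambda>z. ginv z $ a $ b) z)"
proof -
  let ?C = "\<lambda>k p q. dY k (\<lambda>z. gmat f z $ p $ q) z"
  have "(\<Sum>j\<in>UNIV. ginv z $ j $ a * dY j (\<lambda>z. ginv z $ l $ b) z)
      = - (\<Sum>j\<in>UNIV. \<Sum>p\<in>UNIV. \<Sum>q\<in>UNIV. ginv z $ j $ a * (ginv z $ l $ p * ?C j p q * ginv z $ q $ b))"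
    by (simp add: dY_ginv[OF z] sum_distrib_left sum_negf)
  also have "(\<Sum>j\<in>UNIV. \<Sum>p\<in>UNIV. \<Sum>q\<in>UNIV. ginv z $ j $ a * (ginv z $ l $ p * ?C j p q * ginv z $ q $ b))
      = (\<Sum>p\<in>UNIV. \<Sum>j\<in>UNIV. \<Sum>q\<in>UNIV. ginv z $ j $ a * (ginv z $ l $ p * ?C j p q * ginv z $ q $ b))"
    by (rule sum.swap)
  also have "\<dots> = (\<Sum>p\<in>UNIV. \<Sum>j\<in>UNIV. \<Sum>q\<in>UNIV. ginv z $ l $ p * (ginv z $ a $ j * ?C p j q * ginv z $ q $ b))"
  proof (intro sum.cong refl)
    fix p j q
    show "ginv z $ j $ a * (ginv z $ l $ p * ?C j p q * ginv z $ q $ b)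
      = ginv z $ l $ p * (ginv z $ a $ j * ?C p j q * ginv z $ q $ b)"
      using dY_gmat_sym(1)[OF z, of j p q] ginv_sym[OF z, of j a] by simp
  qed
  also have "\<dots> = - (\<Sum>p\<in>UNIV. ginv z $ l $ p * dY p (\<lambda>z. ginv z $ a $ b) z)"
    by (simp add: dY_ginv[OF z] sum_distrib_left sum_negf)
  finally show ?thesis by simp
qed

text \<open>Lowering the index of y gives F times dF, so the g-gradient of F is y/F.\<close>

lemma ginv_dY_f:
  assumes z: "z \<in> Om"
  shows "(\<Sum>j\<in>UNIV. ginv z $ j $ a * dY j f z) = snd z $ a / f z"
proof -
  have F: "f z > 0" by (rule f_pos[OF z])
  have "f z * (\<Sum>j\<in>UNIV. ginv z $ j $ a * dY j f z) = (\<Sum>j\<in>UNIV. ginv z $ a $ j * (\<Sum>k\<in>UNIV. gmat f z $ j $ k * snd z $ k))"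
    unfolding gmat_snd[OF z] dY_f2[OF z] sum_distrib_left
    by (intro sum.cong refl) (simp add: ginv_sym[OF z, of a])
  also have "\<dots> = (\<Sum>k\<in>UNIV. (\<Sum>j\<in>UNIV. ginv z $ a $ j * gmat f z $ j $ k) * snd z $ k)"
    unfolding sum_distrib_left sum_distrib_right by (subst sum.swap) (simp add: mult.assoc)
  also have "\<dots> = snd z $ a"
    by (simp add: ginv_mult[OF z] if_distrib if_distribR cong: if_cong)
  finally show ?thesis using F by (simp add: field_simps)
qed

end

text \<open>A \<open>1\<close>-homogeneous function \<open>h\<close> whose Hessian is trace-free with respect to \<open>g\<close>. In terms of
  the Hessian metric of \<open>F\<^sup>2/2\<close> this is the infinitesimal form of the uniqueness in the Minkowski problem:
  \<open>hup\<close> is (up to sign) the derivative of the cofactor matrix of the Hessian of \<open>F\<^sup>2/2 + t h\<close>, hence divergence free.\<close>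

locale trace_free_function = finsler_chart +
  fixes h :: "'a tb \<Rightarrow> real"
  assumes smooth_h: "smooth_on (slit_over U) h" and homog_h: "homog U 1 h"
    and trace_free: "\<And>z. z \<in> slit_over U \<Longrightarrow>
      (\<Sum>j\<in>UNIV. \<Sum>k\<in>UNIV. matrix_inv (gmat f z) $ j $ k * dY j (dY k h) z) = 0"
begin

abbreviation "hh a b \<equiv> dY a (dY b h)"

definition Ah :: "'a \<Rightarrow> 'a \<Rightarrow> 'a tb \<Rightarrow> real" where
  "Ah j l z = (\<Sum>a\<in>UNIV. \<Sum>b\<in>UNIV. ginv z $ j $ a * ginv z $ l $ b * hh a b z)"

definition hup :: "'a \<Rightarrow> 'a \<Rightarrow> 'a tb \<Rightarrow> real" where
  "hup j l z = det (gmat f z) * Ah j l z"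

lemma smooth_hh: "smooth_on Om (hh a b)"
  by (intro smooth_on_dY smooth_h)

lemma hh_sym: "z \<in> Om \<Longrightarrow> hh a b z = hh b a z"
  unfolding dY_eq_dd by (rule dd_commute[OF smooth_h])

lemma dY_hh_sym: "z \<in> Om \<Longrightarrow> dY c (hh a b) z = dY b (hh a c) z"
proof -
  assume z: "z \<in> Om"
  have "dY c (hh a b) z = dY c (hh b a) z"
    unfolding dY_eq_dd[of c] by (rule dd_cong[OF open_Om z hh_sym])
  also have "\<dots> = dY b (hh c a) z"
    unfolding dY_eq_dd[of c] dY_eq_dd[of b] by (rule dd_commute[OF smooth_on_dY[OF smooth_h] z])
  also have "\<dots> = dY b (hh a c) z"
    unfolding dY_eq_dd[of b] by (rule dd_cong[OF open_Om z hh_sym])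
  finally show ?thesis .
qed

lemma smooth_Ah: "smooth_on Om (Ah j l)"
  unfolding Ah_def[abs_def] by (intro smooth_on_sum smooth_on_mult smooth_ginv smooth_hh open_Om)

lemma smooth_hup: "smooth_on Om (hup j l)"
  unfolding hup_def[abs_def] by (intro smooth_on_mult smooth_Ah smooth_det_gmat)

lemma hh_radial: "z \<in> Om \<Longrightarrow> (\<Sum>a\<in>UNIV. snd z $ a * hh a b z) = 0"
  using euler_homog(2)[OF smooth_on_dY[OF smooth_h] homog_dY[OF smooth_h homog_h], of z b] by simp

text \<open>The product rule gives four terms. The derivative of the determinant cancels that of the
  first inverse metric (\<open>div_ginv\<close>). By total symmetry the other two add up to a raised
  derivative of the trace of the Hessian of \<open>h\<close>, which is zero.\<close>

lemma div_hup:
  assumes z: "z \<in> Om"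
  shows "(\<Sum>j\<in>UNIV. dY j (hup j l) z) = 0"
proof -
  let ?d = "det (gmat f z)"
  note [simp] = diff_Om[OF _ z] smooth_ginv smooth_hh smooth_det_gmat smooth_Ah smooth_on_mult smooth_on_sum open_Om
  have "dY j (Ah j l) z = (\<Sum>a\<in>UNIV. \<Sum>b\<in>UNIV. ginv z $ j $ a * ginv z $ l $ b * dY j (hh a b) z
      + (ginv z $ j $ a * dY j (\<lambda>z. ginv z $ l $ b) z + dY j (\<lambda>z. ginv z $ j $ a) z * ginv z $ l $ b) * hh a b z)" for j
    unfolding Ah_def[abs_def] dY_eq_dd[of j] by (simp add: dd_sum dd_mult)
  then have dA: "dY j (Ah j l) z = (\<Sum>a\<in>UNIV. \<Sum>b\<in>UNIV. dY j (\<lambda>z. ginv z $ j $ a) z * (ginv z $ l $ b * hh a b z))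
     + (\<Sum>a\<in>UNIV. \<Sum>b\<in>UNIV. ginv z $ j $ a * dY j (\<lambda>z. ginv z $ l $ b) z * hh a b z)
     + (\<Sum>a\<in>UNIV. \<Sum>b\<in>UNIV. ginv z $ l $ b * (ginv z $ j $ a * dY j (hh a b) z))" for j
    by (simp add: sum.distrib algebra_simps)
  have 1: "?d * (\<Sum>j\<in>UNIV. \<Sum>a\<in>UNIV. \<Sum>b\<in>UNIV. dY j (\<lambda>z. ginv z $ j $ a) z * (ginv z $ l $ b * hh a b z))
      = - (\<Sum>j\<in>UNIV. dY j (\<lambda>z. det (gmat f z)) z * Ah j l z)"
  proof -
    define Y where "Y a = (\<Sum>b\<in>UNIV. ginv z $ l $ b * hh a b z)" for a
    have "?d * (\<Sum>j\<in>UNIV. \<Sum>a\<in>UNIV. \<Sum>b\<in>UNIV. dY j (\<lambda>z. ginv z $ j $ a) z * (ginv z $ l $ b * hh a b z))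
       = ?d * (\<Sum>a\<in>UNIV. \<Sum>j\<in>UNIV. dY j (\<lambda>z. ginv z $ j $ a) z * Y a)"
      by (subst sum.swap) (simp add: Y_def sum_distrib_left)
    also have "\<dots> = (\<Sum>a\<in>UNIV. (?d * (\<Sum>j\<in>UNIV. dY j (\<lambda>z. ginv z $ j $ a) z)) * Y a)"
      by (simp add: sum_distrib_left sum_distrib_right mult.assoc)
    also have "\<dots> = - (\<Sum>a\<in>UNIV. \<Sum>q\<in>UNIV. dY q (\<lambda>z. det (gmat f z)) z * (ginv z $ q $ a * Y a))"
      unfolding div_ginv[OF z] by (simp add: sum_distrib_right sum_negf mult.assoc)
    also have "\<dots> = - (\<Sum>q\<in>UNIV. \<Sum>a\<in>UNIV. dY q (\<lambda>z. det (gmat f z)) z * (ginv z $ q $ a * Y a))"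
      by (subst sum.swap) (rule refl)
    finally show ?thesis by (simp add: Y_def Ah_def sum_distrib_left mult.assoc)
  qed
  have 2: "(\<Sum>j\<in>UNIV. \<Sum>a\<in>UNIV. \<Sum>b\<in>UNIV. ginv z $ j $ a * dY j (\<lambda>z. ginv z $ l $ b) z * hh a b z)
      = (\<Sum>p\<in>UNIV. \<Sum>a\<in>UNIV. \<Sum>b\<in>UNIV. ginv z $ l $ p * (dY p (\<lambda>z. ginv z $ a $ b) z * hh a b z))"
  proof -
    have "(\<Sum>j\<in>UNIV. \<Sum>a\<in>UNIV. \<Sum>b\<in>UNIV. ginv z $ j $ a * dY j (\<lambda>z. ginv z $ l $ b) z * hh a b z)
        = (\<Sum>a\<in>UNIV. \<Sum>b\<in>UNIV. (\<Sum>j\<in>UNIV. ginv z $ j $ a * dY j (\<lambda>z. ginv z $ l $ b) z) * hh a b z)"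
      unfolding sum_distrib_right by (subst sum.swap, rule sum.cong[OF refl], rule sum.swap)
    also have "\<dots> = (\<Sum>a\<in>UNIV. \<Sum>b\<in>UNIV. \<Sum>p\<in>UNIV. ginv z $ l $ p * (dY p (\<lambda>z. ginv z $ a $ b) z * hh a b z))"
      unfolding ginv_dY_ginv_sym[OF z] by (simp add: sum_distrib_right mult.assoc)
    also have "\<dots> = (\<Sum>a\<in>UNIV. \<Sum>p\<in>UNIV. \<Sum>b\<in>UNIV. ginv z $ l $ p * (dY p (\<lambda>z. ginv z $ a $ b) z * hh a b z))"
      by (rule sum.cong[OF refl], rule sum.swap)
    also have "\<dots> = (\<Sum>p\<in>UNIV. \<Sum>a\<in>UNIV. \<Sum>b\<in>UNIV. ginv z $ l $ p * (dY p (\<lambda>z. ginv z $ a $ b) z * hh a b z))"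
      by (rule sum.swap)
    finally show ?thesis .
  qed
  have 3: "(\<Sum>j\<in>UNIV. \<Sum>a\<in>UNIV. \<Sum>b\<in>UNIV. ginv z $ l $ b * (ginv z $ j $ a * dY j (hh a b) z))
      = (\<Sum>p\<in>UNIV. \<Sum>a\<in>UNIV. \<Sum>b\<in>UNIV. ginv z $ l $ p * (ginv z $ a $ b * dY p (hh a b) z))"
  proof -
    have "(\<Sum>j\<in>UNIV. \<Sum>a\<in>UNIV. \<Sum>b\<in>UNIV. ginv z $ l $ b * (ginv z $ j $ a * dY j (hh a b) z))
        = (\<Sum>j\<in>UNIV. \<Sum>b\<in>UNIV. \<Sum>a\<in>UNIV. ginv z $ l $ b * (ginv z $ j $ a * dY j (hh a b) z))"
      by (rule sum.cong[OF refl], rule sum.swap)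
    also have "\<dots> = (\<Sum>b\<in>UNIV. \<Sum>j\<in>UNIV. \<Sum>a\<in>UNIV. ginv z $ l $ b * (ginv z $ j $ a * dY j (hh a b) z))"
      by (rule sum.swap)
    also have "\<dots> = (\<Sum>b\<in>UNIV. \<Sum>a\<in>UNIV. \<Sum>j\<in>UNIV. ginv z $ l $ b * (ginv z $ j $ a * dY j (hh a b) z))"
      by (rule sum.cong[OF refl], rule sum.swap)
    also have "\<dots> = (\<Sum>b\<in>UNIV. \<Sum>a\<in>UNIV. \<Sum>j\<in>UNIV. ginv z $ l $ b * (ginv z $ a $ j * dY b (hh a j) z))"
    proof (intro sum.cong refl)
      fix b a j
      show "ginv z $ l $ b * (ginv z $ j $ a * dY j (hh a b) z) = ginv z $ l $ b * (ginv z $ a $ j * dY b (hh a j) z)"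
        using dY_hh_sym[OF z, of j a b] ginv_sym[OF z, of j a] by simp
    qed
    finally show ?thesis .
  qed
  have 4: "(\<Sum>a\<in>UNIV. \<Sum>b\<in>UNIV. dY p (\<lambda>z. ginv z $ a $ b) z * hh a b z) + (\<Sum>a\<in>UNIV. \<Sum>b\<in>UNIV. ginv z $ a $ b * dY p (hh a b) z) = 0" for p
  proof -
    have "dY p (\<lambda>z. \<Sum>a\<in>UNIV. \<Sum>b\<in>UNIV. ginv z $ a $ b * hh a b z) z = dY p (\<lambda>z. 0) z"
      unfolding dY_eq_dd[of p] by (rule dd_cong[OF open_Om z trace_free])
    moreover have "dY p (\<lambda>z. \<Sum>a\<in>UNIV. \<Sum>b\<in>UNIV. ginv z $ a $ b * hh a b z) z
      = (\<Sum>a\<in>UNIV. \<Sum>b\<in>UNIV. dY p (\<lambda>z. ginv z $ a $ b) z * hh a b z) + (\<Sum>a\<in>UNIV. \<Sum>b\<in>UNIV. ginv z $ a $ b * dY p (hh a b) z)"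
      unfolding dY_eq_dd[of p] by (simp add: dd_sum dd_mult sum.distrib)
    ultimately show ?thesis by (simp add: dY_eq_dd[of p])
  qed
  have "(\<Sum>j\<in>UNIV. dY j (hup j l) z) = ?d * (\<Sum>j\<in>UNIV. dY j (Ah j l) z) + (\<Sum>j\<in>UNIV. dY j (\<lambda>z. det (gmat f z)) z * Ah j l z)"
    unfolding hup_def[abs_def] dY_eq_dd by (simp add: dd_mult sum.distrib sum_distrib_left)
  also have "(\<Sum>j\<in>UNIV. dY j (Ah j l) z)
     = (\<Sum>j\<in>UNIV. \<Sum>a\<in>UNIV. \<Sum>b\<in>UNIV. dY j (\<lambda>z. ginv z $ j $ a) z * (ginv z $ l $ b * hh a b z))
     + (\<Sum>p\<in>UNIV. \<Sum>a\<in>UNIV. \<Sum>b\<in>UNIV. ginv z $ l $ p * (dY p (\<lambda>z. ginv z $ a $ b) z * hh a b z))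
     + (\<Sum>p\<in>UNIV. \<Sum>a\<in>UNIV. \<Sum>b\<in>UNIV. ginv z $ l $ p * (ginv z $ a $ b * dY p (hh a b) z))"
    unfolding dA sum.distrib 2 3 by (rule refl)
  also have "(\<Sum>p\<in>UNIV. \<Sum>a\<in>UNIV. \<Sum>b\<in>UNIV. ginv z $ l $ p * (ginv z $ a $ b * dY p (hh a b) z))
      = (\<Sum>p\<in>UNIV. ginv z $ l $ p * - (\<Sum>a\<in>UNIV. \<Sum>b\<in>UNIV. dY p (\<lambda>z. ginv z $ a $ b) z * hh a b z))"
  proof (intro sum.cong refl)
    fix p
    show "(\<Sum>a\<in>UNIV. \<Sum>b\<in>UNIV. ginv z $ l $ p * (ginv z $ a $ b * dY p (hh a b) z))
      = ginv z $ l $ p * - (\<Sum>a\<in>UNIV. \<Sum>b\<in>UNIV. dY p (\<lambda>z. ginv z $ a $ b) z * hh a b z)"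
      using 4[of p] by (simp add: sum_distrib_left[symmetric] add_eq_0_iff)
  qed
  also have "(\<Sum>p\<in>UNIV. \<Sum>a\<in>UNIV. \<Sum>b\<in>UNIV. ginv z $ l $ p * (dY p (\<lambda>z. ginv z $ a $ b) z * hh a b z))
      = (\<Sum>p\<in>UNIV. ginv z $ l $ p * (\<Sum>a\<in>UNIV. \<Sum>b\<in>UNIV. dY p (\<lambda>z. ginv z $ a $ b) z * hh a b z))"
    by (simp add: sum_distrib_left)
  finally show ?thesis
    using 1 by (simp add: distrib_left sum_negf)
qed

text \<open>The gradient of F is radial by \<open>ginv_dY_f\<close>, and the Hessian of the
  1-homogeneous \<open>h\<close> annihilates y.\<close>

lemma Ah_dY_f:
  assumes z: "z \<in> Om"
  shows "(\<Sum>j\<in>UNIV. Ah j l z * dY j f z) = 0"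
proof -
  note * = ginv_dY_f[OF z]
  have "(\<Sum>j\<in>UNIV. Ah j l z * dY j f z) = (\<Sum>j\<in>UNIV. \<Sum>a\<in>UNIV. (ginv z $ j $ a * dY j f z) * (\<Sum>b\<in>UNIV. ginv z $ l $ b * hh a b z))"
    by (simp add: Ah_def sum_distrib_left sum_distrib_right algebra_simps)
  also have "\<dots> = (\<Sum>a\<in>UNIV. (\<Sum>j\<in>UNIV. ginv z $ j $ a * dY j f z) * (\<Sum>b\<in>UNIV. ginv z $ l $ b * hh a b z))"
    by (subst sum.swap) (simp add: sum_distrib_right)
  also have "\<dots> = (\<Sum>b\<in>UNIV. ginv z $ l $ b * ((\<Sum>a\<in>UNIV. snd z $ a * hh a b z) / f z))"
    unfolding * sum_distrib_left sum_divide_distrib by (subst sum.swap) (simp add: algebra_simps)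
  finally show ?thesis by (simp add: hh_radial[OF z])
qed

text \<open>Because of the tangency to the level sets of F, the factor F passes through the
  divergence like a constant; it makes the field homogeneous of degree 0.\<close>

definition Vf :: "'a \<Rightarrow> 'a tb \<Rightarrow> real" where
  "Vf j z = f z * (\<Sum>l\<in>UNIV. hup j l z * dY l h z)"

lemma smooth_Vf: "smooth_on Om (Vf j)"
  unfolding Vf_def[abs_def] by (intro smooth_on_mult smooth_f smooth_on_sum smooth_hup smooth_on_dY smooth_h open_Om)

lemma Vf_dY_f:
  assumes z: "z \<in> Om"
  shows "(\<Sum>j\<in>UNIV. dY j f z * Vf j z) = 0"
proof -
  have "(\<Sum>j\<in>UNIV. dY j f z * Vf j z) = (\<Sum>j\<in>UNIV. \<Sum>l\<in>UNIV. f z * det (gmat f z) * dY l h z * (Ah j l z * dY j f z))"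
    by (simp add: Vf_def hup_def sum_distrib_left algebra_simps)
  also have "\<dots> = (\<Sum>l\<in>UNIV. f z * det (gmat f z) * dY l h z * (\<Sum>j\<in>UNIV. Ah j l z * dY j f z))"
    by (subst sum.swap) (simp add: sum_distrib_left)
  finally show ?thesis by (simp add: Ah_dY_f[OF z])
qed

text \<open>The squared g-norm of the Hessian of \<open>h\<close>.\<close>

definition Eh :: "'a tb \<Rightarrow> real" where
  "Eh z = (\<Sum>j\<in>UNIV. \<Sum>l\<in>UNIV. Ah j l z * hh j l z)"

text \<open>Of the three terms of the product rule, the derivative of F drops out by tangency and
  that of \<open>hup\<close> by \<open>div_hup\<close>; the derivative of dh leaves the squared
  norm.\<close>

lemma div_Vf:
  assumes z: "z \<in> Om"
  shows "(\<Sum>j\<in>UNIV. dY j (Vf j) z) = f z * (det (gmat f z) * Eh z)"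
proof -
  note [simp] = diff_Om[OF _ z] smooth_hup smooth_f smooth_h smooth_on_dY smooth_on_mult smooth_on_sum open_Om
  have "dY j (Vf j) z = f z * (\<Sum>l\<in>UNIV. hup j l z * hh j l z) + f z * (\<Sum>l\<in>UNIV. dY j (hup j l) z * dY l h z)
      + dY j f z * (\<Sum>l\<in>UNIV. hup j l z * dY l h z)" for j
    unfolding Vf_def[abs_def] dY_eq_dd[of j] by (simp add: dd_sum dd_mult sum.distrib distrib_left)
  then have "(\<Sum>j\<in>UNIV. dY j (Vf j) z) = f z * (\<Sum>j\<in>UNIV. \<Sum>l\<in>UNIV. hup j l z * hh j l z)
      + f z * (\<Sum>j\<in>UNIV. \<Sum>l\<in>UNIV. dY j (hup j l) z * dY l h z)
      + (\<Sum>j\<in>UNIV. dY j f z * (\<Sum>l\<in>UNIV. hup j l z * dY l h z))"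
    by (simp add: sum.distrib sum_distrib_left)
  also have "(\<Sum>j\<in>UNIV. \<Sum>l\<in>UNIV. dY j (hup j l) z * dY l h z) = (\<Sum>l\<in>UNIV. (\<Sum>j\<in>UNIV. dY j (hup j l) z) * dY l h z)"
    by (subst sum.swap) (simp add: sum_distrib_right)
  also have "\<dots> = 0" by (simp add: div_hup[OF z])
  also have "(\<Sum>j\<in>UNIV. dY j f z * (\<Sum>l\<in>UNIV. hup j l z * dY l h z)) = 0"
  proof -
    have "f z * (\<Sum>j\<in>UNIV. dY j f z * (\<Sum>l\<in>UNIV. hup j l z * dY l h z)) = (\<Sum>j\<in>UNIV. dY j f z * Vf j z)"
      unfolding Vf_def by (simp add: sum_distrib_left algebra_simps)
    then show ?thesis using Vf_dY_f[OF z] f_pos[OF z] by simp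
  qed
  finally show ?thesis by (simp add: hup_def Eh_def sum_distrib_left mult.assoc)
qed

text \<open>In an orthonormal frame \<open>Eh\<close> is the sum of the squares of the components
  \<open>X i k\<close> of the Hessian, and the coordinate components are recovered from these with
  the coframe.\<close>

lemma Eh_nonneg_zero:
  assumes z: "z \<in> Om"
  shows "Eh z \<ge> 0" and "Eh z = 0 \<Longrightarrow> hh p q z = 0"
proof -
  obtain W u where "adapted_frame undefined f W u" "W \<subseteq> Om" and zW: "z \<in> W"
    using adapted_frame_exists[OF z] by blast
  then interpret finsler_frame U f undefined W u by unfold_locales
  define X where "X i k = (\<Sum>a\<in>UNIV. \<Sum>b\<in>UNIV. u i z $ a * u k z $ b * hh a b z)" for i k
  have "Eh z = (\<Sum>j\<in>UNIV. \<Sum>l\<in>UNIV. \<Sum>a\<in>UNIV. \<Sum>b\<in>UNIV. \<Sum>i\<in>UNIV. \<Sum>k\<in>UNIV.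
      (u i z $ j * u k z $ l * hh j l z) * (u i z $ a * u k z $ b * hh a b z))"
    unfolding Eh_def Ah_def ginv_eq[OF zW] sum_product
    by (simp add: sum_distrib_left sum_distrib_right algebra_simps)
  also have "\<dots> = (\<Sum>i\<in>UNIV. \<Sum>k\<in>UNIV. \<Sum>j\<in>UNIV. \<Sum>l\<in>UNIV. \<Sum>a\<in>UNIV. \<Sum>b\<in>UNIV.
      (u i z $ j * u k z $ l * hh j l z) * (u i z $ a * u k z $ b * hh a b z))"
  proof -
    have sw: "(\<Sum>j\<in>UNIV. \<Sum>l\<in>UNIV. \<Sum>i\<in>UNIV. Y j l i) = (\<Sum>i\<in>UNIV. \<Sum>j\<in>UNIV. \<Sum>l\<in>UNIV. Y j l i)"
      for Y :: "'a \<Rightarrow> 'a \<Rightarrow> 'a \<Rightarrow> real"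
    proof -
      have "(\<Sum>j\<in>UNIV. \<Sum>l\<in>UNIV. \<Sum>i\<in>UNIV. Y j l i) = (\<Sum>j\<in>UNIV. \<Sum>i\<in>UNIV. \<Sum>l\<in>UNIV. Y j l i)"
        by (rule sum.cong[OF refl], rule sum.swap)
      also have "\<dots> = (\<Sum>i\<in>UNIV. \<Sum>j\<in>UNIV. \<Sum>l\<in>UNIV. Y j l i)" by (rule sum.swap)
      finally show ?thesis .
    qed
    have sw2: "(\<Sum>a\<in>UNIV. \<Sum>b\<in>UNIV. \<Sum>i\<in>UNIV. \<Sum>k\<in>UNIV. Y a b i k)
        = (\<Sum>i\<in>UNIV. \<Sum>k\<in>UNIV. \<Sum>a\<in>UNIV. \<Sum>b\<in>UNIV. Y a b i k)" for Y :: "'a \<Rightarrow> 'a \<Rightarrow> 'a \<Rightarrow> 'a \<Rightarrow> real"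
      by (rule trans[OF sw[of "\<lambda>a b i. \<Sum>k\<in>UNIV. Y a b i k"]], rule sum.cong[OF refl], rule sw)
    have "(\<Sum>j\<in>UNIV. \<Sum>l\<in>UNIV. \<Sum>a\<in>UNIV. \<Sum>b\<in>UNIV. \<Sum>i\<in>UNIV. \<Sum>k\<in>UNIV.
      (u i z $ j * u k z $ l * hh j l z) * (u i z $ a * u k z $ b * hh a b z))
      = (\<Sum>j\<in>UNIV. \<Sum>l\<in>UNIV. \<Sum>i\<in>UNIV. \<Sum>k\<in>UNIV. \<Sum>a\<in>UNIV. \<Sum>b\<in>UNIV.
      (u i z $ j * u k z $ l * hh j l z) * (u i z $ a * u k z $ b * hh a b z))"
      by (rule sum.cong[OF refl], rule sum.cong[OF refl], rule sw2)
    also have "\<dots> = (\<Sum>i\<in>UNIV. \<Sum>k\<in>UNIV. \<Sum>j\<in>UNIV. \<Sum>l\<in>UNIV. \<Sum>a\<in>UNIV. \<Sum>b\<in>UNIV.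
      (u i z $ j * u k z $ l * hh j l z) * (u i z $ a * u k z $ b * hh a b z))"
      by (rule sw2)
    finally show ?thesis .
  qed
  also have "\<dots> = (\<Sum>i\<in>UNIV. \<Sum>k\<in>UNIV. (X i k)\<^sup>2)"
    unfolding X_def power2_eq_square sum_distrib_right by (simp add: sum_distrib_left)
  finally have E: "Eh z = (\<Sum>i\<in>UNIV. \<Sum>k\<in>UNIV. (X i k)\<^sup>2)" .
  then show "Eh z \<ge> 0" by (simp add: sum_nonneg)
  assume "Eh z = 0"
  then have X0: "X i k = 0" for i k
    using E by (simp add: sum_nonneg_eq_0_iff sum_nonneg)
  let ?c = "coframe_mat u z"
  have "hh p q z = (\<Sum>a\<in>UNIV. \<Sum>b\<in>UNIV. (if a = p then 1 else 0) * (if b = q then 1 else 0) * hh a b z)"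
  proof -
    have \<delta>: "(\<Sum>b\<in>UNIV. (if b = q then 1 else 0) * k b) = k q" for k :: "'a \<Rightarrow> real" and q
      by (simp add: if_distrib[where f = "\<lambda>x. x * k b" for b] cong: if_cong)
    show ?thesis
      unfolding mult.assoc sum_distrib_left[symmetric] \<delta> by (rule refl)
  qed
  also have "\<dots> = (\<Sum>a\<in>UNIV. \<Sum>b\<in>UNIV. \<Sum>i\<in>UNIV. \<Sum>k\<in>UNIV. ?c $ i $ p * ?c $ k $ q * (u i z $ a * u k z $ b * hh a b z))"
    unfolding u_coframe[OF zW, symmetric] sum_product sum_distrib_right by (simp add: sum_distrib_left algebra_simps)
  also have "\<dots> = (\<Sum>a\<in>UNIV. \<Sum>i\<in>UNIV. \<Sum>b\<in>UNIV. \<Sum>k\<in>UNIV. ?c $ i $ p * ?c $ k $ q * (u i z $ a * u k z $ b * hh a b z))"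
    by (rule sum.cong[OF refl], rule sum.swap)
  also have "\<dots> = (\<Sum>i\<in>UNIV. \<Sum>a\<in>UNIV. \<Sum>b\<in>UNIV. \<Sum>k\<in>UNIV. ?c $ i $ p * ?c $ k $ q * (u i z $ a * u k z $ b * hh a b z))"
    by (rule sum.swap)
  also have "\<dots> = (\<Sum>i\<in>UNIV. \<Sum>a\<in>UNIV. \<Sum>k\<in>UNIV. \<Sum>b\<in>UNIV. ?c $ i $ p * ?c $ k $ q * (u i z $ a * u k z $ b * hh a b z))"
    by (rule sum.cong[OF refl], rule sum.cong[OF refl], rule sum.swap)
  also have "\<dots> = (\<Sum>i\<in>UNIV. \<Sum>k\<in>UNIV. \<Sum>a\<in>UNIV. \<Sum>b\<in>UNIV. ?c $ i $ p * ?c $ k $ q * (u i z $ a * u k z $ b * hh a b z))"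
    by (rule sum.cong[OF refl], rule sum.swap)
  also have "\<dots> = (\<Sum>i\<in>UNIV. \<Sum>k\<in>UNIV. ?c $ i $ p * ?c $ k $ q * X i k)"
    by (simp add: X_def sum_distrib_left)
  finally show "hh p q z = 0" by (simp add: X0)
qed

section \<open>The cut-off argument on one fibre\<close>

lemma f_zero: "x \<in> U \<Longrightarrow> f (x, 0) = 0"
  using f_scale[of x 2 0] by simp

text \<open>F is 1-homogeneous and has a positive minimum on the Euclidean unit sphere. The bound
  gives the cut-off field below compact support.\<close>

lemma f_coercive:
  assumes x: "x \<in> U"
  obtains r where "\<And>y. r \<le> norm y \<Longrightarrow> f (x, y) \<ge> 2"
proof -
  have cont: "continuous_on UNIV (\<lambda>y. f (x, y))"
    by (rule continuous_on_compose2[OF cont_f]) (use x in \<open>auto intro!: continuous_intros\<close>)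
  have "\<exists>y0\<in>sphere 0 1. \<forall>y\<in>sphere 0 1. f (x, y0) \<le> f (x, y)"
    by (rule continuous_attains_inf) (auto intro: continuous_on_subset[OF cont])
  then obtain y0 where y0: "norm y0 = 1" "\<And>y. norm y = 1 \<Longrightarrow> f (x, y0) \<le> f (x, y)"
    by (auto simp: dist_norm)
  define \<mu> where "\<mu> = f (x, y0)"
  have \<mu>: "\<mu> > 0" unfolding \<mu>_def using y0(1) x by (intro f_pos) (auto simp: slit_over_def)
  show ?thesis
  proof (rule that[of "2 / \<mu>"])
    fix y :: "real ^ 'a" assume y: "2 / \<mu> \<le> norm y"
    have ny: "norm y > 0" using y \<mu> by (smt (verit) divide_pos_pos)
    have "f (x, y) = norm y * f (x, (1 / norm y) *\<^sub>R y)"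
      using f_scale[OF x ny, of "(1 / norm y) *\<^sub>R y"] ny by simp
    moreover have "f (x, (1 / norm y) *\<^sub>R y) \<ge> \<mu>"
      unfolding \<mu>_def using ny by (intro y0(2)) simp
    ultimately have "f (x, y) \<ge> norm y * \<mu>" using ny by (simp add: mult_left_mono)
    then show "f (x, y) \<ge> 2" using y \<mu> by (simp add: field_simps)
  qed
qed

text \<open>The set F < 1 is an open neighbourhood of the origin on which \<open>G\<close> is 0, and
  it covers the one point left out.\<close>

lemma continuous_on_punctured_extension:
  fixes G :: "real ^ 'a \<Rightarrow> real"
  assumes x: "x \<in> U" and G: "continuous_on (- {0}) G"
    and 0: "\<And>y. f (x, y) < 1 \<Longrightarrow> G y = 0"
  shows "continuous_on UNIV G"
proof -
  have cont: "continuous_on UNIV (\<lambda>y. f (x, y))"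
    by (rule continuous_on_compose2[OF cont_f]) (use x in \<open>auto intro!: continuous_intros\<close>)
  have op: "open {y. f (x, y) < 1}"
    by (rule open_Collect_less[OF cont]) (rule continuous_on_const)
  have "continuous_on {y. f (x, y) < 1} G"
    by (rule continuous_on_eq[OF continuous_on_const[of _ 0]]) (simp add: 0)
  then have "continuous_on (- {0} \<union> {y. f (x, y) < 1}) G"
    by (intro continuous_on_open_Un G op) auto
  moreover have "- {0} \<union> {y. f (x, y) < 1} = UNIV"
    using f_zero[OF x] by auto
  ultimately show ?thesis by simp
qed

text \<open>The cut-off is a function of F, so its gradient is annihilated by \<open>Vf\<close>, and
  the divergence of the cut-off field is the cut-off times F det g \<open>Eh\<close>. This is
  continuous, nonnegative and of integral 0, so \<open>Eh\<close> vanishes wherever the cut-off is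
  positive.\<close>

lemma Eh_zero_annulus:
  assumes x: "x \<in> U" and y1: "1 < f (x, y)" "f (x, y) < 2"
  shows "Eh (x, y) = 0"
proof -
  \<comment> \<open>One continuous derivative is enough for the cut-off, because only first
    derivatives are integrated.\<close>
  define \<psi> where "\<psi> t = (max 0 t)\<^sup>2" for t :: real
  define \<psi>' where "\<psi>' t = 2 * max 0 t" for t :: real
  have \<psi>d: "(\<psi> has_real_derivative \<psi>' t) (at t)" for t
  proof (cases t "0 :: real" rule: linorder_cases)
    case less
    have "((\<lambda>t. 0) has_real_derivative \<psi>' t) (at t)" using less by (simp add: \<psi>'_def)
    then show ?thesis
      by (rule has_field_derivative_transform_within_open[of _ _ _ "{..<0}"]) (use less in \<open>auto simp: \<psi>_def\<close>)
  next
    case greater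
    have "((\<lambda>t. t\<^sup>2) has_real_derivative \<psi>' t) (at t)" using greater by (auto intro!: derivative_eq_intros simp: \<psi>'_def)
    then show ?thesis
      by (rule has_field_derivative_transform_within_open[of _ _ _ "{0<..}"]) (use greater in \<open>auto simp: \<psi>_def\<close>)
  next
    case equal
    have "((\<lambda>s. (\<psi> s - \<psi> 0) / (s - 0)) \<longlongrightarrow> 0) (at 0)"
    proof (rule Lim_null_comparison[where g = "\<lambda>s. \<bar>s\<bar>"])
      show "\<forall>\<^sub>F s in at 0. norm ((\<psi> s - \<psi> 0) / (s - 0)) \<le> \<bar>s\<bar>"
        by (rule always_eventually) (auto simp: \<psi>_def max_def power2_eq_square)
      show "((\<lambda>s :: real. \<bar>s\<bar>) \<longlongrightarrow> 0) (at 0)" by (auto intro!: tendsto_eq_intros)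
    qed
    then show ?thesis using equal by (simp add: has_field_derivative_iff \<psi>'_def)
  qed
  have \<psi>c: "continuous_on S \<psi>" "continuous_on S \<psi>'" for S
    unfolding \<psi>_def \<psi>'_def by (intro continuous_intros)+
  \<comment> \<open>Positive exactly for 1 < F < 2.\<close>
  define q where "q z = (f z - 1) * (2 - f z)" for z
  have q0: "q z < 0" if "f z < 1" for z using that by (simp add: q_def mult_neg_pos)
  have q2: "q z \<le> 0" if "f z \<ge> 2" for z using that by (simp add: q_def mult_nonneg_nonpos)
  have sq: "smooth_on Om q"
    unfolding q_def[abs_def] by (intro smooth_on_mult smooth_on_diff smooth_f smooth_on_const open_Om)
  have dq: "dY j q z = (3 - 2 * f z) * dY j f z" if "z \<in> Om" for j z
  proof -
    have d: "f differentiable (at z)" "(\<lambda>z. f z - 1) differentiable (at z)" "(\<lambda>z. 2 - f z) differentiable (at z)"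
      using diff_Om[OF smooth_f that] by simp_all
    have "dY j q z = (f z - 1) * (- dY j f z) + dY j f z * (2 - f z)"
      unfolding q_def[abs_def] dY_eq_dd dd_mult[OF d(2,3)] using d(1) by (simp add: dd_diff)
    then show ?thesis by (simp add: algebra_simps)
  qed
  \<comment> \<open>The components of the cut-off field; the value 0 at the origin is its continuous
    extension, and likewise for the derivatives \<open>w'\<close>.\<close>
  define w where "w j y = (if y = 0 then 0 else \<psi> (q (x, y)) * Vf j (x, y))" for j y
  define w' where "w' j y = (if y = 0 then 0 else \<psi>' (q (x, y)) * dY j q (x, y) * Vf j (x, y)
      + \<psi> (q (x, y)) * dY j (Vf j) (x, y))" for j y
  have zOm: "(x, y) \<in> Om" if "y \<noteq> 0" for y using that x by (simp add: slit_over_def)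
  have w0: "w j y = 0" "w' j y = 0" if "f (x, y) < 1" for j y
    using q0[OF that] by (simp_all add: w_def w'_def \<psi>_def \<psi>'_def)
  have cs: "continuous_on (- {0}) (\<lambda>y. k (x, y))" if "smooth_on Om k" for k :: "'a tb \<Rightarrow> real"
    by (rule smooth_on_continuous[OF smooth_on_slice[OF that x]])
  have c\<psi>: "continuous_on (- {0}) (\<lambda>y. \<psi> (q (x, y)))" "continuous_on (- {0}) (\<lambda>y. \<psi>' (q (x, y)))"
    by (rule continuous_on_compose2[OF \<psi>c(1)[of UNIV] cs[OF sq]], simp)
      (rule continuous_on_compose2[OF \<psi>c(2)[of UNIV] cs[OF sq]], simp)
  have cw: "continuous_on UNIV (w j)" for j
  proof (rule continuous_on_punctured_extension[OF x _ w0(1)])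
    have "continuous_on (- {0}) (\<lambda>y. \<psi> (q (x, y)) * Vf j (x, y))"
      by (intro continuous_intros c\<psi> cs smooth_Vf)
    then show "continuous_on (- {0}) (w j)" by (rule continuous_on_eq) (simp add: w_def)
  qed
  have cw': "continuous_on UNIV (w' j)" for j
  proof (rule continuous_on_punctured_extension[OF x _ w0(2)])
    have "continuous_on (- {0}) (\<lambda>y. \<psi>' (q (x, y)) * dY j q (x, y) * Vf j (x, y) + \<psi> (q (x, y)) * dY j (Vf j) (x, y))"
      by (intro continuous_intros c\<psi> cs smooth_Vf smooth_on_dY sq)
    then show "continuous_on (- {0}) (w' j)" by (rule continuous_on_eq) (simp add: w'_def)
  qed
  have der: "((\<lambda>t. w j (y + t *\<^sub>R axis j 1)) has_real_derivative w' j y) (at 0)" for j y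
  proof (cases "f (x, y) < 1")
    case True
    have cont: "continuous_on UNIV (\<lambda>t. f (x, y + t *\<^sub>R axis j 1))"
      by (rule continuous_on_compose2[OF cont_f]) (use x in \<open>auto intro!: continuous_intros\<close>)
    have "((\<lambda>t. 0) has_real_derivative 0) (at 0 :: real filter)" by simp
    then have "((\<lambda>t. w j (y + t *\<^sub>R axis j 1)) has_real_derivative 0) (at 0)"
      by (rule has_field_derivative_transform_within_open[of _ _ _ "{t. f (x, y + t *\<^sub>R axis j 1) < 1}"])
        (use True w0 in \<open>auto intro: open_Collect_less[OF cont continuous_on_const]\<close>)
    then show ?thesis using w0(2)[OF True] by simp
  next
    case False
    then have y: "y \<noteq> 0" using f_zero[OF x] by auto
    have line: "((\<lambda>t. k (x, y + t *\<^sub>R axis j 1)) has_real_derivative dY j k (x, y)) (at 0)" if "smooth_on Om k" for k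
      using has_real_derivative_dd_line[of k "(x, y)" 0 "(0, axis j 1)"] diff_Om[OF that zOm[OF y]]
      by (simp add: dY_eq_dd zero_prod_def[symmetric])
    have "((\<lambda>t. \<psi> (q (x, y + t *\<^sub>R axis j 1))) has_real_derivative \<psi>' (q (x, y)) * dY j q (x, y)) (at 0)"
      by (rule DERIV_chain2[of \<psi>]) (use \<psi>d line[OF sq] in auto)
    from DERIV_mult[OF this line[OF smooth_Vf]]
    have "((\<lambda>t. \<psi> (q (x, y + t *\<^sub>R axis j 1)) * Vf j (x, y + t *\<^sub>R axis j 1)) has_real_derivative w' j y) (at 0)"
      using y by (simp add: w'_def algebra_simps)
    moreover have "open {t. y + t *\<^sub>R axis j 1 \<noteq> 0}"
      by (intro open_Collect_neq continuous_intros)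
    ultimately show ?thesis
      by (rule has_field_derivative_transform_within_open) (use y in \<open>auto simp: w_def\<close>)
  qed
  obtain r where r: "\<And>y. r \<le> norm y \<Longrightarrow> f (x, y) \<ge> 2" using f_coercive[OF x] by blast
  have supp: "w j y = 0" if "r \<le> norm y" for j y
    using q2[OF r[OF that]] by (simp add: w_def \<psi>_def)
  have int: "integrable lborel (w' j)" "integral\<^sup>L lborel (w' j) = 0" for j
    using integral_directional_derivative_eq_0[of "w j" "axis j 1" "w' j" r, OF der cw' cw supp] by auto
  \<comment> \<open>The divergence of the cut-off field.\<close>
  define P where "P y = (\<Sum>j\<in>UNIV. w' j y)" for y
  have Pq: "P y = \<psi> (q (x, y)) * (f (x, y) * (det (gmat f (x, y)) * Eh (x, y)))" if "y \<noteq> 0" for y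
  proof -
    note z = zOm[OF that]
    have "P y = \<psi>' (q (x, y)) * (3 - 2 * f (x, y)) * (\<Sum>j\<in>UNIV. dY j f (x, y) * Vf j (x, y))
       + \<psi> (q (x, y)) * (\<Sum>j\<in>UNIV. dY j (Vf j) (x, y))"
      unfolding P_def w'_def dq[OF z] using that by (simp add: sum.distrib sum_distrib_left mult.assoc)
    then show ?thesis by (simp add: Vf_dY_f[OF z] div_Vf[OF z])
  qed
  have P1: "P y \<ge> 0" for y
  proof (cases "y = 0")
    case False
    show ?thesis unfolding Pq[OF False] using f_pos[OF zOm[OF False]] det_gmat_pos[OF zOm[OF False]] Eh_nonneg_zero(1)[OF zOm[OF False]]
      by (simp add: \<psi>_def)
  qed (simp add: P_def w'_def)
  have P2: "continuous_on UNIV P" unfolding P_def by (intro continuous_intros cw')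
  have P3: "integrable lborel P" unfolding P_def by (intro Bochner_Integration.integrable_sum int)
  have P4: "integral\<^sup>L lborel P = 0" unfolding P_def using int by (simp add: Bochner_Integration.integral_sum)
  have P0: "P y = 0" by (rule continuous_nonneg_integral_eq_0[OF P2 P1 P3 P4])
  have y: "y \<noteq> 0" using y1 f_zero[OF x] by auto
  have "q (x, y) > 0" using y1 by (simp add: q_def)
  then have "\<psi> (q (x, y)) \<noteq> 0" by (simp add: \<psi>_def)
  then show ?thesis
    using P0 Pq[OF y] f_pos[OF zOm[OF y]] det_gmat_pos[OF zOm[OF y]] by simp
qed

theorem hessian_zero:
  assumes z: "z \<in> Om"
  shows "hh p q z = 0"
proof -
  obtain x y where xy: "z = (x, y)" by (cases z)
  have x: "x \<in> U" using z xy by (simp add: slit_over_def)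
  have F: "f (x, y) > 0" using f_pos[OF z] xy by simp
  \<comment> \<open>Rescales y to F = 3/2, inside the annulus. The Hessian is homogeneous of degree
    -1, so its vanishing there is enough.\<close>
  define t where "t = 3 / (2 * f (x, y))"
  have t: "t > 0" using F by (simp add: t_def)
  have ft: "f (x, t *\<^sub>R y) = 3 / 2" using f_scale[OF x t, of y] F by (simp add: t_def)
  have z': "(x, t *\<^sub>R y) \<in> Om" using z xy t by (intro slit_over_scale) auto
  have "Eh (x, t *\<^sub>R y) = 0" using ft by (intro Eh_zero_annulus[OF x]) auto
  then have "hh p q (x, t *\<^sub>R y) = 0" by (rule Eh_nonneg_zero(2)[OF z'])
  moreover have "hh p q (x, t *\<^sub>R y) = t powr (1 - 1 - 1) * hh p q (x, y)"
    by (rule homogD[OF homog_dY[OF smooth_on_dY[OF smooth_h] homog_dY[OF smooth_h homog_h]]]) (use z xy t in auto)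
  ultimately show ?thesis using t xy by simp
qed

end

section \<open>The closed 1-form in a chart\<close>

text \<open>The trace of g_jk = F_j F_k + F F_jk: the left side gives n, and the rank-one term gives
  1 because y^k F_k = F.\<close>

lemma (in finsler_chart) trace_hessian_f:
  assumes z: "z \<in> Om"
  shows "(\<Sum>j\<in>UNIV. \<Sum>k\<in>UNIV. ginv z $ j $ k * dY j (dY k f) z) = (real CARD('n) - 1) / f z"
proof -
  have F: "f z > 0" by (rule f_pos[OF z])
  note d = diff_Om[OF smooth_f z] diff_Om[OF smooth_on_dY[OF smooth_f] z]
  have g: "gmat f z $ k $ j = dY j f z * dY k f z + f z * dY j (dY k f) z" for j k
  proof -
    have "dY j (dY k f2) z = dY j (\<lambda>z. 2 * (f z * dY k f z)) z"
      unfolding dY_eq_dd[of j] by (rule dd_cong[OF open_Om z]) (simp add: dY_f2)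
    also have "\<dots> = 2 * (dY j f z * dY k f z + f z * dY j (dY k f) z)"
      unfolding dY_eq_dd[of j] using d by (simp add: dd_cmult dd_mult)
    finally show ?thesis by (simp add: gmat_eq)
  qed
  have "real CARD('n) = (\<Sum>j\<in>UNIV. \<Sum>k\<in>UNIV. ginv z $ j $ k * gmat f z $ k $ j)"
    by (simp add: ginv_mult[OF z])
  also have "\<dots> = (\<Sum>j\<in>UNIV. \<Sum>k\<in>UNIV. dY k f z * (ginv z $ j $ k * dY j f z))
      + f z * (\<Sum>j\<in>UNIV. \<Sum>k\<in>UNIV. ginv z $ j $ k * dY j (dY k f) z)"
    by (simp add: g distrib_left sum.distrib sum_distrib_left algebra_simps)
  also have "(\<Sum>j\<in>UNIV. \<Sum>k\<in>UNIV. dY k f z * (ginv z $ j $ k * dY j f z))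
      = (\<Sum>k\<in>UNIV. dY k f z * (\<Sum>j\<in>UNIV. ginv z $ j $ k * dY j f z))"
    by (subst sum.swap) (simp add: sum_distrib_left)
  also have "\<dots> = (\<Sum>k\<in>UNIV. snd z $ k * dY k f z) / f z"
    unfolding ginv_dY_f[OF z] by (simp add: sum_divide_distrib mult.commute)
  also have "\<dots> = 1"
    using euler_homog(2)[OF smooth_f homog_f z] F by simp
  finally show ?thesis using F by (simp add: field_simps)
qed

text \<open>The frame vectors \<open>e_h\<close> span the horizontal space and \<open>ext_d\<close>
  is bilinear. In this way the values of the mean stretch curvature on the frame reach the
  coordinate fields \<open>delta_x\<close>.\<close>

lemma (in finsler_frame) ext_d_horizontal_eq:
  assumes z: "z \<in> W" and form: "form_on S \<omega>" "form_on S \<eta>" "z \<in> S"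
    and eq: "\<And>p q. ext_d \<omega> z (e_h f u p z) (e_h f u q z) = ext_d \<eta> z (e_h f u p z) (e_h f u q z)"
    and hor: "\<And>k. delta_y f k z a = 0" "\<And>k. delta_y f k z b = 0"
  shows "ext_d \<omega> z a b = ext_d \<eta> z a b"
proof -
  have dec: "a = (\<Sum>k\<in>UNIV. co_h u k z a *\<^sub>R e_h f u k z)" if "\<And>k. delta_y f k z a = 0" for a
  proof -
    have "vert z a = 0" by (simp add: vert_def that zero_prod_def vec_eq_iff)
    then show ?thesis using frame_decomp[OF z, of a] by simp
  qed
  have *: "ext_d \<omega> z a b = (\<Sum>p\<in>UNIV. \<Sum>q\<in>UNIV. co_h u p z a * (co_h u q z b * ext_d \<omega> z (e_h f u p z) (e_h f u q z)))"
    if "form_on S \<omega>" for \<omega>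
  proof -
    note lin = linear_ext_d[OF that form(3)]
    have "ext_d \<omega> z a b = (\<Sum>p\<in>UNIV. co_h u p z a * ext_d \<omega> z (e_h f u p z) b)"
      by (subst dec[OF hor(1)]) (simp add: linear_sum[OF lin(1)] linear_scale[OF lin(1)])
    also have "\<dots> = (\<Sum>p\<in>UNIV. co_h u p z a * (\<Sum>q\<in>UNIV. co_h u q z b * ext_d \<omega> z (e_h f u p z) (e_h f u q z)))"
    proof -
      have "ext_d \<omega> z v b = (\<Sum>q\<in>UNIV. co_h u q z b * ext_d \<omega> z v (e_h f u q z))" for v
        by (subst dec[OF hor(2)]) (simp add: linear_sum[OF linear_ext_d(2)[OF that form(3)]] linear_scale[OF linear_ext_d(2)[OF that form(3)]])
      then show ?thesis by simp
    qed
    finally show ?thesis by (simp add: sum_distrib_left)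
  qed
  show ?thesis unfolding *[OF form(1)] *[OF form(2)] eq by (rule refl)
qed

context finsler_density
begin

lemma delta_y_delta_x: "delta_y f k z (delta_x f i z) = 0"
  by (simp add: delta_y_def delta_x_def axis_def if_distrib cong: if_cong)

text \<open>The distortion has a critical point on each fibre, because it is \<open>0\<close>-homogeneous.\<close>

lemma critical_direction:
  assumes x: "x \<in> U"
  obtains y where "(x, y) \<in> Om" "f (x, y) = 1" "\<And>k. dY k \<tau> (x, y) = 0"
proof -
  \<comment> \<open>The density is constant on a fibre, so det g can be maximized in place of the
    distortion.\<close>
  let ?D = "\<lambda>y. det (gmat f (x, y))"
  have zOm: "(x, y) \<in> Om" if "y \<noteq> 0" for y using that x by (simp add: slit_over_def)
  have cont: "continuous_on (- {0}) ?D"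
    by (rule smooth_on_continuous[OF smooth_on_slice[OF smooth_det_gmat x]])
  have "\<exists>y0\<in>sphere 0 1. \<forall>y\<in>sphere 0 1. ?D y \<le> ?D y0"
    by (rule continuous_attains_sup) (auto intro: continuous_on_subset[OF cont])
  then obtain y0 where y0: "norm y0 = 1" "\<And>y. norm y = 1 \<Longrightarrow> ?D y \<le> ?D y0"
    by (auto simp: dist_norm)
  have y0n: "y0 \<noteq> 0" using y0(1) by auto
  have scale: "?D (t *\<^sub>R y) = ?D y" if "y \<noteq> 0" "t > 0" for t y
    by (simp only: gmat_scale[OF zOm[OF that(1)] that(2)])
  have F: "f (x, y0) > 0" by (rule f_pos[OF zOm[OF y0n]])
  \<comment> \<open>A dilation does not change det g; this one moves the maximum point to F = 1,
    where the stretch hypothesis is available.\<close>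
  define y1 where "y1 = (1 / f (x, y0)) *\<^sub>R y0"
  have y1n: "y1 \<noteq> 0" using y0n F by (simp add: y1_def)
  note z = zOm[OF y1n]
  have max: "?D y \<le> ?D y1" if "y \<noteq> 0" for y
  proof -
    have "?D y = ?D ((1 / norm y) *\<^sub>R y)" using scale[OF that, of "1 / norm y"] that by simp
    also have "\<dots> \<le> ?D y0" using that by (intro y0(2)) simp
    also have "\<dots> = ?D y1" unfolding y1_def using scale[OF y0n, of "1 / f (x, y0)"] F by simp
    finally show ?thesis .
  qed
  have "dY k (\<lambda>z. det (gmat f z)) (x, y1) = 0" for k
  proof -
    have der: "((\<lambda>t. ?D (y1 + t *\<^sub>R axis k 1)) has_real_derivative dY k (\<lambda>z. det (gmat f z)) (x, y1)) (at 0)"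
      using has_real_derivative_dd_line[of "\<lambda>z. det (gmat f z)" "(x, y1)" 0 "(0, axis k 1)"] diff_Om[OF smooth_det_gmat z]
      by (simp add: dY_eq_dd zero_prod_def[symmetric])
    show ?thesis
    \<comment> \<open>Steps shorter than \<open>norm y1\<close> cannot reach the origin, about which
      \<open>max\<close> says nothing.\<close>
    proof (rule DERIV_local_max[OF der, of "norm y1"])
      show "0 < norm y1" using y1n by simp
      show "\<forall>t. \<bar>0 - t\<bar> < norm y1 \<longrightarrow> ?D (y1 + t *\<^sub>R axis k 1) \<le> ?D (y1 + 0 *\<^sub>R axis k 1)"
      proof (intro allI impI)
        fix t assume t: "\<bar>0 - t\<bar> < norm y1"
        have "y1 + t *\<^sub>R axis k 1 \<noteq> 0"
        proof
          assume "y1 + t *\<^sub>R axis k 1 = 0"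
          then have "norm y1 = norm (t *\<^sub>R axis k 1 :: real ^ 'a)" by (metis add_eq_0_iff norm_minus_cancel)
          then show False using t by (simp add: norm_axis_1)
        qed
        then show "?D (y1 + t *\<^sub>R axis k 1) \<le> ?D (y1 + 0 *\<^sub>R axis k 1)" using max by simp
      qed
    qed
  qed
  then have "dY k \<tau> (x, y1) = 0" for k
    using dY_distortion[OF z] dY_det_gmat[OF z] det_gmat_pos[OF z] by simp
  moreover have "f (x, y1) = 1"
    unfolding y1_def using f_scale[OF x, of "1 / f (x, y0)" y0] F by simp
  ultimately show ?thesis using that z by blast
qed

text \<open>Homogeneity and a critical direction on each fibre make it enough to have the two
  curvature conditions, in their frame-free form, at F = 1. Linearity of S - c F in y comes from
  \<open>hessian_zero\<close>.\<close>

theorem almost_constant_chart: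
  assumes n: "CARD('a) \<ge> 2"
    and scalar: "\<And>z. z \<in> Om \<Longrightarrow> f z = 1 \<Longrightarrow> (\<Sum>j\<in>UNIV. \<Sum>k\<in>UNIV. ginv z $ j $ k * dY j (dY k Sh) z) = e"
    and stretch: "\<And>z a b. z \<in> Om \<Longrightarrow> f z = 1 \<Longrightarrow> (\<And>k. delta_y f k z a = 0) \<Longrightarrow> (\<And>k. delta_y f k z b = 0)
      \<Longrightarrow> ext_d Sh_form z a b = ext_d kap_form z a b"
  obtains \<xi> where "\<And>k. smooth_on U (\<xi> k)"
    "\<And>x y. (x, y) \<in> Om \<Longrightarrow> Sh (x, y) = 1 / (real CARD('a) - 1) * e * f (x, y) + (\<Sum>k\<in>UNIV. \<xi> k x * y $ k)"
    "\<And>x a b. x \<in> U \<Longrightarrow> ext_d (\<lambda>x a. \<Sum>k\<in>UNIV. \<xi> k x * a $ k) x a b = 0"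
proof -
  define c where "c = 1 / (real CARD('a) - 1) * e"
  have n1: "real CARD('a) - 1 > 0" using n by simp
  define h where "h z = Sh z - c * f z" for z
  have sh: "smooth_on Om h"
    unfolding h_def[abs_def] by (intro smooth_on_diff smooth_on_mult smooth_on_const open_Om smooth_Sh smooth_f)
  have hh: "homog U 1 h"
    unfolding h_def[abs_def] by (intro homog_diff homog_cmult homog_Sh homog_f)
  have dh: "dY k h z = dY k Sh z - c * dY k f z" if "z \<in> Om" for k z
  proof -
    note d = diff_Om[OF smooth_Sh that] diff_Om[OF smooth_f that]
    show ?thesis unfolding h_def[abs_def] dY_eq_dd using d by (simp add: dd_diff dd_cmult)
  qed
  \<comment> \<open>The trace is homogeneous of degree -1, which extends the equation from F = 1 to
    the whole fibre.\<close>
  have scalar': "(\<Sum>j\<in>UNIV. \<Sum>k\<in>UNIV. ginv z $ j $ k * dY j (dY k Sh) z) = e / f z" if z: "z \<in> Om" for z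
  proof -
    obtain x y where xy: "z = (x, y)" by (cases z)
    have x: "x \<in> U" using z xy by (simp add: slit_over_def)
    have F: "f (x, y) > 0" using f_pos[OF z] xy by simp
    define t where "t = 1 / f (x, y)"
    have t: "t > 0" using F by (simp add: t_def)
    let ?T = "\<lambda>z. \<Sum>j\<in>UNIV. \<Sum>k\<in>UNIV. ginv z $ j $ k * dY j (dY k Sh) z"
    have "homog U (0 + (1 - 1 - 1)) ?T"
      by (intro homog_sum homog_mult homog_ginv homog_dY smooth_on_dY smooth_Sh homog_Sh)
    then have "?T (x, t *\<^sub>R y) = t powr (- 1) * ?T (x, y)"
      using homogD[of U _ ?T x y t] z xy t by simp
    moreover have "?T (x, t *\<^sub>R y) = e"
      using z xy t f_scale[OF x t, of y] F by (intro scalar slit_over_scale) (auto simp: t_def)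
    ultimately have "e = f (x, y) * ?T (x, y)" using F by (simp add: t_def powr_minus_divide)
    then show ?thesis using F xy by simp
  qed
  interpret trace_free_function U f h
  proof unfold_locales
    fix z assume z: "z \<in> Om"
    have F: "f z > 0" by (rule f_pos[OF z])
    have "dY j (dY k h) z = dY j (dY k Sh) z - c * dY j (dY k f) z" for j k
    proof -
      have "dY j (dY k h) z = dY j (\<lambda>z. dY k Sh z - c * dY k f z) z"
        unfolding dY_eq_dd[of j] by (rule dd_cong[OF open_Om z dh])
      then show ?thesis
        unfolding dY_eq_dd[of j] using diff_Om[OF smooth_on_dY[OF smooth_Sh] z] diff_Om[OF smooth_on_dY[OF smooth_f] z]
        by (simp add: dd_diff dd_cmult)
    qed
    then have "(\<Sum>j\<in>UNIV. \<Sum>k\<in>UNIV. ginv z $ j $ k * dY j (dY k h) z)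
        = (\<Sum>j\<in>UNIV. \<Sum>k\<in>UNIV. ginv z $ j $ k * dY j (dY k Sh) z) - c * (\<Sum>j\<in>UNIV. \<Sum>k\<in>UNIV. ginv z $ j $ k * dY j (dY k f) z)"
      by (simp add: right_diff_distrib sum_subtractf sum_distrib_left mult.left_commute)
    then show "(\<Sum>j\<in>UNIV. \<Sum>k\<in>UNIV. ginv z $ j $ k * dY j (dY k h) z) = 0"
      unfolding scalar'[OF z] trace_hessian_f[OF z] using n1 F by (simp add: c_def field_simps)
  qed (fact sh, fact hh)
  obtain y0 :: "real ^ 'a" where y0: "y0 \<noteq> 0"
    using that[of "axis undefined 1"] by (simp add: axis_eq_0_iff)
  \<comment> \<open>The y-derivatives of \<open>h\<close> are constant on fibres because its Hessian
    vanishes, so any nonzero \<open>y0\<close> serves to evaluate them.\<close>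
  define \<xi> where "\<xi> k x = dY k h (x, y0)" for k x
  have fibre: "dY k h (x, y) = \<xi> k x" if "(x, y) \<in> Om" for k x y
    unfolding \<xi>_def
    by (rule constant_on_fibre[OF n smooth_on_dY[OF sh]]) (use that y0 hessian_zero in \<open>auto simp: slit_over_def\<close>)
  have s\<xi>: "smooth_on U (\<xi> k)" for k
    unfolding \<xi>_def[abs_def]
  proof (rule smooth_on_compose[OF smooth_on_dY[OF sh], of _ "\<lambda>x. (x, y0)"])
    have "smooth_on U (\<lambda>x. (x, 0) + (0, y0) :: 'a tb)"
      by (intro smooth_on_add smooth_on_const open_U smooth_on_linear[of "\<lambda>x. (x, 0)"] smooth_on_id)
        (auto intro: bounded_linear_Pair bounded_linear_zero bounded_linear_ident)
    then show "smooth_on U (\<lambda>x. (x, y0) :: 'a tb)" by simp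
  qed (use y0 in \<open>auto simp: slit_over_def\<close>)
  show ?thesis
  proof (rule that[of \<xi>])
    show "smooth_on U (\<xi> k)" for k by (rule s\<xi>)
    fix x y assume z: "(x, y) \<in> Om"
    have "(\<Sum>k\<in>UNIV. snd (x, y) $ k * dY k h (x, y)) = 1 * h (x, y)"
      by (rule euler_homog(2)[OF sh hh z])
    then show "Sh (x, y) = 1 / (real CARD('a) - 1) * e * f (x, y) + (\<Sum>k\<in>UNIV. \<xi> k x * y $ k)"
      by (simp add: fibre[OF z] h_def c_def mult.commute)
  next
    fix x a b assume x: "x \<in> U"
    obtain y where z: "(x, y) \<in> Om" and f1: "f (x, y) = 1" and crit: "\<And>k. dY k \<tau> (x, y) = 0"
      using critical_direction[OF x] by blast
    let ?z = "(x, y)"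
    have d\<xi>: "\<xi> k differentiable (at x)" for k by (rule smooth_on_differentiable[OF s\<xi> x])
    \<comment> \<open>By \<open>fibre\<close> the function \<open>dY j h\<close> is pulled back from
      the base, so a tangent vector acts on it through its projection alone.\<close>
    have hor: "dd (delta_x f i ?z) (dY j h) ?z = dd (axis i 1) (\<xi> j) x" for i j
    proof -
      have "dd (delta_x f i ?z) (dY j h) ?z = dd (delta_x f i ?z) (\<lambda>w. \<xi> j (fst w)) ?z"
        by (rule dd_cong[OF open_Om z]) (metis fibre prod.collapse)
      also have "\<dots> = dd (dd (delta_x f i ?z) fst ?z) (\<xi> j) x"
        using d\<xi> by (subst dd_compose) (auto simp: bounded_linear_imp_differentiable bounded_linear_fst)
      also have "\<dots> = dd (axis i 1) (\<xi> j) x"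
        by (simp add: dd_bounded_linear bounded_linear_fst delta_x_def)
      finally show ?thesis .
    qed
    \<comment> \<open>In the critical direction d \<open>kap_form\<close> vanishes on horizontal
      pairs; the stretch hypothesis transfers this to the y-derivatives of S, and
      \<open>delta_x_dY_f_sym\<close> takes care of the multiple of F.\<close>
    have sym: "dd (axis i 1) (\<xi> j) x = dd (axis j 1) (\<xi> i) x" for i j
    proof -
      let ?\<delta> = "\<lambda>i. delta_x f i ?z"
      have "ext_d Sh_form ?z (?\<delta> i) (?\<delta> j) = ext_d kap_form ?z (?\<delta> i) (?\<delta> j)"
        by (rule stretch[OF z f1]) (rule delta_y_delta_x)+
      also have "\<dots> = 0"
        by (rule ext_d_kap_form_horizontal[OF z crit]) (rule delta_y_delta_x)+
      finally have 0: "ext_d Sh_form ?z (?\<delta> i) (?\<delta> j) = 0" .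
      have Sf: "(\<lambda>w. Sh_form w (?\<delta> j)) = dY j Sh" for j
        by (simp add: fun_eq_iff Sh_form_def delta_x_def axis_def if_distrib cong: if_cong)
      have "dd (?\<delta> i) (dY j Sh) ?z = dd (?\<delta> j) (dY i Sh) ?z"
        using 0 unfolding ext_d_dd Sf by simp
      moreover have "dd (?\<delta> i) (dY j h) ?z = dd (?\<delta> i) (dY j Sh) ?z - c * dd (?\<delta> i) (dY j f) ?z" for i j
      proof -
        have "dd (?\<delta> i) (dY j h) ?z = dd (?\<delta> i) (\<lambda>z. dY j Sh z - c * dY j f z) ?z"
          by (rule dd_cong[OF open_Om z dh])
        then show ?thesis
          using diff_Om[OF smooth_on_dY[OF smooth_Sh] z] diff_Om[OF smooth_on_dY[OF smooth_f] z]
          by (simp add: dd_diff dd_cmult)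
      qed
      ultimately have "dd (?\<delta> i) (dY j h) ?z = dd (?\<delta> j) (dY i h) ?z"
        using delta_x_dY_f_sym[OF z, of i j] by simp
      then show ?thesis unfolding hor .
    qed
    have *: "dd a (\<lambda>x. \<Sum>k\<in>UNIV. \<xi> k x * b $ k) x = (\<Sum>k\<in>UNIV. \<Sum>i\<in>UNIV. a $ i * b $ k * dd (axis i 1) (\<xi> k) x)" for a b
    proof -
      have "dd a (\<xi> k) x = (\<Sum>i\<in>UNIV. a $ i * dd (axis i 1) (\<xi> k) x)" for k
        by (subst vec_eq_sum_axis[of a]) (simp add: dd_dir_sum[OF d\<xi>] dd_dir_scaleR[OF d\<xi>])
      moreover have "dd a (\<lambda>x. \<Sum>k\<in>UNIV. \<xi> k x * b $ k) x = (\<Sum>k\<in>UNIV. dd a (\<xi> k) x * b $ k)"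
        using d\<xi> by (simp add: dd_sum dd_mult)
      ultimately show ?thesis by (simp add: sum_distrib_left sum_distrib_right algebra_simps)
    qed
    have "(\<Sum>k\<in>UNIV. \<Sum>i\<in>UNIV. a $ i * b $ k * dd (axis i 1) (\<xi> k) x)
        = (\<Sum>k\<in>UNIV. \<Sum>i\<in>UNIV. b $ i * a $ k * dd (axis i 1) (\<xi> k) x)"
      by (subst sum.swap) (simp add: sym mult.commute)
    then show "ext_d (\<lambda>x a. \<Sum>k\<in>UNIV. \<xi> k x * a $ k) x a b = 0"
      unfolding ext_d_dd * by simp
  qed
qed

end

section \<open>Invariance under changes of charts\<close>

lemma dd_linear_compose:
  assumes "bounded_linear L" "g differentiable (at z)"
  shows "dd v (\<lambda>x. L (g x)) z = L (dd v g z)"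
  using assms by (subst dd_compose) (simp_all add: bounded_linear_imp_differentiable dd_bounded_linear)

lemma smooth_on_Pair:
  fixes a :: "'a::euclidean_space \<Rightarrow> 'b::euclidean_space" and b :: "'a \<Rightarrow> 'c::euclidean_space"
  assumes "smooth_on S a" "smooth_on S b"
  shows "smooth_on S (\<lambda>x. (a x, b x))"
proof -
  have "smooth_on S (\<lambda>x. (a x, 0) + (0, b x))"
    by (intro smooth_on_add smooth_on_linear[OF _ assms(1), of "\<lambda>v. (v, 0)"] smooth_on_linear[OF _ assms(2), of "\<lambda>v. (0, v)"]
        bounded_linear_Pair bounded_linear_zero bounded_linear_ident)
  then show ?thesis by simp
qed

context finsler_chart
begin

text \<open>Unlike the definition of the spray, its characterization by the Euler--Lagrange equations of \<open>F\<^sup>2\<close>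
  is visibly independent of the chart.\<close>

lemma euler_lagrange:
  assumes z: "z \<in> Om"
  shows "dd (snd z, b) (dY l f2) z - dX l f2 z = 2 * (\<Sum>k\<in>UNIV. gmat f z $ l $ k * (b $ k + 2 * spray f k z))"
proof -
  have "dX k (dY l f2) z = dY l (dX k f2) z" for k
    unfolding dX_eq_dd dY_eq_dd by (rule dd_commute[OF smooth_f2 z])
  then have "dd (snd z, b) (dY l f2) z = (\<Sum>k\<in>UNIV. dY l (dX k f2) z * snd z $ k) + (\<Sum>k\<in>UNIV. b $ k * dY k (dY l f2) z)"
    by (simp add: dd_tb[OF diff_Om[OF smooth_on_dY[OF smooth_f2] z]] mult.commute)
  moreover have "(\<Sum>k\<in>UNIV. b $ k * dY k (dY l f2) z) = 2 * (\<Sum>k\<in>UNIV. gmat f z $ l $ k * b $ k)"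
    unfolding sum_distrib_left by (intro sum.cong refl) (simp add: gmat_eq)
  moreover have "(\<Sum>k\<in>UNIV. gmat f z $ l $ k * (b $ k + 2 * spray f k z))
      = (\<Sum>k\<in>UNIV. gmat f z $ l $ k * b $ k) + 2 * (\<Sum>k\<in>UNIV. gmat f z $ l $ k * spray f k z)"
    by (simp add: distrib_left sum.distrib sum_distrib_left mult.left_commute)
  ultimately show ?thesis
    using gmat_spray[OF z, of l] by simp
qed

lemma euler_lagrange_spray:
  assumes "z \<in> Om"
  shows "dd (snd z, - 2 *\<^sub>R (\<chi> k. spray f k z)) (dY l f2) z = dX l f2 z"
  using euler_lagrange[OF assms, of "- 2 *\<^sub>R (\<chi> k. spray f k z)" l] by simp

text \<open>A second solution would differ from the spray by a nonzero vector in the kernel of g,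
  which is positive definite.\<close>

lemma euler_lagrange_unique:
  assumes z: "z \<in> Om" and "\<And>l. dd (snd z, b) (dY l f2) z = dX l f2 z"
  shows "b = - 2 *\<^sub>R (\<chi> k. spray f k z)"
proof (rule ccontr)
  assume b: "b \<noteq> - 2 *\<^sub>R (\<chi> k. spray f k z)"
  define w where "w = (\<chi> k. b $ k + 2 * spray f k z)"
  have "w \<noteq> 0" using b by (auto simp: w_def vec_eq_iff eq_neg_iff_add_eq_0)
  have "(\<Sum>k\<in>UNIV. gmat f z $ l $ k * w $ k) = 0" for l
    using euler_lagrange[OF z, of b l] assms(2)[of l] by (simp add: w_def)
  then have "(\<Sum>l\<in>UNIV. w $ l * (\<Sum>k\<in>UNIV. gmat f z $ l $ k * w $ k)) = 0" by simp
  then have "bil (gmat f z) w w = 0" by (simp add: bil_def sum_distrib_left algebra_simps)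
  then show False using gmat_pos[OF z \<open>w \<noteq> 0\<close>] by simp
qed

end

text \<open>Two coordinate expressions of the same metric and the same density, compared over the
  overlap \<open>S\<close> of two charts with transition map \<open>\<psi>\<close>.\<close>

locale chart_change = D: finsler_density U f s + D': finsler_density U' f' s'
  for U :: "(real ^ 'n::finite) set" and f s and U' :: "(real ^ 'n) set" and f' s' +
  fixes S :: "(real ^ 'n) set" and \<psi> :: "real ^ 'n \<Rightarrow> real ^ 'n"
  assumes S_sub: "S \<subseteq> U" and smooth_psi: "smooth_on S \<psi>" and psi_mem: "\<And>x. x \<in> S \<Longrightarrow> \<psi> x \<in> U'"
    and psi_inj: "\<And>x. x \<in> S \<Longrightarrow> inj (\<lambda>v. dd v \<psi> x)"
    and f_lift: "\<And>x y. x \<in> S \<Longrightarrow> f (x, y) = f' (\<psi> x, dd y \<psi> x)"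
    and s_lift: "\<And>x. x \<in> S \<Longrightarrow> s x = \<bar>det (matrix (\<lambda>v. dd v \<psi> x))\<bar> * s' (\<psi> x)"
begin

definition J :: "'n \<Rightarrow> 'n \<Rightarrow> real ^ 'n \<Rightarrow> real" where
  "J k l x = dd (axis l 1) \<psi> x $ k"

text \<open>The tangent map of \<open>\<psi>\<close>, that is, the transition map between the
  induced charts of the tangent bundle.\<close>

definition lift :: "'n tb \<Rightarrow> 'n tb" where
  "lift z = (\<psi> (fst z), dd (snd z) \<psi> (fst z))"

abbreviation "SO \<equiv> slit_over S"

lemma open_S: "open S" by (rule smooth_on_open[OF smooth_psi])

lemmas open_SO = open_slit_over[OF open_S]

lemma SO_Om: "z \<in> SO \<Longrightarrow> z \<in> slit_over U"
  using S_sub by (auto simp: slit_over_def)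

lemma SO_S: "z \<in> SO \<Longrightarrow> fst z \<in> S"
  by (simp add: slit_over_def)

lemma diff_psi: "x \<in> S \<Longrightarrow> \<psi> differentiable (at x)"
  by (rule smooth_on_differentiable[OF smooth_psi])

lemma smooth_J: "smooth_on S (J k l)"
  unfolding J_def[abs_def] by (intro smooth_on_vec_nth smooth_on_dd smooth_psi)

lemma diff_J: "x \<in> S \<Longrightarrow> J k l differentiable (at x)"
  by (rule smooth_on_differentiable[OF smooth_J])

lemma dd_psi:
  assumes "x \<in> S"
  shows "dd v \<psi> x $ k = (\<Sum>l\<in>UNIV. J k l x * v $ l)"
proof -
  note d = diff_psi[OF assms]
  have "dd v \<psi> x = (\<Sum>l\<in>UNIV. v $ l *\<^sub>R dd (axis l 1) \<psi> x)"
    by (subst vec_eq_sum_axis[of v]) (simp add: dd_dir_sum[OF d] dd_dir_scaleR[OF d])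
  then show ?thesis by (simp add: J_def mult.commute)
qed

lemma dJ_sym:
  assumes x: "x \<in> S"
  shows "dd (axis p 1) (J k l) x = dd (axis l 1) (J k p) x"
proof -
  have "J k l y = dd (axis l 1) (\<lambda>x. \<psi> x $ k) y" if "y \<in> S" for l y
    unfolding J_def by (rule dd_linear_compose[OF bounded_linear_vec_nth diff_psi[OF that], symmetric])
  then have "dd v (J k l) x = dd v (dd (axis l 1) (\<lambda>x. \<psi> x $ k)) x" for v l
    by (rule dd_cong[OF open_S x])
  then show ?thesis
    by (simp add: dd_commute[OF smooth_on_vec_nth[OF smooth_psi] x, of "axis p 1"])
qed

lemma smooth_fst_SO: "smooth_on S h \<Longrightarrow> smooth_on SO (\<lambda>z. h (fst z))"
  by (rule smooth_on_compose[OF _ smooth_on_linear[OF bounded_linear_fst smooth_on_id[OF open_SO]]])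
    (auto simp: slit_over_def)

lemma dd_fst:
  assumes "h differentiable (at (fst z))"
  shows "dd v (\<lambda>z. h (fst z)) z = dd (fst v) h (fst z)"
  using assms by (subst dd_compose) (simp_all add: bounded_linear_imp_differentiable bounded_linear_fst dd_bounded_linear)

lemma smooth_lift: "smooth_on SO lift"
proof -
  have "smooth_on SO (\<lambda>z. (\<psi> (fst z), \<chi> k. \<Sum>l\<in>UNIV. J k l (fst z) * snd z $ l))"
  proof (intro smooth_on_Pair smooth_fst_SO smooth_psi smooth_on_vec open_SO)
    show "smooth_on SO (\<lambda>z. (\<chi> k. \<Sum>l\<in>UNIV. J k l (fst z) * snd z $ l) $ k)" for k
      unfolding vec_lambda_beta
      by (intro smooth_on_sum smooth_on_mult smooth_fst_SO smooth_J smooth_on_coord open_SO)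
  qed
  then show ?thesis
    by (rule smooth_on_congI) (simp add: lift_def vec_eq_iff dd_psi SO_S)
qed

lemma diff_lift: "z \<in> SO \<Longrightarrow> lift differentiable (at z)"
  by (rule smooth_on_differentiable[OF smooth_lift])

lemma lift_mem:
  assumes z: "z \<in> SO"
  shows "lift z \<in> slit_over U'"
proof -
  note x = SO_S[OF z]
  have "dd (snd z) \<psi> (fst z) \<noteq> dd 0 \<psi> (fst z)"
    using psi_inj[OF x] z by (auto simp: slit_over_def dest: injD)
  then show ?thesis
    using psi_mem[OF x] by (simp add: lift_def slit_over_def dd_dir_zero[OF diff_psi[OF x]])
qed

lemma dd_lift:
  assumes z: "z \<in> SO"
  shows "dd v lift z = (dd (fst v) \<psi> (fst z),
    \<chi> k. \<Sum>l\<in>UNIV. J k l (fst z) * snd v $ l + dd (fst v) (J k l) (fst z) * snd z $ l)"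
proof (rule prod_eqI)
  note x = SO_S[OF z]
  have "fst (dd v lift z) = dd v (\<lambda>z. fst (lift z)) z"
    by (rule dd_linear_compose[OF bounded_linear_fst diff_lift[OF z], symmetric])
  also have "\<dots> = dd (fst v) \<psi> (fst z)"
    unfolding lift_def fst_conv by (rule dd_fst[OF diff_psi[OF x]])
  finally show "fst (dd v lift z) = fst (dd (fst v) \<psi> (fst z),
    \<chi> k. \<Sum>l\<in>UNIV. J k l (fst z) * snd v $ l + dd (fst v) (J k l) (fst z) * snd z $ l)" by simp
  have "snd (dd v lift z) $ k = (\<Sum>l\<in>UNIV. J k l (fst z) * snd v $ l + dd (fst v) (J k l) (fst z) * snd z $ l)" for k
  proof -
    have bl: "bounded_linear (\<lambda>w :: 'n tb. snd w $ k)"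
      by (rule bounded_linear_compose[OF bounded_linear_vec_nth bounded_linear_snd])
    have "snd (dd v lift z) $ k = dd v (\<lambda>z. snd (lift z) $ k) z"
      by (rule dd_linear_compose[OF bl diff_lift[OF z], symmetric])
    also have "\<dots> = dd v (\<lambda>z. \<Sum>l\<in>UNIV. J k l (fst z) * snd z $ l) z"
      by (rule dd_cong[OF open_SO z]) (simp add: lift_def dd_psi SO_S)
    also have "\<dots> = (\<Sum>l\<in>UNIV. J k l (fst z) * snd v $ l + dd (fst v) (J k l) (fst z) * snd z $ l)"
    proof -
      have d: "(\<lambda>z. J k l (fst z)) differentiable (at z)" "(\<lambda>z. snd z $ l) differentiable (at z)" for l
        using smooth_on_differentiable[OF smooth_fst_SO[OF smooth_J] z] smooth_on_differentiable[OF smooth_on_coord[OF open_SO] z]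
        by auto
      have c: "dd v (\<lambda>z. snd z $ l) z = snd v $ l" for l
        using dd_coord[of "fst v" "snd v" l z] by simp
      show ?thesis
        by (subst dd_sum) (simp_all add: d dd_mult dd_fst[OF diff_J[OF x]] c)
    qed
    finally show ?thesis .
  qed
  then show "snd (dd v lift z) = snd (dd (fst v) \<psi> (fst z),
    \<chi> k. \<Sum>l\<in>UNIV. J k l (fst z) * snd v $ l + dd (fst v) (J k l) (fst z) * snd z $ l)"
    by (simp add: vec_eq_iff)
qed

lemma smooth_comp_lift: "smooth_on (slit_over U') h \<Longrightarrow> smooth_on SO (\<lambda>z. h (lift z))"
  by (rule smooth_on_compose[OF _ smooth_lift]) (auto intro: lift_mem)

lemma dd_comp_lift:
  assumes "smooth_on (slit_over U') h" "z \<in> SO"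
  shows "dd v (\<lambda>z. h (lift z)) z = dd (dd v lift z) h (lift z)"
  by (rule dd_compose[OF diff_lift[OF assms(2)] smooth_on_differentiable[OF assms(1) lift_mem[OF assms(2)]]])

lemma f2_lift: "z \<in> SO \<Longrightarrow> D.f2 z = D'.f2 (lift z)"
  using f_lift[of "fst z" "snd z"] SO_S by (simp add: lift_def)

lemma dd_lift_vertical:
  assumes z: "z \<in> SO"
  shows "dd (0, axis l 1) lift z = (0, \<chi> k. J k l (fst z))"
proof -
  note x = SO_S[OF z]
  have "(\<Sum>i\<in>UNIV. J k i (fst z) * axis l 1 $ i) = J k l (fst z)" for k
    by (simp add: axis_def if_distrib cong: if_cong)
  then show ?thesis
    by (simp add: dd_lift[OF z] dd_dir_zero diff_psi[OF x] diff_J[OF x])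
qed

lemma dY_f2_lift:
  assumes z: "z \<in> SO"
  shows "dY l D.f2 z = (\<Sum>k\<in>UNIV. J k l (fst z) * dY k D'.f2 (lift z))"
proof -
  have "dY l D.f2 z = dd (0, axis l 1) (\<lambda>z. D'.f2 (lift z)) z"
    unfolding dY_eq_dd by (rule dd_cong[OF open_SO z f2_lift])
  also have "\<dots> = (\<Sum>k\<in>UNIV. J k l (fst z) * dY k D'.f2 (lift z))"
    unfolding dd_comp_lift[OF D'.smooth_f2 z] dd_lift_vertical[OF z]
    by (simp add: dd_vertical D'.diff_Om[OF D'.smooth_f2 lift_mem[OF z]])
  finally show ?thesis .
qed

lemma dd_dY_f2_lift:
  assumes z: "z \<in> SO"
  shows "dd v (dY l D.f2) z = (\<Sum>k\<in>UNIV. J k l (fst z) * dd (dd v lift z) (dY k D'.f2) (lift z))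
     + (\<Sum>k\<in>UNIV. dd (fst v) (J k l) (fst z) * dY k D'.f2 (lift z))"
proof -
  note x = SO_S[OF z]
  have s: "smooth_on (slit_over U') (dY k D'.f2)" for k by (intro smooth_on_dY D'.smooth_f2)
  have d: "(\<lambda>z. J k l (fst z)) differentiable (at z)" "(\<lambda>z. dY k D'.f2 (lift z)) differentiable (at z)" for k
    using smooth_on_differentiable[OF smooth_fst_SO[OF smooth_J] z] smooth_on_differentiable[OF smooth_comp_lift[OF s] z]
    by auto
  have "dd v (dY l D.f2) z = dd v (\<lambda>z. \<Sum>k\<in>UNIV. J k l (fst z) * dY k D'.f2 (lift z)) z"
    by (rule dd_cong[OF open_SO z dY_f2_lift])
  also have "\<dots> = (\<Sum>k\<in>UNIV. J k l (fst z) * dd (dd v lift z) (dY k D'.f2) (lift z)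
      + dd (fst v) (J k l) (fst z) * dY k D'.f2 (lift z))"
    by (subst dd_sum) (simp_all add: d dd_mult dd_comp_lift[OF s z] dd_fst[OF diff_J[OF x]])
  finally show ?thesis by (simp add: sum.distrib)
qed

lemma det_psi: "x \<in> S \<Longrightarrow> det (matrix (\<lambda>v. dd v \<psi> x)) \<noteq> 0"
  using psi_inj linear_dd[OF diff_psi] by (simp add: det_nz_iff_inj)

text \<open>The tangent map is linear on fibres, so the second y-derivatives of F^2 transform as a
  tensor, without derivatives of the Jacobian.\<close>

lemma gmat_lift:
  assumes z: "z \<in> SO"
  shows "gmat f z = transpose (matrix (\<lambda>v. dd v \<psi> (fst z))) ** gmat f' (lift z) ** matrix (\<lambda>v. dd v \<psi> (fst z))"
proof -
  note x = SO_S[OF z]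
  have "gmat f z $ l $ m = (\<Sum>p\<in>UNIV. (\<Sum>k\<in>UNIV. J k l (fst z) * gmat f' (lift z) $ k $ p) * J p m (fst z))" for l m
  proof -
    have "dY m (dY l D.f2) z = (\<Sum>k\<in>UNIV. J k l (fst z) * (\<Sum>p\<in>UNIV. J p m (fst z) * dY p (dY k D'.f2) (lift z)))"
      unfolding dY_eq_dd[of m] dd_dY_f2_lift[OF z] dd_lift_vertical[OF z]
      by (simp add: dd_vertical D'.diff_Om[OF smooth_on_dY[OF D'.smooth_f2] lift_mem[OF z]] dd_dir_zero[OF diff_J[OF x]])
    then have "gmat f z $ l $ m = (\<Sum>k\<in>UNIV. \<Sum>p\<in>UNIV. J k l (fst z) * gmat f' (lift z) $ k $ p * J p m (fst z))"
      by (simp add: D.gmat_eq D'.gmat_eq sum_distrib_left mult.assoc mult.left_commute[of "_ / 2"] mult.commute[of "dY _ _ _"] sum_divide_distrib)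
    also have "\<dots> = (\<Sum>p\<in>UNIV. \<Sum>k\<in>UNIV. J k l (fst z) * gmat f' (lift z) $ k $ p * J p m (fst z))"
      by (rule sum.swap)
    finally show ?thesis by (simp add: sum_distrib_right)
  qed
  then show ?thesis
    by (simp add: vec_eq_iff matrix_matrix_mult_def transpose_def matrix_def J_def)
qed

text \<open>The square root of det g and the density acquire the same factor, the absolute value of
  the Jacobian determinant.\<close>

lemma distortion_lift:
  assumes z: "z \<in> SO"
  shows "distortion f s z = distortion f' s' (lift z)"
proof -
  note x = SO_S[OF z]
  let ?d = "det (matrix (\<lambda>v. dd v \<psi> (fst z)))"
  have "det (gmat f z) = ?d\<^sup>2 * det (gmat f' (lift z))"
    by (simp add: gmat_lift[OF z] det_mul det_transpose power2_eq_square)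
  then have "sqrt (det (gmat f z)) = \<bar>?d\<bar> * sqrt (det (gmat f' (lift z)))"
    by (simp add: real_sqrt_mult)
  then show ?thesis
    using det_psi[OF x] by (simp add: distortion_def s_lift[OF x] lift_def)
qed

text \<open>The tangent map preserves the Euler-Lagrange equations: the second derivatives of the
  transition map that appear on both sides cancel by symmetry (\<open>dJ_sym\<close>). Then
  \<open>euler_lagrange_unique\<close> identifies the image of the spray.\<close>

lemma spray_lift:
  assumes z: "z \<in> SO"
  shows "dd (snd z, - 2 *\<^sub>R (\<chi> k. spray f k z)) lift z = (snd (lift z), - 2 *\<^sub>R (\<chi> k. spray f' k (lift z)))"
proof -
  note x = SO_S[OF z]
  define v where "v = (snd z, - 2 *\<^sub>R (\<chi> k. spray f k z))"
  define b where "b = snd (dd v lift z)"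
  have fv: "fst v = snd z" by (simp add: v_def)
  have lv: "dd v lift z = (snd (lift z), b)"
    by (simp add: b_def prod_eq_iff dd_lift[OF z] fv lift_def)
  have dJ: "dd (snd z) (J k l) (fst z) = (\<Sum>p\<in>UNIV. dd (axis l 1) (J k p) (fst z) * snd z $ p)" for k l
  proof -
    note d = diff_J[OF x, of k l]
    have "dd (snd z) (J k l) (fst z) = (\<Sum>p\<in>UNIV. snd z $ p * dd (axis p 1) (J k l) (fst z))"
      by (subst vec_eq_sum_axis[of "snd z"]) (simp add: dd_dir_sum[OF d] dd_dir_scaleR[OF d])
    then show ?thesis by (simp add: dJ_sym[OF x, of _ k l] mult.commute)
  qed
  \<comment> \<open>The Euler-Lagrange residual of the image vector. The equation in the first chart
    says that the transposed Jacobian annihilates it, and that matrix is invertible.\<close>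
  define T where "T = (\<chi> k. dd (dd v lift z) (dY k D'.f2) (lift z) - dX k D'.f2 (lift z))"
  have "(\<Sum>k\<in>UNIV. J k l (fst z) * T $ k) = 0" for l
  proof -
    have "dX l D.f2 z = dd (axis l 1, 0) (\<lambda>z. D'.f2 (lift z)) z"
      unfolding dX_eq_dd by (rule dd_cong[OF open_SO z f2_lift])
    also have "\<dots> = dd (dd (axis l 1) \<psi> (fst z), \<chi> k. \<Sum>p\<in>UNIV. dd (axis l 1) (J k p) (fst z) * snd z $ p) D'.f2 (lift z)"
      by (simp add: dd_comp_lift[OF D'.smooth_f2 z] dd_lift[OF z])
    also have "\<dots> = (\<Sum>k\<in>UNIV. J k l (fst z) * dX k D'.f2 (lift z))
        + (\<Sum>k\<in>UNIV. dd (snd z) (J k l) (fst z) * dY k D'.f2 (lift z))"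
      by (simp add: dd_tb[OF D'.diff_Om[OF D'.smooth_f2 lift_mem[OF z]]] J_def[symmetric] dJ)
    finally have "dX l D.f2 z = (\<Sum>k\<in>UNIV. J k l (fst z) * dX k D'.f2 (lift z))
        + (\<Sum>k\<in>UNIV. dd (snd z) (J k l) (fst z) * dY k D'.f2 (lift z))" .
    moreover have "dd v (dY l D.f2) z = dX l D.f2 z"
      unfolding v_def by (rule D.euler_lagrange_spray[OF SO_Om[OF z]])
    ultimately have "(\<Sum>k\<in>UNIV. J k l (fst z) * dd (dd v lift z) (dY k D'.f2) (lift z))
        = (\<Sum>k\<in>UNIV. J k l (fst z) * dX k D'.f2 (lift z))"
      using dd_dY_f2_lift[OF z, of v l] by (simp add: fv)
    then show ?thesis by (simp add: T_def right_diff_distrib sum_subtractf)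
  qed
  then have "transpose (matrix (\<lambda>v. dd v \<psi> (fst z))) *v T = 0"
    by (simp add: vec_eq_iff matrix_vector_mult_def transpose_def matrix_def J_def)
  moreover have "invertible (transpose (matrix (\<lambda>v. dd v \<psi> (fst z))))"
    using det_psi[OF x] by (simp add: invertible_det_nz det_transpose)
  ultimately have "T = 0"
    by (metis invertible_def matrix_vector_mul_assoc matrix_vector_mul_lid matrix_vector_mult_0_right)
  then have "dd (snd (lift z), b) (dY k D'.f2) (lift z) = dX k D'.f2 (lift z)" for k
    unfolding lv[symmetric] by (simp add: T_def vec_eq_iff)
  then have "b = - 2 *\<^sub>R (\<chi> k. spray f' k (lift z))"
    by (rule D'.euler_lagrange_unique[OF lift_mem[OF z]])
  then show ?thesis using lv by (simp add: v_def)
qed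

text \<open>The function is the derivative of the distortion along the spray, and both are
  invariant. This makes the local one-forms agree on overlaps.\<close>

lemma Sh_lift:
  assumes z: "z \<in> SO"
  shows "D.Sh z = D'.Sh (lift z)"
proof -
  have "D.Sh z = dd (snd z, - 2 *\<^sub>R (\<chi> k. spray f k z)) (\<lambda>z. distortion f' s' (lift z)) z"
    unfolding D.Sh_eq_dd_spray[OF SO_Om[OF z]] by (rule dd_cong[OF open_SO z distortion_lift])
  also have "\<dots> = D'.Sh (lift z)"
    unfolding dd_comp_lift[OF D'.smooth_distortion z] spray_lift[OF z] D'.Sh_eq_dd_spray[OF lift_mem[OF z]] ..
  finally show ?thesis .
qed

end

section \<open>Charts and tangent vectors\<close>

locale atlas =
  fixes X :: "'m topology" and A :: "('m, 'n::finite) chart set"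
  assumes manifold: "smooth_manifold X A"
begin

definition overlap :: "('m, 'n) chart \<Rightarrow> ('m, 'n) chart \<Rightarrow> (real ^ 'n) set" where
  "overlap c c' = snd c ` (fst c \<inter> fst c')"

lemma chart_sub: "c \<in> A \<Longrightarrow> fst c \<subseteq> topspace X"
  using manifold openin_subset by (auto simp: smooth_manifold_def)

lemma chart_inj:
  assumes "c \<in> A"
  shows "inj_on (snd c) (fst c)"
proof -
  have "homeomorphic_map (subtopology X (fst c)) (top_of_set (chart_image c)) (snd c)"
    using manifold assms by (auto simp: smooth_manifold_def)
  then have "inj_on (snd c) (topspace (subtopology X (fst c)))"
    by (simp add: homeomorphic_map_def)
  then show ?thesis using chart_sub[OF assms] by (simp add: inf.absorb2)
qed

lemma chart_open: "c \<in> A \<Longrightarrow> open (chart_image c)"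
  using manifold by (auto simp: smooth_manifold_def)

lemma smooth_transition: "c \<in> A \<Longrightarrow> c' \<in> A \<Longrightarrow> smooth_on (overlap c c') (transition c c')"
  using manifold by (auto simp: smooth_manifold_def overlap_def)

lemma chart_inv_snd: "c \<in> A \<Longrightarrow> p \<in> fst c \<Longrightarrow> chart_inv c (snd c p) = p"
  unfolding chart_inv_def by (rule inv_into_f_f[OF chart_inj])

lemma chart_inv_mem: "x \<in> chart_image c \<Longrightarrow> chart_inv c x \<in> fst c"
  unfolding chart_image_def chart_inv_def by (rule inv_into_into)

lemma snd_chart_inv: "x \<in> chart_image c \<Longrightarrow> snd c (chart_inv c x) = x"
  unfolding chart_image_def chart_inv_def by (rule f_inv_into_f)

lemma snd_mem_chart_image: "p \<in> fst c \<Longrightarrow> snd c p \<in> chart_image c"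
  by (simp add: chart_image_def)

lemma transition_snd: "c \<in> A \<Longrightarrow> p \<in> fst c \<Longrightarrow> transition c c' (snd c p) = snd c' p"
  by (simp add: transition_def chart_inv_snd)

lemma jacobian_dd: "jacobian c c' p v = dd v (transition c c') (snd c p)"
  by (simp add: jacobian_def dd_def)

lemma overlap_mem: "p \<in> fst c \<Longrightarrow> p \<in> fst c' \<Longrightarrow> snd c p \<in> overlap c c'"
  by (simp add: overlap_def)

lemma diff_transition:
  "c \<in> A \<Longrightarrow> c' \<in> A \<Longrightarrow> p \<in> fst c \<Longrightarrow> p \<in> fst c' \<Longrightarrow> transition c c' differentiable (at (snd c p))"
  by (rule smooth_on_differentiable[OF smooth_transition overlap_mem])

lemma linear_jacobian:
  assumes "c \<in> A" "c' \<in> A" "p \<in> fst c" "p \<in> fst c'"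
  shows "linear (jacobian c c' p)"
  using linear_dd[OF diff_transition[OF assms]] by (simp add: jacobian_dd[abs_def])

lemma jacobian_self:
  assumes "c \<in> A" "p \<in> fst c"
  shows "jacobian c c p v = v"
proof -
  have "jacobian c c p v = dd v (\<lambda>x. x) (snd c p)"
    unfolding jacobian_dd
    by (rule dd_cong[OF chart_open[OF assms(1)] snd_mem_chart_image[OF assms(2)]]) (simp add: transition_def snd_chart_inv)
  then show ?thesis by (simp add: dd_bounded_linear bounded_linear_ident)
qed

lemma jacobian_compose:
  assumes c: "c \<in> A" "c' \<in> A" "c'' \<in> A" and p: "p \<in> fst c" "p \<in> fst c'" "p \<in> fst c''"
  shows "jacobian c' c'' p (jacobian c c' p v) = jacobian c c'' p v"
proof -
  have op: "open (overlap c c' \<inter> overlap c c'')"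
    using smooth_on_open[OF smooth_transition] c by (intro open_Int) auto
  have eq: "transition c' c'' (transition c c' x) = transition c c'' x" if "x \<in> overlap c c' \<inter> overlap c c''" for x
  proof -
    obtain q q' where q: "q \<in> fst c" "q \<in> fst c'" "x = snd c q" "q' \<in> fst c" "q' \<in> fst c''" "x = snd c q'"
      using \<open>x \<in> overlap c c' \<inter> overlap c c''\<close> by (auto simp: overlap_def)
    then show ?thesis using c by (simp add: transition_snd)
  qed
  have "jacobian c c'' p v = dd v (\<lambda>x. transition c' c'' (transition c c' x)) (snd c p)"
    unfolding jacobian_dd using p by (intro dd_cong[OF op, symmetric] eq) (simp_all add: overlap_mem)
  also have "\<dots> = dd (dd v (transition c c') (snd c p)) (transition c' c'') (transition c c' (snd c p))"
    using diff_transition[OF c(1,2) p(1,2)] diff_transition[OF c(2,3) p(2,3)] c p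
    by (intro dd_compose) (simp_all add: transition_snd)
  finally show ?thesis using c p by (simp add: jacobian_dd transition_snd)
qed

lemma coord_vec_apply: "c' \<in> A \<Longrightarrow> p \<in> fst c' \<Longrightarrow> coord_vec A c p y c' = jacobian c c' p y"
  by (simp add: coord_vec_def)

lemma coord_vec_jacobian:
  assumes "c \<in> A" "c' \<in> A" "p \<in> fst c" "p \<in> fst c'"
  shows "coord_vec A c' p (jacobian c c' p y) = coord_vec A c p y"
  using assms jacobian_compose by (auto simp: coord_vec_def fun_eq_iff)

lemma coord_vec_tangent:
  assumes "c \<in> A" "p \<in> fst c"
  shows "coord_vec A c p y \<in> tangent_space A p"
  using assms jacobian_compose by (auto simp: tangent_space_def coord_vec_def)

lemma coord_vec_scale:
  assumes "c \<in> A" "p \<in> fst c"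
  shows "coord_vec A c p (t *\<^sub>R y) = (\<lambda>c'. t *\<^sub>R coord_vec A c p y c')"
  using assms by (auto simp: coord_vec_def fun_eq_iff linear_scale[OF linear_jacobian])

lemma slit_eq: "slit c = slit_over (chart_image c)"
  by (simp add: slit_def slit_over_def)

section \<open>From the manifold to its coordinate expressions\<close>

lemma finsler_density_chart:
  assumes F: "finsler_metric X A F" and \<sigma>: "positive_density A \<sigma>" and c: "c \<in> A"
  shows "finsler_density (chart_image c) (rep A F c) (\<sigma> c)"
proof unfold_locales
  show "open (chart_image c)" by (rule chart_open[OF c])
  show "smooth_on (slit_over (chart_image c)) (rep A F c)"
    using F c by (simp add: finsler_metric_def slit_eq)
  show "continuous_on (chart_image c \<times> UNIV) (rep A F c)"
    using F c by (simp add: finsler_metric_def)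
  show "bil (gmat (rep A F c) z) w w > 0" if "z \<in> slit_over (chart_image c)" "w \<noteq> 0" for z w
    using F c that by (simp add: finsler_metric_def slit_eq bil_def)
  have top: "chart_inv c x \<in> topspace X" and vec: "coord_vec A c (chart_inv c x) y \<in> tangent_space A (chart_inv c x)"
    if "x \<in> chart_image c" for x y
    using chart_inv_mem[OF that] chart_sub[OF c] coord_vec_tangent[OF c] by auto
  show "rep A F c (x, t *\<^sub>R y) = t * rep A F c (x, y)" if "x \<in> chart_image c" "t > 0" for x y t
    using F top[OF that(1)] vec[OF that(1), of y] that(2)
    by (simp add: rep_def coord_vec_scale[OF c chart_inv_mem[OF that(1)]] finsler_metric_def)
  show "rep A F c z \<ge> 0" if "z \<in> slit_over (chart_image c)" for z
    using F top[of "fst z"] vec[of "fst z" "snd z"] that by (simp add: rep_def slit_over_def finsler_metric_def)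
  show "smooth_on (chart_image c) (\<sigma> c)" "\<And>x. x \<in> chart_image c \<Longrightarrow> \<sigma> c x > 0"
    using \<sigma> c by (auto simp: positive_density_def)
qed

lemma rep_transition:
  assumes c: "c \<in> A" "c' \<in> A" "p \<in> fst c" "p \<in> fst c'"
  shows "rep A F c (snd c p, y) = rep A F c' (snd c' p, jacobian c c' p y)"
  using c by (simp add: rep_def chart_inv_snd coord_vec_jacobian)

lemma chart_change_transition:
  assumes F: "finsler_metric X A F" and \<sigma>: "positive_density A \<sigma>" and c: "c \<in> A" "c' \<in> A"
  shows "chart_change (chart_image c) (rep A F c) (\<sigma> c) (chart_image c') (rep A F c') (\<sigma> c')
    (overlap c c') (transition c c')"
proof (intro chart_change.intro finsler_density_chart[OF F \<sigma>] c chart_change_axioms.intro)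
  show "overlap c c' \<subseteq> chart_image c" by (auto simp: overlap_def chart_image_def)
  show "smooth_on (overlap c c') (transition c c')" by (rule smooth_transition[OF c])
  fix x assume "x \<in> overlap c c'"
  then obtain p where p: "p \<in> fst c" "p \<in> fst c'" "x = snd c p" by (auto simp: overlap_def)
  note t = transition_snd[OF c(1) p(1), of c']
  show "transition c c' x \<in> chart_image c'" using p t by (simp add: snd_mem_chart_image)
  have "inj (jacobian c c' p)"
    by (rule inj_on_inverseI[of _ "jacobian c' c p"]) (use c p in \<open>simp add: jacobian_compose jacobian_self\<close>)
  then show "inj (\<lambda>v. dd v (transition c c') x)" by (simp add: jacobian_dd[abs_def] p)
  show "rep A F c (x, y) = rep A F c' (transition c c' x, dd y (transition c c') x)" for y
    using rep_transition[OF c p(1,2), of F y] t by (simp add: p(3) jacobian_dd)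
  show "\<sigma> c x = \<bar>det (matrix (\<lambda>v. dd v (transition c c') x))\<bar> * \<sigma> c' (transition c c' x)"
  proof -
    have "\<sigma> c (snd c p) = \<bar>det (matrix (jacobian c c' p))\<bar> * \<sigma> c' (snd c' p)"
      using \<sigma> c p unfolding positive_density_def by blast
    then show ?thesis unfolding p(3) t jacobian_dd[abs_def] .
  qed
qed

end

section \<open>Almost constant S-curvature\<close>

theorem theorem2:
  fixes X :: "'m topology"
    and A :: "('m, 'n::finite) chart set"
    and F :: "'m \<Rightarrow> ('m, 'n) tvec \<Rightarrow> real"
    and \<sigma> :: "('m, 'n) chart \<Rightarrow> real ^ 'n \<Rightarrow> real"
    and m :: 'n
    and e :: real
  assumes "CARD('n) \<ge> 2"
    and "smooth_manifold X A"
    and "finsler_metric X A F"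
    and "positive_density A \<sigma>"
    and "berwald_scalar_constant m A F e"
    and "mean_stretch_vanishes m A F"
  shows "\<exists>\<xi>. smooth_one_form X A \<xi> \<and> closed_one_form A \<xi> \<and>
    (\<forall>c\<in>A. \<forall>z\<in>sphere_bundle A F c.
       S_curvature (rep A F c) (\<sigma> c) z =
         1 / (real CARD('n) - 1) * e + pullback_form (rep_form A \<xi> c) z (reeb (rep A F c) z))"
proof -
  interpret atlas X A by unfold_locales (rule assms(2))
  define C where "C = 1 / (real CARD('n) - 1) * e"
  define ShC where "ShC c = finsler_density.Sh (rep A F c) (\<sigma> c)" for c
  \<comment> \<open>Collects what \<open>almost_constant_chart\<close> yields in one chart, so that
    one form can be chosen for each chart.\<close>
  define P where "P c \<xi> \<longleftrightarrow> (\<forall>k. smooth_on (chart_image c) (\<xi> k)) \<and>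
      (\<forall>x y. (x, y) \<in> slit_over (chart_image c) \<longrightarrow> ShC c (x, y) = C * rep A F c (x, y) + (\<Sum>k\<in>UNIV. \<xi> k x * y $ k)) \<and>
      (\<forall>x\<in>chart_image c. \<forall>a b. ext_d (\<lambda>x a. \<Sum>k\<in>UNIV. \<xi> k x * a $ k) x a b = 0)" for c \<xi>
  have "\<exists>\<xi>. P c \<xi>"
    if c: "c \<in> A" for c
  proof -
    let ?f = "rep A F c"
    interpret finsler_density "chart_image c" ?f "\<sigma> c"
      by (rule finsler_density_chart[OF assms(3,4) c])
    have sphere: "z \<in> sphere_bundle A F c" if "z \<in> Om" "?f z = 1" for z
      using that by (simp add: sphere_bundle_def slit_eq)
    have scalar: "(\<Sum>j\<in>UNIV. \<Sum>k\<in>UNIV. ginv z $ j $ k * dY j (dY k Sh) z) = e"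
      if z: "z \<in> Om" "?f z = 1" for z
    proof -
      obtain W u where u: "adapted_frame m ?f W u" "W \<subseteq> Om" "z \<in> W"
        using adapted_frame_exists[OF z(1)] by blast
      interpret finsler_density_frame "chart_image c" ?f m W u "\<sigma> c" by unfold_locales (use u in auto)
      have "berwald_scalar m ?f u z = e"
        using assms(5) c u sphere[OF z] unfolding berwald_scalar_constant_def slit_eq by blast
      then show ?thesis using berwald_scalar_eq[OF u(3)] z(2) by simp
    qed
    have stretch: "ext_d Sh_form z a b = ext_d kap_form z a b"
      if z: "z \<in> Om" "?f z = 1" and hor: "\<And>k. delta_y ?f k z a = 0" "\<And>k. delta_y ?f k z b = 0" for z a b
    proof -
      obtain W u where u: "adapted_frame m ?f W u" "W \<subseteq> Om" "z \<in> W"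
        using adapted_frame_exists[OF z(1)] by blast
      interpret finsler_density_frame "chart_image c" ?f m W u "\<sigma> c" by unfold_locales (use u in auto)
      have "mean_stretch m ?f u z a b = 0" for a b
        using assms(6) c u sphere[OF z] unfolding mean_stretch_vanishes_def slit_eq by blast
      then have "ext_d Sh_form z (e_h ?f u p z) (e_h ?f u q z) = ext_d kap_form z (e_h ?f u p z) (e_h ?f u q z)" for p q
        using mean_stretch_e_h[OF u(3), of p q] by simp
      then show ?thesis
        by (rule ext_d_horizontal_eq[OF u(3) form_Sh_form form_kap_form z(1) _ hor])
    qed
    obtain \<xi> where "\<And>k. smooth_on (chart_image c) (\<xi> k)"
      "\<And>x y. (x, y) \<in> Om \<Longrightarrow> Sh (x, y) = 1 / (real CARD('n) - 1) * e * ?f (x, y) + (\<Sum>k\<in>UNIV. \<xi> k x * y $ k)"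
      "\<And>x a b. x \<in> chart_image c \<Longrightarrow> ext_d (\<lambda>x a. \<Sum>k\<in>UNIV. \<xi> k x * a $ k) x a b = 0"
      using almost_constant_chart[OF assms(1) scalar stretch] by blast
    then show ?thesis unfolding P_def ShC_def C_def by (intro exI[of _ \<xi>]) auto
  qed
  then have "\<forall>c\<in>A. \<exists>\<xi>. P c \<xi>"
    by blast
  from bchoice[OF this] obtain \<xi> where \<xi>': "\<forall>c\<in>A. P c (\<xi> c)"
    by blast
  have \<xi>: "c \<in> A \<Longrightarrow> smooth_on (chart_image c) (\<xi> c k)"
      "c \<in> A \<Longrightarrow> (x, y) \<in> slit_over (chart_image c) \<Longrightarrow>
        ShC c (x, y) = C * rep A F c (x, y) + (\<Sum>k\<in>UNIV. \<xi> c k x * y $ k)"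
      "c \<in> A \<Longrightarrow> x \<in> chart_image c \<Longrightarrow> ext_d (\<lambda>x a. \<Sum>k\<in>UNIV. \<xi> c k x * a $ k) x a b = 0" for c k x y a b
    using \<xi>' unfolding P_def by blast+
  \<comment> \<open>The global form takes points and vectors without reference to a chart, so one
    chart around each point is picked; \<open>rep\<Xi>\<close> below shows that the choice is
    immaterial.\<close>
  define ch where "ch p = (SOME c. c \<in> A \<and> p \<in> fst c)" for p
  have ch: "ch p \<in> A" "p \<in> fst (ch p)" if "p \<in> topspace X" for p
  proof -
    have "\<exists>c. c \<in> A \<and> p \<in> fst c"
      using assms(2) that unfolding smooth_manifold_def by blast
    from someI_ex[OF this] show "ch p \<in> A" "p \<in> fst (ch p)" by (auto simp: ch_def)
  qed
  define \<Xi> where "\<Xi> p v = (\<Sum>k\<in>UNIV. \<xi> (ch p) k (snd (ch p) p) * v (ch p) $ k)" for p and v :: "('m, 'n) tvec"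
  \<comment> \<open>\<open>Sh\<close> and F take the same values at corresponding vectors of two
    charts (\<open>Sh_lift\<close>, \<open>rep_transition\<close>), hence so does the part of
    \<open>Sh\<close> that is linear in y.\<close>
  have rep\<Xi>: "rep_form A \<Xi> c x a = (\<Sum>k\<in>UNIV. \<xi> c k x * a $ k)" if c: "c \<in> A" and x: "x \<in> chart_image c" for c x a
  \<comment> \<open>The zero vector lies outside the slit bundle, where the comparison of
    \<open>Sh\<close> takes place, and is settled by linearity.\<close>
  proof (cases "a = 0")
    case True
    define p where "p = chart_inv c x"
    have p: "p \<in> fst c" "p \<in> topspace X" using chart_inv_mem[OF x] chart_sub[OF c] by (auto simp: p_def)
    show ?thesis
      using True c p ch[OF p(2)] by (simp add: rep_form_def p_def[symmetric] \<Xi>_def coord_vec_apply linear_0[OF linear_jacobian])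
  next
    case False
    define p where "p = chart_inv c x"
    have p: "p \<in> fst c" "p \<in> topspace X" "x = snd c p"
      using chart_inv_mem[OF x] chart_sub[OF c] snd_chart_inv[OF x] by (auto simp: p_def)
    note cp = ch[OF p(2)]
    let ?c = "ch p"
    interpret chart_change "chart_image c" "rep A F c" "\<sigma> c" "chart_image ?c" "rep A F ?c" "\<sigma> ?c" "overlap c ?c" "transition c ?c"
      by (rule chart_change_transition[OF assms(3,4) c cp(1)])
    have z: "(x, a) \<in> slit_over (overlap c ?c)"
      using False p cp by (simp add: slit_over_def overlap_mem)
    have lift: "lift (x, a) = (snd ?c p, jacobian c ?c p a)"
      using c p by (simp add: lift_def jacobian_dd transition_snd)
    have "ShC c (x, a) = ShC ?c (snd ?c p, jacobian c ?c p a)"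
      using Sh_lift[OF z] by (simp add: ShC_def lift)
    moreover have "rep A F c (x, a) = rep A F ?c (snd ?c p, jacobian c ?c p a)"
      unfolding p(3) by (rule rep_transition[OF c cp(1) p(1) cp(2)])
    moreover have "(x, a) \<in> slit_over (chart_image c)" by (rule SO_Om[OF z])
    moreover have "(snd ?c p, jacobian c ?c p a) \<in> slit_over (chart_image ?c)"
      using lift_mem[OF z] by (simp add: lift)
    ultimately have "(\<Sum>k\<in>UNIV. \<xi> c k x * a $ k) = (\<Sum>k\<in>UNIV. \<xi> ?c k (snd ?c p) * jacobian c ?c p a $ k)"
      using \<xi>(2)[OF c] \<xi>(2)[OF cp(1)] by simp
    then show ?thesis
      using cp by (simp add: rep_form_def p_def[symmetric] \<Xi>_def coord_vec_apply)
  qed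
  have "smooth_one_form X A \<Xi>"
    unfolding smooth_one_form_def
  proof (intro conjI ballI allI)
    show "\<Xi> p (\<lambda>c. s *\<^sub>R v c + t *\<^sub>R w c) = s * \<Xi> p v + t * \<Xi> p w" for p v w s t
      by (simp add: \<Xi>_def distrib_left sum.distrib sum_distrib_left mult.left_commute)
    show "smooth_on (chart_image c) (\<lambda>x. rep_form A \<Xi> c x a)" if c: "c \<in> A" for c a
    proof (rule smooth_on_congI)
      show "smooth_on (chart_image c) (\<lambda>x. \<Sum>k\<in>UNIV. \<xi> c k x * a $ k)"
        by (intro smooth_on_sum smooth_on_mult smooth_on_const \<xi>(1)[OF c] chart_open[OF c])
    qed (rule rep\<Xi>[OF c])
  qed
  moreover have "closed_one_form A \<Xi>"
    unfolding closed_one_form_def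
  proof (intro ballI allI)
    fix c x a b assume c: "c \<in> A" and x: "x \<in> chart_image c"
    have "ext_d (rep_form A \<Xi> c) x a b = ext_d (\<lambda>x a. \<Sum>k\<in>UNIV. \<xi> c k x * a $ k) x a b"
      by (rule ext_d_cong[OF chart_open[OF c] x rep\<Xi>[OF c]])
    then show "ext_d (rep_form A \<Xi> c) x a b = 0" by (simp add: \<xi>(3)[OF c x])
  qed
  moreover have "S_curvature (rep A F c) (\<sigma> c) z = C + pullback_form (rep_form A \<Xi> c) z (reeb (rep A F c) z)"
    if c: "c \<in> A" and z: "z \<in> sphere_bundle A F c" for c z
  proof -
    let ?f = "rep A F c"
    interpret finsler_density "chart_image c" ?f "\<sigma> c"
      by (rule finsler_density_chart[OF assms(3,4) c])
    have zOm: "z \<in> Om" and f1: "?f z = 1" using z by (auto simp: sphere_bundle_def slit_eq)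
    have x: "fst z \<in> chart_image c" using zOm by (simp add: slit_over_def)
    have "S_curvature ?f (\<sigma> c) z = C + (\<Sum>k\<in>UNIV. \<xi> c k (fst z) * snd z $ k)"
      using S_curvature_eq[OF zOm] f1 \<xi>(2)[OF c, of "fst z" "snd z"] zOm by (simp add: ShC_def)
    \<comment> \<open>Where F = 1 the Reeb field projects to y itself, so the pulled-back form takes
      the value of xi on y.\<close>
    moreover have "fst (reeb ?f z) = snd z"
      unfolding reeb_eq spray_vector_eq[OF zOm] using f1 by simp
    ultimately show ?thesis by (simp add: pullback_form_def rep\<Xi>[OF c x])
  qed
  ultimately show ?thesis unfolding C_def by (intro exI[of _ \<Xi>]) auto
qed

end
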